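(* Let $n,N\in\mathbb N$, $\mu\in\mathbb R$, let $a\in S^\mu(\mathbb R^n;\mathbb C^{N\times N})$, and assume that the Cauchy problem $$\partial_t u-\operatorname{op}[a]u=0\quad(t>0),\qquad u(0)=u_0$$ is quasi-hyperbolic. Then for every $u_0\in\mathscr S'(\mathbb R^n;\mathbb C^N)$ there exists a unique solution $u\in C^1([0,\infty);\mathscr S'(\mathbb R^n;\mathbb C^N))$ of this Cauchy problem. This solution is given by $u(t)=\operatorname{op}[e^{ta(\cdot)}]u_0$. Moreover, the family $(T(t))_{t\ge0}$ with $T(t):=\operatorname{op}[e^{ta(\cdot)}]$ is a locally uniformly bounded semigroup on $\mathscr S'(\mathbb R^n;\mathbb C^N)$. The analogous results hold with $\mathscr S'(\mathbb R^n;\mathbb C^N)$ replaced by $\mathscr S(\mathbb R^n;\mathbb C^N)$: for every $u_0\in\mathscr S(\mathbb R^n;\mathbb C^N)$ there exists a unique solution $u\in C^1([0,\infty);\mathscr S(\mathbb R^n;\mathbb C^N))$, it is given by $u(t)=\operatorname{op}[e^{ta(\cdot)}]u_0$, and $(\operatorname{op}[e^{ta(\cdot)}])_{t\ge0}$ is a locally uniformly bounded semigroup on $\mathscr S(\mathbb R^n;\mathbb C^N)$.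
   Context: Notation: $\langle\xi\rangle:=(1+|\xi|^2)^{1/2}$. $S^\mu(\mathbb R^n;\mathbb C^{N\times N})$ is the set of all $a\in C^\infty(\mathbb R^n;\mathbb C^{N\times N})$ such that for each $\alpha\in\mathbb N_0^n$ there is $C_\alpha>0$ with $|\partial_\xi^\alpha a(\xi)|\le C_\alpha\langle\xi\rangle^{\mu-|\alpha|}$ for all $\xi\in\mathbb R^n$. $\mathcal O_M(\mathbb R^n;\mathbb C^{N\times N})$ is the set of all $a\in C^\infty(\mathbb R^n;\mathbb C^{N\times N})$ such that for each $\alpha$ there are $C_\alpha,m_\alpha>0$ with $|\partial^\alpha a(\xi)|\le C_\alpha\langle\xi\rangle^{m_\alpha}$ for all $\xi$. $\mathscr S(\mathbb R^n;\mathbb C^N)$ is the Schwartz space and $\mathscr S'(\mathbb R^n;\mathbb C^N)=L(\mathscr S(\mathbb R^n);\mathbb C^N)$ the space of $\mathbb C^N$-valued tempered distributions (with the strong topology of uniform convergence on bounded sets). The Fourier transform is $(\mathscr F\varphi)(\xi)=(2\pi)^{-n/2}\int_{\mathbb R^n}e^{ix\cdot\xi}\varphi(x)\,dx$, extended by duality to tempered distributions. For $a\in\mathcal O_M(\mathbb R^n;\mathbb C^{N\times N})$, $\operatorname{op}[a]:=\mathscr F^{-1}a\mathscr F$, acting as a continuous linear operator on $\mathscr S(\mathbb R^n;\mathbb C^N)$ and on $\mathscr S'(\mathbb R^n;\mathbb C^N)$, where $(au)_j=\sum_k a_{jk}u_k$. The Cauchy problem (or $a$) is called quasi-hyperbolic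 if there is $M_a\in\mathbb R$ such that $\det(\lambda-a(\xi))\ne0$ for all $\xi\in\mathbb R^n$ and all $\lambda\in\mathbb C$ with $\operatorname{Re}\lambda>M_a$. A locally uniformly bounded semigroup on a locally convex space $E$ is a family $(T(t))_{t\ge0}$ of continuous linear operators on $E$ with $T(0)=I$, $T(t+s)=T(t)T(s)$ for $s,t\ge 0$, such that for every $T_0>0$ the set $\{T(t):0\le t\le T_0\}$ is bounded in the space of continuous linear operators on $E$ (equivalently, for the spaces considered here, equicontinuous). *)

theory Defs
  imports "HOL-Analysis.Analysis"
begin

section \<open>Complex vector spaces\<close>

class complex_vector = real_vector +
  fixes scaleC :: "complex \<Rightarrow> 'a \<Rightarrow> 'a"  (infixr "*\<^sub>C" 75)
  assumes scaleC_add_right: "c *\<^sub>C (x + y) = c *\<^sub>C x + c *\<^sub>C y"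
    and scaleC_add_left: "(c + d) *\<^sub>C x = c *\<^sub>C x + d *\<^sub>C x"
    and scaleC_scaleC: "c *\<^sub>C d *\<^sub>C x = (c * d) *\<^sub>C x"
    and scaleC_of_real: "complex_of_real r *\<^sub>C x = r *\<^sub>R x"

class complex_normed_vector = complex_vector + real_normed_vector +
  assumes norm_scaleC: "norm (c *\<^sub>C x) = cmod c * norm x"

lemma scaleC_one: "1 *\<^sub>C x = (x :: 'a::complex_vector)"
  and scaleC_minus_one: "(- 1) *\<^sub>C x = - (x :: 'a::complex_vector)"
  using scaleC_of_real[of 1 x] scaleC_of_real[of "- 1" x] by simp_all

lemma vector_space_scaleC: "vector_space (scaleC :: complex \<Rightarrow> 'a::complex_vector \<Rightarrow> 'a)"
  by standard (simp_all add: scaleC_add_right scaleC_add_left scaleC_scaleC scaleC_one)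

abbreviation clinear :: "('a::complex_vector \<Rightarrow> 'b::complex_vector) \<Rightarrow> bool" where
  "clinear \<equiv> Vector_Spaces.linear scaleC scaleC"

lemma clinear_iff:
  "clinear f \<longleftrightarrow> (\<forall>x y. f (x + y) = f x + f y) \<and> (\<forall>c x. f (c *\<^sub>C x) = c *\<^sub>C f x)"
  by (simp add: Vector_Spaces.linear_iff vector_space_scaleC)

lemma bounded_linear_scaleC: "bounded_linear (\<lambda>x::'a::complex_normed_vector. c *\<^sub>C x)"
proof (rule bounded_linear_intro[where K = "cmod c"])
  fix r :: real and x :: 'a
  show "c *\<^sub>C r *\<^sub>R x = r *\<^sub>R c *\<^sub>C x"
    by (simp add: scaleC_of_real[symmetric] scaleC_scaleC mult.commute)
qed (simp_all add: scaleC_add_right norm_scaleC mult.commute)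

instantiation complex :: complex_normed_vector
begin

definition scaleC_complex :: "complex \<Rightarrow> complex \<Rightarrow> complex" where
  "scaleC_complex c z = c * z"

instance
  by standard (simp_all add: scaleC_complex_def algebra_simps norm_mult scaleR_conv_of_real)

end

instantiation vec :: (complex_vector, finite) complex_vector
begin

definition scaleC_vec :: "complex \<Rightarrow> 'a ^ 'b \<Rightarrow> 'a ^ 'b" where
  "scaleC_vec c v = (\<chi> i. c *\<^sub>C (v $ i))"

instance
  by standard
    (simp_all add: scaleC_vec_def vec_eq_iff scaleC_add_right scaleC_add_left
      scaleC_scaleC scaleC_of_real)

end

instance vec :: (complex_normed_vector, finite) complex_normed_vector
  by standard (simp add: scaleC_vec_def norm_vec_def norm_scaleC L2_set_right_distrib)


section \<open>Partial derivatives\<close>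

definition partial ::
  "'n::finite \<Rightarrow> (real ^ 'n \<Rightarrow> 'b::real_normed_vector) \<Rightarrow> real ^ 'n \<Rightarrow> 'b" where
  "partial i f x = frechet_derivative f (at x) (axis i 1)"

primrec iter_partial ::
  "'n::finite list \<Rightarrow> (real ^ 'n \<Rightarrow> 'b::real_normed_vector) \<Rightarrow> real ^ 'n \<Rightarrow> 'b" where
  "iter_partial [] f = f"
| "iter_partial (i # is) f = partial i (iter_partial is f)"

text \<open>If all iterated partial derivatives are (Frechet) differentiable everywhere, then they are
  in particular continuous, so this is membership in $C^\infty$.\<close>

definition smooth :: "(real ^ 'n::finite \<Rightarrow> 'b::real_normed_vector) \<Rightarrow> bool" where
  "smooth f \<longleftrightarrow> (\<forall>is x. iter_partial is f differentiable (at x))"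

text \<open>For smooth functions partial derivatives commute, so it does not matter in which order the
  \<open>\<alpha> $ i\<close> derivatives in the directions \<open>i\<close> are taken.\<close>

definition mpartial ::
  "nat ^ 'n \<Rightarrow> (real ^ 'n::finite \<Rightarrow> 'b::real_normed_vector) \<Rightarrow> real ^ 'n \<Rightarrow> 'b" where
  "mpartial \<alpha> f = iter_partial (SOME is. \<forall>i. count_list is i = \<alpha> $ i) f"

definition mi_order :: "nat ^ 'n::finite \<Rightarrow> nat" where
  "mi_order \<alpha> = (\<Sum>i\<in>UNIV. \<alpha> $ i)"

definition jbracket :: "'a::real_normed_vector \<Rightarrow> real" where
  "jbracket \<xi> = sqrt (1 + (norm \<xi>)\<^sup>2)"

lemma jbracket_ge_0: "jbracket \<xi> \<ge> 0"
  by (simp add: jbracket_def)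

lemma iter_partial_add:
  assumes "smooth f" "smooth g"
  shows "iter_partial is (\<lambda>x. f x + g x) = (\<lambda>x. iter_partial is f x + iter_partial is g x)"
proof (induction "is")
  case (Cons i "is")
  have "partial i (\<lambda>x. iter_partial is f x + iter_partial is g x) x =
      partial i (iter_partial is f) x + partial i (iter_partial is g) x" for x
  proof -
    have "iter_partial is f differentiable (at x)" "iter_partial is g differentiable (at x)"
      using assms by (auto simp: smooth_def)
    then have "((\<lambda>x. iter_partial is f x + iter_partial is g x) has_derivative
        (\<lambda>h. frechet_derivative (iter_partial is f) (at x) h
           + frechet_derivative (iter_partial is g) (at x) h)) (at x)"
      by (intro has_derivative_add) (simp_all add: frechet_derivative_works[symmetric])
    from frechet_derivative_at[OF this, symmetric] show ?thesis
      by (simp add: partial_def)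
  qed
  then show ?case by (auto simp: Cons)
qed simp

lemma iter_partial_bounded_linear:
  assumes "bounded_linear L" "smooth f"
  shows "iter_partial is (\<lambda>x. L (f x)) = (\<lambda>x. L (iter_partial is f x))"
proof (induction "is")
  case (Cons i "is")
  have "partial i (\<lambda>x. L (iter_partial is f x)) x = L (partial i (iter_partial is f) x)" for x
  proof -
    have "iter_partial is f differentiable (at x)"
      using assms by (auto simp: smooth_def)
    then have "((\<lambda>x. L (iter_partial is f x)) has_derivative
        (\<lambda>h. L (frechet_derivative (iter_partial is f) (at x) h))) (at x)"
      by (intro bounded_linear.has_derivative[OF assms(1)])
        (simp add: frechet_derivative_works[symmetric])
    from frechet_derivative_at[OF this, symmetric] show ?thesis
      by (simp add: partial_def)
  qed
  then show ?case by (auto simp: Cons)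
qed simp

lemma smooth_add: "smooth f \<Longrightarrow> smooth g \<Longrightarrow> smooth (\<lambda>x. f x + g x)"
  by (subst smooth_def, simp only: iter_partial_add) (auto simp: smooth_def intro: differentiable_add)

lemma smooth_bounded_linear:
  assumes "bounded_linear L" "smooth f"
  shows "smooth (\<lambda>x. L (f x))"
  unfolding smooth_def
proof (intro allI)
  fix "is" x
  have "iter_partial is f differentiable (at x)"
    using assms(2) by (simp add: smooth_def)
  then show "iter_partial is (\<lambda>x. L (f x)) differentiable (at x)"
    unfolding iter_partial_bounded_linear[OF assms] differentiable_def
    using bounded_linear.has_derivative[OF assms(1)] by blast
qed

lemma iter_partial_0: "iter_partial is (\<lambda>x. 0) = (\<lambda>x. 0)"
proof (induction "is")
  case (Cons i "is")
  have "partial i (\<lambda>x. 0) = (\<lambda>x. 0)"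
    by (simp add: partial_def fun_eq_iff frechet_derivative_const)
  with Cons show ?case by simp
qed simp

lemma smooth_0: "smooth (\<lambda>x. 0)"
  by (simp add: smooth_def iter_partial_0)


section \<open>Symbols\<close>

definition symbol_class :: "real \<Rightarrow> (real ^ 'n::finite \<Rightarrow> complex ^ 'N::finite ^ 'N) set" where
  "symbol_class \<mu> = {a. smooth a \<and>
     (\<forall>\<alpha>. \<exists>C>0. \<forall>\<xi>. norm (mpartial \<alpha> a \<xi>) \<le> C * jbracket \<xi> powr (\<mu> - real (mi_order \<alpha>)))}"

definition O_M :: "(real ^ 'n::finite \<Rightarrow> complex ^ 'N::finite ^ 'N) set" where
  "O_M = {a. smooth a \<and>
     (\<forall>\<alpha>. \<exists>C>0. \<exists>m>0. \<forall>\<xi>. norm (mpartial \<alpha> a \<xi>) \<le> C * jbracket \<xi> powr m)}"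

definition quasi_hyperbolic :: "(real ^ 'n::finite \<Rightarrow> complex ^ 'N::finite ^ 'N) \<Rightarrow> bool" where
  "quasi_hyperbolic a \<longleftrightarrow>
     (\<exists>M::real. \<forall>\<xi>. \<forall>z::complex. Re z > M \<longrightarrow> det (mat z - a \<xi>) \<noteq> 0)"

text \<open>The class-based \<open>exp\<close> is not usable here: multiplication on \<open>complex ^ 'N ^ 'N\<close> is
  componentwise.\<close>

definition matexp :: "complex ^ 'N::finite ^ 'N \<Rightarrow> complex ^ 'N ^ 'N" where
  "matexp A = (\<Sum>k. (1 / fact k) *\<^sub>R (((**) A ^^ k) (mat 1)))"


section \<open>The Schwartz space\<close>

definition is_schwartz :: "(real ^ 'n::finite \<Rightarrow> 'b::real_normed_vector) \<Rightarrow> bool" where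
  "is_schwartz f \<longleftrightarrow> smooth f \<and>
     (\<forall>(k::nat) \<alpha>. bdd_above (range (\<lambda>x. jbracket x ^ k * norm (mpartial \<alpha> f x))))"

lemma is_schwartz_0: "is_schwartz (\<lambda>x. 0)"
  by (simp add: is_schwartz_def smooth_0 mpartial_def iter_partial_0)

lemma is_schwartzD:
  assumes "is_schwartz f"
  shows "\<exists>A. \<forall>x. jbracket x ^ k * norm (mpartial \<alpha> f x) \<le> A"
proof -
  have "bdd_above (range (\<lambda>x. jbracket x ^ k * norm (mpartial \<alpha> f x)))"
    using assms by (simp add: is_schwartz_def)
  then show ?thesis by (auto simp: bdd_above_def)
qed

lemma is_schwartz_add:
  assumes "is_schwartz f" "is_schwartz g"
  shows "is_schwartz (\<lambda>x. f x + g x)"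
  unfolding is_schwartz_def
proof (intro conjI allI)
  have sm: "smooth f" "smooth g"
    using assms by (auto simp: is_schwartz_def)
  show "smooth (\<lambda>x. f x + g x)"
    by (rule smooth_add[OF sm])
  fix k \<alpha>
  obtain A where A: "\<And>x. jbracket x ^ k * norm (mpartial \<alpha> f x) \<le> A"
    using is_schwartzD[OF assms(1)] by blast
  obtain B where B: "\<And>x. jbracket x ^ k * norm (mpartial \<alpha> g x) \<le> B"
    using is_schwartzD[OF assms(2)] by blast
  have "jbracket x ^ k * norm (mpartial \<alpha> (\<lambda>x. f x + g x) x) \<le> A + B" for x
  proof -
    have "jbracket x ^ k * norm (mpartial \<alpha> (\<lambda>x. f x + g x) x)
        \<le> jbracket x ^ k * (norm (mpartial \<alpha> f x) + norm (mpartial \<alpha> g x))"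
      by (auto simp: mpartial_def iter_partial_add[OF sm] jbracket_ge_0
          intro!: mult_left_mono norm_triangle_ineq)
    with A[of x] B[of x] show ?thesis
      by (simp add: distrib_left)
  qed
  then show "bdd_above (range (\<lambda>x. jbracket x ^ k * norm (mpartial \<alpha> (\<lambda>x. f x + g x) x)))"
    by (rule bdd_aboveI2)
qed

lemma is_schwartz_bounded_linear:
  assumes L: "bounded_linear L" and f: "is_schwartz f"
  shows "is_schwartz (\<lambda>x. L (f x))"
  unfolding is_schwartz_def
proof (intro conjI allI)
  have sm: "smooth f"
    using f by (simp add: is_schwartz_def)
  show "smooth (\<lambda>x. L (f x))"
    by (rule smooth_bounded_linear[OF L sm])
  fix k \<alpha>
  obtain K where K: "K \<ge> 0" "\<And>x. norm (L x) \<le> norm x * K"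
    using bounded_linear.nonneg_bounded[OF L] by blast
  obtain A where A: "\<And>x. jbracket x ^ k * norm (mpartial \<alpha> f x) \<le> A"
    using is_schwartzD[OF f] by blast
  have "jbracket x ^ k * norm (mpartial \<alpha> (\<lambda>x. L (f x)) x) \<le> A * K" for x
  proof -
    have "jbracket x ^ k * norm (mpartial \<alpha> (\<lambda>x. L (f x)) x)
        \<le> jbracket x ^ k * (norm (mpartial \<alpha> f x) * K)"
      by (auto simp: mpartial_def iter_partial_bounded_linear[OF L sm] jbracket_ge_0
          intro!: mult_left_mono K)
    also have "\<dots> \<le> A * K"
      using mult_right_mono[OF A[of x] K(1)] by (simp add: mult.assoc)
    finally show ?thesis .
  qed
  then show "bdd_above (range (\<lambda>x. jbracket x ^ k * norm (mpartial \<alpha> (\<lambda>x. L (f x)) x)))"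
    by (rule bdd_aboveI2)
qed

typedef (overloaded) ('n::finite, 'b::real_normed_vector) schwartz =
  "{f :: real ^ 'n \<Rightarrow> 'b. is_schwartz f}"
  using is_schwartz_0 by blast

setup_lifting type_definition_schwartz

instantiation schwartz :: (finite, real_normed_vector) real_vector
begin

lift_definition zero_schwartz :: "('a, 'b) schwartz" is "\<lambda>x. 0"
  by (rule is_schwartz_0)

lift_definition plus_schwartz :: "('a, 'b) schwartz \<Rightarrow> ('a, 'b) schwartz \<Rightarrow> ('a, 'b) schwartz"
  is "\<lambda>f g x. f x + g x"
  by (rule is_schwartz_add)

lift_definition scaleR_schwartz :: "real \<Rightarrow> ('a, 'b) schwartz \<Rightarrow> ('a, 'b) schwartz"
  is "\<lambda>r f x. r *\<^sub>R f x"
  by (rule is_schwartz_bounded_linear[OF bounded_linear_scaleR_right])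

lift_definition uminus_schwartz :: "('a, 'b) schwartz \<Rightarrow> ('a, 'b) schwartz"
  is "\<lambda>f x. - f x"
  by (rule is_schwartz_bounded_linear[OF bounded_linear_minus[OF bounded_linear_ident]])

definition minus_schwartz :: "('a, 'b) schwartz \<Rightarrow> ('a, 'b) schwartz \<Rightarrow> ('a, 'b) schwartz" where
  "minus_schwartz f g = f + - g"

instance
proof
  fix f g h :: "('a, 'b) schwartz" and r s :: real
  note eqs = Rep_schwartz_inject[symmetric] zero_schwartz.rep_eq plus_schwartz.rep_eq
    scaleR_schwartz.rep_eq uminus_schwartz.rep_eq fun_eq_iff
  show "f + g + h = f + (g + h)" "f + g = g + f" "0 + f = f" "- f + f = 0"
    by (simp_all add: eqs algebra_simps)
  show "r *\<^sub>R (f + g) = r *\<^sub>R f + r *\<^sub>R g" "(r + s) *\<^sub>R f = r *\<^sub>R f + s *\<^sub>R f"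
    by (simp_all add: eqs scaleR_add_right scaleR_add_left)
  show "r *\<^sub>R s *\<^sub>R f = (r * s) *\<^sub>R f" "1 *\<^sub>R f = f"
    by (simp_all add: eqs)
qed (simp add: minus_schwartz_def)

end

instantiation schwartz :: (finite, complex_normed_vector) complex_vector
begin

lift_definition scaleC_schwartz :: "complex \<Rightarrow> ('a, 'b) schwartz \<Rightarrow> ('a, 'b) schwartz"
  is "\<lambda>c f x. c *\<^sub>C f x"
  by (rule is_schwartz_bounded_linear[OF bounded_linear_scaleC])

instance
  by standard
    (simp_all add: Rep_schwartz_inject[symmetric] plus_schwartz.rep_eq scaleR_schwartz.rep_eq
      scaleC_schwartz.rep_eq fun_eq_iff scaleC_add_right scaleC_add_left scaleC_scaleC scaleC_of_real)

end

definition schwartz_seminorm ::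
  "nat \<Rightarrow> nat ^ 'n \<Rightarrow> ('n::finite, 'b::real_normed_vector) schwartz \<Rightarrow> real" where
  "schwartz_seminorm k \<alpha> f = (SUP x. jbracket x ^ k * norm (mpartial \<alpha> (Rep_schwartz f) x))"

instantiation schwartz :: (finite, real_normed_vector) topological_space
begin

definition open_schwartz :: "('a, 'b) schwartz set \<Rightarrow> bool" where
  "open_schwartz U \<longleftrightarrow> (\<forall>f\<in>U. \<exists>F (\<epsilon>::real). finite F \<and> \<epsilon> > 0 \<and>
     {g. \<forall>(k, \<alpha>)\<in>F. schwartz_seminorm k \<alpha> (g - f) < \<epsilon>} \<subseteq> U)"

instance
proof
  show "open (UNIV :: ('a, 'b) schwartz set)"
    unfolding open_schwartz_def by (auto intro!: exI[of _ "{}"] exI[of _ "1::real"])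
next
  fix S T :: "('a, 'b) schwartz set"
  assume S: "open S" and T: "open T"
  show "open (S \<inter> T)"
    unfolding open_schwartz_def
  proof
    fix f assume f: "f \<in> S \<inter> T"
    obtain F d where F: "finite F" "d > (0::real)"
      "{g. \<forall>(k, \<alpha>)\<in>F. schwartz_seminorm k \<alpha> (g - f) < d} \<subseteq> S"
      using S f unfolding open_schwartz_def by blast
    obtain G e where G: "finite G" "e > (0::real)"
      "{g. \<forall>(k, \<alpha>)\<in>G. schwartz_seminorm k \<alpha> (g - f) < e} \<subseteq> T"
      using T f unfolding open_schwartz_def by blast
    have "{g. \<forall>(k, \<alpha>)\<in>F \<union> G. schwartz_seminorm k \<alpha> (g - f) < min d e} \<subseteq> S \<inter> T"
      using F(3) G(3) by fastforce
    then show "\<exists>F (\<epsilon>::real). finite F \<and> \<epsilon> > 0 \<and>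
        {g. \<forall>(k, \<alpha>)\<in>F. schwartz_seminorm k \<alpha> (g - f) < \<epsilon>} \<subseteq> S \<inter> T"
      using F(1,2) G(1,2) by (intro exI[of _ "F \<union> G"] exI[of _ "min d e"]) simp
  qed
next
  fix K :: "('a, 'b) schwartz set set"
  assume K: "\<forall>S\<in>K. open S"
  show "open (\<Union>K)"
    unfolding open_schwartz_def
  proof
    fix u assume "u \<in> \<Union>K"
    then obtain S where S: "S \<in> K" "u \<in> S" by blast
    then have "open S" using K by blast
    then obtain F e where F: "finite F" "e > (0::real)"
      "{g. \<forall>(k, \<alpha>)\<in>F. schwartz_seminorm k \<alpha> (g - u) < e} \<subseteq> S"
      using S(2) unfolding open_schwartz_def by blast
    from F(3) S(1) have "{g. \<forall>(k, \<alpha>)\<in>F. schwartz_seminorm k \<alpha> (g - u) < e} \<subseteq> \<Union>K"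
      by (rule order_trans[OF _ Sup_upper])
    with F(1,2) show "\<exists>F (\<epsilon>::real). finite F \<and> \<epsilon> > 0 \<and>
        {g. \<forall>(k, \<alpha>)\<in>F. schwartz_seminorm k \<alpha> (g - u) < \<epsilon>} \<subseteq> \<Union>K"
      by (intro exI conjI)
  qed
qed

end


section \<open>Tempered distributions\<close>

definition vn_bounded :: "'a::{real_vector, topological_space} set \<Rightarrow> bool" where
  "vn_bounded B \<longleftrightarrow> (\<forall>U. open U \<and> 0 \<in> U \<longrightarrow> (\<exists>r>0. \<forall>s>r. B \<subseteq> (\<lambda>x. s *\<^sub>R x) ` U))"

lemma vn_bounded_Un:
  assumes "vn_bounded A" "vn_bounded B"
  shows "vn_bounded (A \<union> B)"
  unfolding vn_bounded_def
proof (intro allI impI)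
  fix U :: "'a set" assume U: "open U \<and> 0 \<in> U"
  obtain r where r: "r > 0" "\<And>s. s > r \<Longrightarrow> A \<subseteq> (\<lambda>x. s *\<^sub>R x) ` U"
    using assms(1) U unfolding vn_bounded_def by blast
  obtain q where q: "q > 0" "\<And>s. s > q \<Longrightarrow> B \<subseteq> (\<lambda>x. s *\<^sub>R x) ` U"
    using assms(2) U unfolding vn_bounded_def by blast
  have "A \<union> B \<subseteq> (\<lambda>x. s *\<^sub>R x) ` U" if "s > max r q" for s
    using r(2)[of s] q(2)[of s] that by simp
  with r(1) show "\<exists>r>0. \<forall>s>r. A \<union> B \<subseteq> (\<lambda>x. s *\<^sub>R x) ` U"
    by (intro exI[of _ "max r q"] conjI allI impI) simp_all
qed

lemma vn_bounded_empty: "vn_bounded {}"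
  unfolding vn_bounded_def by (auto intro: exI[of _ 1])

typedef (overloaded) ('n::finite, 'N::finite) tempered =
  "{u :: ('n, complex) schwartz \<Rightarrow> complex ^ 'N. clinear u \<and> continuous_on UNIV u}"
  by (rule exI[of _ "\<lambda>_. 0"]) (simp add: clinear_iff scaleC_vec_def scaleC_complex_def vec_eq_iff)

setup_lifting type_definition_tempered

instantiation tempered :: (finite, finite) complex_vector
begin

lift_definition zero_tempered :: "('a, 'b) tempered" is "\<lambda>\<phi>. 0"
  by (simp add: clinear_iff scaleC_vec_def scaleC_complex_def vec_eq_iff)

lift_definition plus_tempered :: "('a, 'b) tempered \<Rightarrow> ('a, 'b) tempered \<Rightarrow> ('a, 'b) tempered"
  is "\<lambda>u v \<phi>. u \<phi> + v \<phi>"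
  by (auto simp: clinear_iff scaleC_add_right intro: continuous_on_add)

lift_definition scaleC_tempered :: "complex \<Rightarrow> ('a, 'b) tempered \<Rightarrow> ('a, 'b) tempered"
  is "\<lambda>c u \<phi>. c *\<^sub>C u \<phi>"
  by (auto simp: clinear_iff scaleC_add_right scaleC_scaleC mult.commute
      intro: bounded_linear.continuous_on[OF bounded_linear_scaleC])

definition scaleR_tempered :: "real \<Rightarrow> ('a, 'b) tempered \<Rightarrow> ('a, 'b) tempered" where
  "scaleR_tempered r u = complex_of_real r *\<^sub>C u"

definition uminus_tempered :: "('a, 'b) tempered \<Rightarrow> ('a, 'b) tempered" where
  "uminus_tempered u = (- 1) *\<^sub>C u"

definition minus_tempered :: "('a, 'b) tempered \<Rightarrow> ('a, 'b) tempered \<Rightarrow> ('a, 'b) tempered" where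
  "minus_tempered u v = u + - v"

instance
proof
  fix u v w :: "('a, 'b) tempered" and c d :: complex and r s :: real
  note eqs = Rep_tempered_inject[symmetric] zero_tempered.rep_eq plus_tempered.rep_eq
    scaleC_tempered.rep_eq scaleR_tempered_def uminus_tempered_def minus_tempered_def fun_eq_iff
  note scale = scaleC_one scaleC_minus_one scaleC_add_right scaleC_add_left scaleC_scaleC
  show "u + v + w = u + (v + w)" "u + v = v + u" "0 + u = u"
    by (simp_all add: eqs algebra_simps)
  show "c *\<^sub>C (u + v) = c *\<^sub>C u + c *\<^sub>C v" "(c + d) *\<^sub>C u = c *\<^sub>C u + d *\<^sub>C u"
    "c *\<^sub>C d *\<^sub>C u = (c * d) *\<^sub>C u"
    by (simp_all add: eqs scale)
  show "r *\<^sub>R (u + v) = r *\<^sub>R u + r *\<^sub>R v" "(r + s) *\<^sub>R u = r *\<^sub>R u + s *\<^sub>R u"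
    "r *\<^sub>R s *\<^sub>R u = (r * s) *\<^sub>R u" "1 *\<^sub>R u = u" "- u + u = 0"
    by (simp_all add: eqs scale)
qed (simp_all add: minus_tempered_def scaleR_tempered_def)

end

text \<open>The strong topology, i.e. uniform convergence on bounded sets of test functions.\<close>

instantiation tempered :: (finite, finite) topological_space
begin

definition open_tempered :: "('a, 'b) tempered set \<Rightarrow> bool" where
  "open_tempered U \<longleftrightarrow> (\<forall>u\<in>U. \<exists>B (\<epsilon>::real). vn_bounded B \<and> \<epsilon> > 0 \<and>
     {v. \<forall>\<phi>\<in>B. norm (Rep_tempered v \<phi> - Rep_tempered u \<phi>) < \<epsilon>} \<subseteq> U)"

instance
proof
  show "open (UNIV :: ('a, 'b) tempered set)"
    unfolding open_tempered_def by (auto intro!: exI[of _ "{}"] exI[of _ "1::real"] vn_bounded_empty)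
next
  fix S T :: "('a, 'b) tempered set"
  assume S: "open S" and T: "open T"
  show "open (S \<inter> T)"
    unfolding open_tempered_def
  proof
    fix u assume u: "u \<in> S \<inter> T"
    obtain B d where B: "vn_bounded B" "d > (0::real)"
      "{v. \<forall>\<phi>\<in>B. norm (Rep_tempered v \<phi> - Rep_tempered u \<phi>) < d} \<subseteq> S"
      using S u unfolding open_tempered_def by blast
    obtain C e where C: "vn_bounded C" "e > (0::real)"
      "{v. \<forall>\<phi>\<in>C. norm (Rep_tempered v \<phi> - Rep_tempered u \<phi>) < e} \<subseteq> T"
      using T u unfolding open_tempered_def by blast
    have "{v. \<forall>\<phi>\<in>B \<union> C. norm (Rep_tempered v \<phi> - Rep_tempered u \<phi>) < min d e} \<subseteq> S \<inter> T"
      using B(3) C(3) by fastforce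
    then show "\<exists>B (\<epsilon>::real). vn_bounded B \<and> \<epsilon> > 0 \<and>
        {v. \<forall>\<phi>\<in>B. norm (Rep_tempered v \<phi> - Rep_tempered u \<phi>) < \<epsilon>} \<subseteq> S \<inter> T"
      using B(1,2) C(1,2) vn_bounded_Un
      by (intro exI[of _ "B \<union> C"] exI[of _ "min d e"]) auto
  qed
next
  fix K :: "('a, 'b) tempered set set"
  assume K: "\<forall>S\<in>K. open S"
  show "open (\<Union>K)"
    unfolding open_tempered_def
  proof
    fix u assume "u \<in> \<Union>K"
    then obtain S where S: "S \<in> K" "u \<in> S" by blast
    then have "open S" using K by blast
    then obtain B e where B: "vn_bounded B" "e > (0::real)"
      "{v. \<forall>\<phi>\<in>B. norm (Rep_tempered v \<phi> - Rep_tempered u \<phi>) < e} \<subseteq> S"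
      using S(2) unfolding open_tempered_def by blast
    from B(3) S(1) have "{v. \<forall>\<phi>\<in>B. norm (Rep_tempered v \<phi> - Rep_tempered u \<phi>) < e} \<subseteq> \<Union>K"
      by (rule order_trans[OF _ Sup_upper])
    with B(1,2) show "\<exists>B (\<epsilon>::real). vn_bounded B \<and> \<epsilon> > 0 \<and>
        {v. \<forall>\<phi>\<in>B. norm (Rep_tempered v \<phi> - Rep_tempered u \<phi>) < \<epsilon>} \<subseteq> \<Union>K"
      by (intro exI conjI)
  qed
qed

end


section \<open>Fourier transform and the operators \<open>op[a]\<close>\<close>

text \<open>The Fourier transform and multiplication by a function in \<open>O_M\<close> map Schwartz functions to
  Schwartz functions and (by duality) tempered distributions to tempered distributions, so the
  abstraction functions below are applied to arguments in their proper range. The inverse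
  \<open>inv\<close> is the inverse of the bijection given by the Fourier transform on the respective space.\<close>

definition fourier ::
  "('n::finite, 'b::{complex_normed_vector, banach, second_countable_topology}) schwartz \<Rightarrow>
   ('n, 'b) schwartz" where
  "fourier \<phi> = Abs_schwartz (\<lambda>\<xi>. (2 * pi) powr (- real CARD('n) / 2) *\<^sub>R
     (\<integral>x. exp (\<i> * complex_of_real (x \<bullet> \<xi>)) *\<^sub>C Rep_schwartz \<phi> x \<partial>lborel))"

definition mult_schwartz ::
  "(real ^ 'n \<Rightarrow> complex ^ 'N ^ 'N) \<Rightarrow> ('n::finite, complex ^ 'N::finite) schwartz \<Rightarrow>
   ('n, complex ^ 'N) schwartz" where
  "mult_schwartz a \<phi> = Abs_schwartz (\<lambda>\<xi>. a \<xi> *v Rep_schwartz \<phi> \<xi>)"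

definition op_schwartz ::
  "(real ^ 'n \<Rightarrow> complex ^ 'N ^ 'N) \<Rightarrow> ('n::finite, complex ^ 'N::finite) schwartz \<Rightarrow>
   ('n, complex ^ 'N) schwartz" where
  "op_schwartz a \<phi> = inv fourier (mult_schwartz a (fourier \<phi>))"

definition mult_test ::
  "(real ^ 'n \<Rightarrow> complex) \<Rightarrow> ('n::finite, complex) schwartz \<Rightarrow> ('n, complex) schwartz" where
  "mult_test b \<phi> = Abs_schwartz (\<lambda>\<xi>. b \<xi> * Rep_schwartz \<phi> \<xi>)"

definition fourier_tempered ::
  "('n::finite, 'N::finite) tempered \<Rightarrow> ('n, 'N) tempered" where
  "fourier_tempered u = Abs_tempered (\<lambda>\<phi>. Rep_tempered u (fourier \<phi>))"

definition mult_tempered ::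
  "(real ^ 'n \<Rightarrow> complex ^ 'N ^ 'N) \<Rightarrow> ('n::finite, 'N::finite) tempered \<Rightarrow>
   ('n, 'N) tempered" where
  "mult_tempered a u =
     Abs_tempered (\<lambda>\<phi>. \<chi> j. \<Sum>k\<in>UNIV. Rep_tempered u (mult_test (\<lambda>\<xi>. a \<xi> $ j $ k) \<phi>) $ k)"

definition op_tempered ::
  "(real ^ 'n \<Rightarrow> complex ^ 'N ^ 'N) \<Rightarrow> ('n::finite, 'N::finite) tempered \<Rightarrow>
   ('n, 'N) tempered" where
  "op_tempered a u = inv fourier_tempered (mult_tempered a (fourier_tempered u))"


section \<open>Cauchy problems and semigroups on topological vector spaces\<close>

definition has_tvs_derivative ::
  "(real \<Rightarrow> 'a::{real_vector, topological_space}) \<Rightarrow> 'a \<Rightarrow> real \<Rightarrow> real set \<Rightarrow> bool" where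
  "has_tvs_derivative u d t S \<longleftrightarrow> ((\<lambda>s. (u s - u t) /\<^sub>R (s - t)) \<longlongrightarrow> d) (at t within S)"

text \<open>\<open>u\<close> is in $C^1([0,\infty);E)$ (with one-sided derivative at 0), satisfies
  $u'(t) - Au(t) = 0$ for $t > 0$, and $u(0) = u_0$. The values of \<open>u\<close> at negative times are
  irrelevant.\<close>

definition cauchy_solution ::
  "('a \<Rightarrow> 'a) \<Rightarrow> 'a \<Rightarrow> (real \<Rightarrow> 'a::{real_vector, topological_space}) \<Rightarrow> bool" where
  "cauchy_solution A u0 u \<longleftrightarrow>
     (\<exists>u'. (\<forall>t\<ge>0. has_tvs_derivative u (u' t) t {0..}) \<and> continuous_on {0..} u' \<and>
           (\<forall>t>0. u' t - A (u t) = 0)) \<and>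
     u 0 = u0"

text \<open>Boundedness of a set of operators in the space of continuous linear operators with the
  topology of uniform convergence on bounded sets: it means that the set maps each bounded set
  into a bounded set.\<close>

definition bounded_operators ::
  "('a \<Rightarrow> 'a::{real_vector, topological_space}) set \<Rightarrow> bool" where
  "bounded_operators \<T> \<longleftrightarrow> (\<forall>B. vn_bounded B \<longrightarrow> vn_bounded (\<Union>T\<in>\<T>. T ` B))"

definition loc_unif_bounded_semigroup ::
  "(real \<Rightarrow> 'a \<Rightarrow> 'a::{complex_vector, topological_space}) \<Rightarrow> bool" where
  "loc_unif_bounded_semigroup T \<longleftrightarrow>
     (\<forall>t\<ge>0. clinear (T t) \<and> continuous_on UNIV (T t)) \<and>
     T 0 = id \<and>
     (\<forall>t\<ge>0. \<forall>s\<ge>0. T (t + s) = T t \<circ> T s) \<and>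
     (\<forall>T0>0. bounded_operators (T ` {0..T0}))"

end

theory Submission
  imports Defs "HOL-Probability.Probability" "HOL-Computational_Algebra.Fundamental_Theorem_Algebra"
begin

text \<open>
  The Fourier transform turns \<open>op[b]\<close> into multiplication by \<open>b\<close>, so everything rests on estimates for
  \<open>e\<^sup>t\<^sup>a\<^sup>(\<^sup>\<xi>\<^sup>)\<close> and its derivatives in \<open>\<xi>\<close> and \<open>t\<close>.

  Let \<open>A\<close> be a matrix with spectrum in \<open>Re z \<le> M\<close>. The powers of \<open>A\<close> are linearly dependent, and over the
  complex numbers the polynomial that expresses this splits; hence a product of boundedly many factors
  \<open>A - r\<close> vanishes (\<open>annihilating_product\<close>). Factors whose \<open>r\<close> is not an eigenvalue can be cancelled, and each of
  the others makes \<open>e\<^sup>t\<^sup>A X\<close> the solution of a scalar equation \<open>y' = r y + g\<close> with \<open>Re r \<le> M\<close>. Therefore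
  \<open>e\<^sup>t\<^sup>A\<close> grows only polynomially in the norm of \<open>A\<close>, locally uniformly in \<open>t\<close> (\<open>matexp_bound\<close>), which for
  \<open>A = a(\<xi>)\<close> is polynomial growth in \<open>\<xi>\<close>. By Leibniz' formula a derivative \<open>X\<close> of \<open>e\<^sup>t\<^sup>a\<close> satisfies \<open>X' = a X + R\<close>
  with \<open>R\<close> built from derivatives of lower order, and Duhamel's formula carries the bound to all
  orders (\<open>bounded_growth_symexp\<close>). The derivatives in \<open>t\<close> are \<open>a e\<^sup>t\<^sup>a\<close> and \<open>a\<^sup>2 e\<^sup>t\<^sup>a\<close>, so Taylor's formula in \<open>t\<close>
  holds with bounds of the same kind (\<open>C1_multipliers_symexp\<close>).

  Multiplication by such a family is a \<open>C\<^sup>1\<close> semigroup on the Schwartz space. On tempered distributions it acts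
  by transposition; as it maps bounded sets of test functions to bounded sets, uniformly for bounded times,
  the estimates dualise to the strong topology. Uniqueness for Schwartz functions is uniqueness
  for the ordinary differential equation at each \<open>\<xi>\<close>. For distributions the curve \<open>s \<mapsto> T(t - s) v(s)\<close> is shown to be constant
  for every solution \<open>v\<close>; its derivative comes from a product rule for the pairing that
  uses the uniform convergence on bounded sets (\<open>has_vector_derivative_pairing\<close>).

  It remains that the Fourier transform is an isomorphism of the Schwartz space and, by transposition, of the tempered
  distributions. Its square is the reflection \<open>\<phi>(x) \<mapsto> \<phi>(- x)\<close> (\<open>fourier_fourier\<close>, proved with a Gaussian damping factor), so its
  fourth power is the identity and its inverse is its third power.
\<close>


section \<open>Calculus of iterated partial derivatives\<close>

lemma partial_eqI: "(f has_derivative f') (at x) \<Longrightarrow> partial i f x = f' (axis i 1)"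
  using frechet_derivative_at[of f f' x] by (simp add: partial_def)

lemma has_derivative_partials:
  fixes f :: "real ^ 'n::finite \<Rightarrow> 'b::real_normed_vector"
  assumes "f differentiable (at x)"
  shows "(f has_derivative (\<lambda>h. \<Sum>j\<in>UNIV. (h $ j) *\<^sub>R partial j f x)) (at x)"
proof -
  let ?D = "frechet_derivative f (at x)"
  have D: "(f has_derivative ?D) (at x)"
    using assms by (simp add: frechet_derivative_works)
  then have lin: "linear ?D"
    by (rule has_derivative_linear)
  have eq: "?D h = (\<Sum>j\<in>UNIV. (h $ j) *\<^sub>R partial j f x)" for h
  proof -
    have "?D h = ?D (\<Sum>j\<in>UNIV. (h $ j) *\<^sub>R axis j 1)"
      using basis_expansion[of h] by (simp add: scalar_mult_eq_scaleR)
    also have "\<dots> = (\<Sum>j\<in>UNIV. (h $ j) *\<^sub>R partial j f x)"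
      by (simp add: linear_sum[OF lin] linear_cmul[OF lin] partial_def)
    finally show ?thesis .
  qed
  have "?D = (\<lambda>h. \<Sum>j\<in>UNIV. (h $ j) *\<^sub>R partial j f x)"
    by (rule ext) (rule eq)
  with D show ?thesis by simp
qed

lemma has_vector_derivative_line:
  fixes f :: "real ^ 'n::finite \<Rightarrow> 'b::real_normed_vector"
  assumes "f differentiable (at (x + s *\<^sub>R axis i 1))"
  shows "((\<lambda>s. f (x + s *\<^sub>R axis i 1)) has_vector_derivative partial i f (x + s *\<^sub>R axis i 1)) (at s within S)"
proof -
  let ?p = "x + s *\<^sub>R axis i 1"
  have D: "(f has_derivative frechet_derivative f (at ?p)) (at ?p)"
    using assms by (simp add: frechet_derivative_works)
  have "((\<lambda>s. x + s *\<^sub>R axis i 1) has_derivative (\<lambda>h. h *\<^sub>R axis i 1)) (at s)"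
    by (auto intro!: derivative_eq_intros)
  from diff_chain_at[OF this D]
  have "((\<lambda>s. f (x + s *\<^sub>R axis i 1)) has_derivative
      (\<lambda>h. frechet_derivative f (at ?p) (h *\<^sub>R axis i 1))) (at s)"
    by (simp add: o_def)
  moreover have "frechet_derivative f (at ?p) (h *\<^sub>R axis i 1) = h *\<^sub>R partial i f ?p" for h
    using linear_cmul[OF has_derivative_linear[OF D]] by (simp add: partial_def)
  ultimately show ?thesis
    by (simp add: has_vector_derivative_def has_derivative_at_withinI)
qed

lemma vector_differentiable_bound:
  fixes g :: "real \<Rightarrow> 'b::real_normed_vector"
  assumes "convex S" and "\<And>s. s \<in> S \<Longrightarrow> (g has_vector_derivative g' s) (at s within S)"
    and "\<And>s. s \<in> S \<Longrightarrow> norm (g' s) \<le> B" and "x \<in> S" "y \<in> S"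
  shows "norm (g x - g y) \<le> B * \<bar>x - y\<bar>"
proof -
  have "onorm (\<lambda>h. h *\<^sub>R g' s) \<le> B" if "s \<in> S" for s
    using assms(3)[OF that] by (intro onorm_le) (simp add: mult.commute[of B] mult_left_mono)
  then show ?thesis
    using differentiable_bound[OF assms(1) assms(2)[unfolded has_vector_derivative_def] _ assms(4,5)]
    by (simp add: real_norm_def)
qed

lemma smooth_partial: "smooth f \<Longrightarrow> smooth (partial i f)"
proof -
  assume f: "smooth f"
  have "iter_partial is (partial i f) = iter_partial (is @ [i]) f" for "is"
    by (induction "is") auto
  with f show "smooth (partial i f)" by (simp add: smooth_def)
qed

lemma smooth_differentiable: "smooth f \<Longrightarrow> f differentiable (at x)"
  unfolding smooth_def by (metis iter_partial.simps(1))

lemma iter_partial_append: "iter_partial (is @ js) f = iter_partial is (iter_partial js f)"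
  by (induction "is") auto

lemma smooth_iter_partial: "smooth f \<Longrightarrow> smooth (iter_partial is f)"
  by (induction "is") (auto intro: smooth_partial)

lemma smooth_partialI:
  assumes "\<And>x. f differentiable (at x)" "\<And>i. smooth (partial i f)"
  shows "smooth f"
  unfolding smooth_def
proof (intro allI)
  fix "is" x
  show "iter_partial is f differentiable (at x)"
  proof (cases "is" rule: rev_exhaust)
    case (snoc js i)
    then show ?thesis using assms(2)[of i] by (simp add: iter_partial_append smooth_def)
  qed (simp add: assms)
qed

text \<open>The second difference quotient in the directions \<open>i\<close> and \<open>j\<close> is symmetric in \<open>i\<close> and \<open>j\<close>, and by
  the mean value inequality in one of the two directions it converges to the mixed derivative.\<close>

lemma second_difference_estimate:
  fixes f :: "real ^ 'n::finite \<Rightarrow> 'b::real_normed_vector"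
  assumes f: "\<And>x. f differentiable (at x)" and fi: "partial i f differentiable (at x)" and e: "e > 0"
  shows "\<exists>d>0. \<forall>h. 0 < h \<and> h < d \<longrightarrow>
    norm (f (x + h *\<^sub>R axis i 1 + h *\<^sub>R axis j 1) - f (x + h *\<^sub>R axis i 1)
      - f (x + h *\<^sub>R axis j 1) + f x - h\<^sup>2 *\<^sub>R partial j (partial i f) x) \<le> e * h\<^sup>2"
proof -
  let ?F = "partial i f"
  let ?L = "frechet_derivative ?F (at x)"
  have L: "(?F has_derivative ?L) (at x)"
    using fi by (simp add: frechet_derivative_works)
  have lin: "linear ?L" by (rule has_derivative_linear[OF L])
  obtain d where d: "d > 0" "\<And>y. norm (y - x) < d \<Longrightarrow>
      norm (?F y - ?F x - ?L (y - x)) \<le> (e/3) * norm (y - x)"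
    using L[unfolded has_derivative_at_alt] e by (metis divide_pos_pos zero_less_numeral)
  have "norm (f (x + h *\<^sub>R axis i 1 + h *\<^sub>R axis j 1) - f (x + h *\<^sub>R axis i 1)
      - f (x + h *\<^sub>R axis j 1) + f x - h\<^sup>2 *\<^sub>R partial j ?F x) \<le> e * h\<^sup>2"
    if h: "0 < h" "h < d/2" for h
  proof -
    let ?ei = "axis i (1::real)" and ?ej = "axis j (1::real)"
    \<comment> \<open>the mean value inequality is applied to a first difference in direction \<open>j\<close>, minus its expected linear part\<close>
    define g where "g s = f ((x + h *\<^sub>R ?ej) + s *\<^sub>R ?ei) - f (x + s *\<^sub>R ?ei)
        - s *\<^sub>R (h *\<^sub>R partial j ?F x)" for s
    define g' where "g' s = ?F ((x + h *\<^sub>R ?ej) + s *\<^sub>R ?ei) - ?F (x + s *\<^sub>R ?ei)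
        - h *\<^sub>R partial j ?F x" for s
    have "(g has_vector_derivative g' s) (at s within {0..h})" for s
      unfolding g_def g'_def
      by (auto intro!: derivative_eq_intros has_vector_derivative_line f)
    moreover have "norm (g' s) \<le> e * h" if s: "s \<in> {0..h}" for s
    proof -
      let ?y = "(x + h *\<^sub>R ?ej) + s *\<^sub>R ?ei" and ?z = "x + s *\<^sub>R ?ei"
      have ny: "norm (?y - x) \<le> 2 * h"
        using norm_triangle_ineq[of "h *\<^sub>R ?ej" "s *\<^sub>R ?ei"] s h by (simp add: norm_axis_1)
      have nz: "norm (?z - x) \<le> h"
        using s h by (simp add: norm_axis_1)
      have "?L (?y - x) - ?L (?z - x) = h *\<^sub>R partial j ?F x"
        by (simp add: linear_diff[OF lin, symmetric] linear_add[OF lin] linear_cmul[OF lin] partial_def)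
      then have "g' s = (?F ?y - ?F x - ?L (?y - x)) - (?F ?z - ?F x - ?L (?z - x))"
        by (simp add: g'_def algebra_simps)
      also have "norm \<dots> \<le> (e/3) * norm (?y - x) + (e/3) * norm (?z - x)"
        using ny nz h
        by (intro order_trans[OF norm_triangle_ineq4 add_mono] d(2)) auto
      also have "\<dots> \<le> (e/3) * (2 * h) + (e/3) * h"
        using ny nz e by (intro add_mono mult_left_mono) auto
      finally show ?thesis by simp
    qed
    ultimately have "norm (g h - g 0) \<le> (e * h) * \<bar>h - 0\<bar>"
      using h by (intro vector_differentiable_bound[where S = "{0..h}"]) auto
    moreover have "g h - g 0 = f (x + h *\<^sub>R axis i 1 + h *\<^sub>R axis j 1) - f (x + h *\<^sub>R axis i 1)
      - f (x + h *\<^sub>R axis j 1) + f x - h\<^sup>2 *\<^sub>R partial j ?F x"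
      by (simp add: g_def algebra_simps power2_eq_square)
    ultimately show ?thesis using h by (simp add: power2_eq_square mult.assoc)
  qed
  with d(1) show ?thesis by (intro exI[of _ "d/2"]) auto
qed

lemma partial_commute:
  fixes f :: "real ^ 'n::finite \<Rightarrow> 'b::real_normed_vector"
  assumes "smooth f"
  shows "partial i (partial j f) = partial j (partial i f)"
proof
  fix x
  let ?D = "partial i (partial j f) x - partial j (partial i f) x"
  have sm: "\<And>x. f differentiable (at x)" "\<And>i x. partial i f differentiable (at x)"
    using assms smooth_differentiable smooth_partial by blast+
  have "norm ?D \<le> 2 * e" if e: "e > 0" for e
  proof -
    define S where "S h = f (x + h *\<^sub>R axis i 1 + h *\<^sub>R axis j 1) - f (x + h *\<^sub>R axis i 1)
      - f (x + h *\<^sub>R axis j 1) + f x" for h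
    have S: "S h = f (x + h *\<^sub>R axis j 1 + h *\<^sub>R axis i 1) - f (x + h *\<^sub>R axis j 1)
      - f (x + h *\<^sub>R axis i 1) + f x" for h
      by (simp add: S_def add_ac)
    obtain d1 where d1: "d1 > 0" "\<And>h. 0 < h \<and> h < d1 \<Longrightarrow>
        norm (S h - h\<^sup>2 *\<^sub>R partial j (partial i f) x) \<le> e * h\<^sup>2"
      using second_difference_estimate[OF sm e, where i = i and j = j and x = x]
      unfolding S_def by blast
    obtain d2 where d2: "d2 > 0" "\<And>h. 0 < h \<and> h < d2 \<Longrightarrow>
        norm (S h - h\<^sup>2 *\<^sub>R partial i (partial j f) x) \<le> e * h\<^sup>2"
      using second_difference_estimate[OF sm e, where i = j and j = i and x = x]
      unfolding S by blast
    define h where "h = min d1 d2 / 2"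
    have h: "0 < h" "h < d1" "h < d2"
      using d1(1) d2(1) by (auto simp: h_def min_def)
    have "h\<^sup>2 *\<^sub>R ?D = (S h - h\<^sup>2 *\<^sub>R partial j (partial i f) x) - (S h - h\<^sup>2 *\<^sub>R partial i (partial j f) x)"
      by (simp add: algebra_simps)
    also have "norm \<dots> \<le> e * h\<^sup>2 + e * h\<^sup>2"
      using h by (intro order_trans[OF norm_triangle_ineq4 add_mono] d1 d2) auto
    finally have "h\<^sup>2 * norm ?D \<le> h\<^sup>2 * (2 * e)" by (simp add: mult.commute)
    then show ?thesis using h by simp
  qed
  from this[of "norm ?D / 4"] have "norm ?D = 0"
    by (cases "norm ?D = 0") auto
  then show "partial i (partial j f) x = partial j (partial i f) x" by simp
qed

lemma iter_partial_remove1: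
  assumes "smooth f" "i \<in> set is"
  shows "iter_partial is f = partial i (iter_partial (remove1 i is) f)"
  using assms(2)
proof (induction "is")
  case (Cons j "is")
  then show ?case
    using partial_commute[OF smooth_iter_partial[OF assms(1)]] by (cases "i = j") auto
qed simp

lemma iter_partial_mset_eq:
  assumes "smooth f" "mset is = mset js"
  shows "iter_partial is f = iter_partial js f"
  using assms(2)
proof (induction "is" arbitrary: js)
  case (Cons i "is")
  then have eq: "mset js = add_mset i (mset is)" by simp
  have "i \<in> set js"
    unfolding set_mset_mset[symmetric] eq by simp
  moreover have "mset is = mset (remove1 i js)"
    by (simp add: eq)
  note calculation this
  from iter_partial_remove1[OF assms(1) this(1)] Cons.IH[OF this(2)] show ?case by simp
qed simp

definition index_of :: "'n::finite list \<Rightarrow> nat ^ 'n" where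
  "index_of is = (\<chi> i. count_list is i)"

text \<open>By the symmetry of second derivatives the ordering chosen in the definition of \<open>mpartial\<close> is immaterial, so estimates for
  all multi-indices are estimates for all lists of directions.\<close>

lemma mpartial_index_of:
  assumes "smooth f"
  shows "mpartial (index_of is) f = iter_partial is f"
proof -
  define js where "js = (SOME js. \<forall>i. count_list js i = index_of is $ i)"
  have "\<forall>i. count_list js i = index_of is $ i"
    unfolding js_def by (rule someI[of _ "is"]) (simp add: index_of_def)
  then have "count (mset js) i = count (mset is) i" for i
    by (simp add: index_of_def count_mset)
  then have "mset js = mset is"
    by (rule multiset_eqI)
  from iter_partial_mset_eq[OF assms this] show ?thesis
    unfolding mpartial_def js_def .
qed

lemma mi_order_index_of: "mi_order (index_of is) = length is"
  by (simp add: mi_order_def index_of_def sum_count_set[of "is" UNIV])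

lemma ex_list_index_of: "\<exists>is. index_of is = (\<alpha> :: nat ^ 'n::finite)"
proof -
  obtain xs :: "'n list" where xs: "mset xs = (\<Sum>i\<in>UNIV. replicate_mset (\<alpha> $ i) i)"
    using ex_mset by blast
  have "count_list xs i = \<alpha> $ i" for i
  proof -
    have "count_list xs i = (\<Sum>j\<in>UNIV. count (replicate_mset (\<alpha> $ j) j) i)"
      by (simp add: count_mset[symmetric] xs count_sum)
    also have "\<dots> = (\<Sum>j\<in>UNIV. if j = i then \<alpha> $ j else 0)"
      by (intro sum.cong) auto
    finally show ?thesis by simp
  qed
  then show ?thesis by (intro exI[of _ xs]) (simp add: index_of_def vec_eq_iff)
qed

text \<open>In Leibniz' formula each derivative falls on one of the two factors. The head of
  \<open>splits is\<close> is the term in which all of them fall on the second one.\<close>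

fun splits :: "'a list \<Rightarrow> ('a list \<times> 'a list) list" where
  "splits [] = [([], [])]"
| "splits (i # is) = map (\<lambda>(u, v). (u, i # v)) (splits is) @ map (\<lambda>(u, v). (i # u, v)) (splits is)"

lemma length_splits: "length (splits is) = 2 ^ length is"
  by (induction "is") auto

lemma splits_lengths: "(u, v) \<in> set (splits is) \<Longrightarrow> length u + length v = length is"
  by (induction "is" arbitrary: u v) auto

lemma splits_Cons_tl: "splits is = ([], is) # tl (splits is)"
proof (induction "is")
  case (Cons i "is")
  then obtain r where "splits is = ([], is) # r" by metis
  then show ?case by simp
qed simp

lemma tl_splits_less: "(u, v) \<in> set (tl (splits is)) \<Longrightarrow> length v < length is"
proof (induction "is" arbitrary: u v)
  case (Cons i "is")
  obtain r where r: "splits is = ([], is) # r" using splits_Cons_tl by metis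
  from Cons.prems r consider v' where "v = i # v'" "(u, v') \<in> set (tl (splits is))"
    | u' where "(u', v) \<in> set (splits is)"
    by (auto simp: image_iff)
  then show ?case
    by cases (use Cons.IH splits_lengths in fastforce)+
qed simp

lemma has_derivative_sum_list:
  assumes "\<And>p. p \<in> set ps \<Longrightarrow> (f p has_derivative f' p) F"
  shows "((\<lambda>x. \<Sum>p\<leftarrow>ps. f p x) has_derivative (\<lambda>h. \<Sum>p\<leftarrow>ps. f' p h)) F"
  using assms by (induction ps) (auto intro: has_derivative_add)

lemma iter_partial_bilinear:
  assumes B: "bounded_bilinear B" and f: "smooth f" and g: "smooth g"
  shows "iter_partial is (\<lambda>x. B (f x) (g x)) =
    (\<lambda>x. \<Sum>(u, v)\<leftarrow>splits is. B (iter_partial u f x) (iter_partial v g x))"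
proof (induction "is")
  case (Cons i "is")
  let ?S = "\<lambda>x. \<Sum>(u, v)\<leftarrow>splits is. B (iter_partial u f x) (iter_partial v g x)"
  have "partial i ?S x = (\<Sum>(u, v)\<leftarrow>splits is. B (iter_partial u f x) (iter_partial (i # v) g x)) +
      (\<Sum>(u, v)\<leftarrow>splits is. B (iter_partial (i # u) f x) (iter_partial v g x))" for x
  proof -
    have D: "(iter_partial u f has_derivative frechet_derivative (iter_partial u f) (at x)) (at x)"
      "(iter_partial v g has_derivative frechet_derivative (iter_partial v g) (at x)) (at x)" for u v
      using f g by (auto simp: frechet_derivative_works[symmetric] smooth_def)
    have "(?S has_derivative (\<lambda>h. \<Sum>p\<leftarrow>splits is.
        (case p of (u, v) \<Rightarrow> B (iter_partial u f x) (frechet_derivative (iter_partial v g) (at x) h) +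
          B (frechet_derivative (iter_partial u f) (at x) h) (iter_partial v g x)))) (at x)"
      by (rule has_derivative_sum_list) (auto intro!: bounded_bilinear.FDERIV[OF B] D split: prod.split)
    from partial_eqI[OF this, of i] show ?thesis
      by (simp only: case_prod_unfold sum_list_addf iter_partial.simps partial_def)
  qed
  then show ?case by (simp add: Cons comp_def case_prod_unfold fun_eq_iff)
qed simp

lemma smooth_bilinear:
  assumes B: "bounded_bilinear B" and f: "smooth f" and g: "smooth g"
  shows "smooth (\<lambda>x. B (f x) (g x))"
  unfolding smooth_def iter_partial_bilinear[OF assms]
proof (intro allI)
  fix "is" x
  have D: "(iter_partial u f has_derivative frechet_derivative (iter_partial u f) (at x)) (at x)"
    "(iter_partial v g has_derivative frechet_derivative (iter_partial v g) (at x)) (at x)" for u v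
    using f g by (auto simp: frechet_derivative_works[symmetric] smooth_def)
  have "((\<lambda>x. \<Sum>(u, v)\<leftarrow>splits is. B (iter_partial u f x) (iter_partial v g x)) has_derivative (\<lambda>h. \<Sum>p\<leftarrow>splits is.
        (case p of (u, v) \<Rightarrow> B (iter_partial u f x) (frechet_derivative (iter_partial v g) (at x) h) +
          B (frechet_derivative (iter_partial u f) (at x) h) (iter_partial v g x)))) (at x)"
    by (rule has_derivative_sum_list) (auto intro!: bounded_bilinear.FDERIV[OF B] D split: prod.split)
  then show "(\<lambda>x. \<Sum>(u, v)\<leftarrow>splits is. B (iter_partial u f x) (iter_partial v g x)) differentiable (at x)"
    by (rule differentiableI)
qed

lemma norm_sum_list_le: "(\<And>p. p \<in> set ps \<Longrightarrow> norm (f p) \<le> b) \<Longrightarrow> norm (\<Sum>p\<leftarrow>ps. f p) \<le> real (length ps) * b"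
proof (induction ps)
  case (Cons p ps)
  have "norm (f p + (\<Sum>p\<leftarrow>ps. f p)) \<le> b + real (length ps) * b"
    by (intro order_trans[OF norm_triangle_ineq] add_mono Cons) auto
  then show ?case by (simp add: distrib_right)
qed simp

text \<open>The factor \<open>2 ^ L\<close> counts the terms of Leibniz' formula.\<close>

lemma norm_iter_partial_bilinear_le:
  fixes f :: "real ^ 'n::finite \<Rightarrow> 'b::real_normed_vector" and g :: "real ^ 'n \<Rightarrow> 'c::real_normed_vector"
  assumes B: "bounded_bilinear B" "K \<ge> 0" "\<And>x y. norm (B x y) \<le> norm x * norm y * K"
    and sm: "smooth f" "smooth g"
    and f: "\<And>u. length u \<le> L \<Longrightarrow> norm (iter_partial u f x) \<le> A"
    and g: "\<And>v. length v \<le> L \<Longrightarrow> norm (iter_partial v g x) \<le> D"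
    and l: "length is \<le> L"
  shows "norm (iter_partial is (\<lambda>x. B (f x) (g x)) x) \<le> 2 ^ L * (A * D * K)"
proof -
  have A: "0 \<le> A" and D: "0 \<le> D"
    using order_trans[OF norm_ge_zero f[of "[]"]] order_trans[OF norm_ge_zero g[of "[]"]] by simp_all
  have "norm (case p of (u, v) \<Rightarrow> B (iter_partial u f x) (iter_partial v g x)) \<le> A * D * K"
    if "p \<in> set (splits is)" for p
  proof -
    obtain u v where p: "p = (u, v)" by (cases p)
    have uv: "length u \<le> L" "length v \<le> L"
      using splits_lengths that l unfolding p by fastforce+
    have "norm (iter_partial u f x) * norm (iter_partial v g x) * K \<le> A * D * K"
      using A by (intro mult_right_mono mult_mono f g uv B(2)) auto
    with B(3) have "norm (B (iter_partial u f x) (iter_partial v g x)) \<le> A * D * K"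
      by (rule order_trans)
    then show ?thesis by (simp add: p)
  qed
  then have "norm (\<Sum>p\<leftarrow>splits is. case p of (u, v) \<Rightarrow> B (iter_partial u f x) (iter_partial v g x))
      \<le> real (length (splits is)) * (A * D * K)"
    by (rule norm_sum_list_le)
  also have "\<dots> \<le> 2 ^ L * (A * D * K)"
    using l A D B(2) by (intro mult_right_mono) (auto simp: length_splits)
  finally show ?thesis by (simp add: iter_partial_bilinear[OF B(1) sm])
qed

lemma iter_partial_diff:
  assumes "smooth f" "smooth g"
  shows "iter_partial is (\<lambda>x. f x - g x) = (\<lambda>x. iter_partial is f x - iter_partial is g x)"
  using iter_partial_add[OF assms(1) smooth_bounded_linear[OF bounded_linear_minus[OF bounded_linear_ident] assms(2)], of "is"]
  by (simp add: iter_partial_bounded_linear[OF bounded_linear_minus[OF bounded_linear_ident] assms(2)])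

lemma smooth_diff: "smooth f \<Longrightarrow> smooth g \<Longrightarrow> smooth (\<lambda>x. f x - g x)"
  using smooth_add[OF _ smooth_bounded_linear[OF bounded_linear_minus[OF bounded_linear_ident]], of f g] by simp

lemma partial_const [simp]: "partial i (\<lambda>x. c) = (\<lambda>x. 0)"
  by (simp add: partial_def fun_eq_iff frechet_derivative_const)

lemma iter_partial_const: "iter_partial is (\<lambda>x. c) = (if is = [] then (\<lambda>x. c) else (\<lambda>x. 0))"
  by (induction "is") (auto simp: if_distrib[of "partial _"])

lemma smooth_const: "smooth (\<lambda>x. c)"
  by (simp add: smooth_def iter_partial_const)

section \<open>Seminorms of the Schwartz space\<close>

lemma jbracket_ge_1: "1 \<le> jbracket x"
  by (simp add: jbracket_def)

lemma jbracket_pos: "0 < jbracket x"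
  using jbracket_ge_1[of x] by simp

lemma jbracket_squared: "jbracket x ^ 2 = 1 + (norm x)\<^sup>2"
  by (simp add: jbracket_def)

lemma norm_le_jbracket: "norm x \<le> jbracket x"
  by (simp add: jbracket_def real_le_rsqrt)

lemma component_le_jbracket: "\<bar>(x :: real ^ 'n::finite) $ i\<bar> \<le> jbracket x"
  using component_le_norm_cart[of x i] norm_le_jbracket[of x] by simp

lemma jbracket_power_mono: "m \<le> n \<Longrightarrow> jbracket x ^ m \<le> jbracket x ^ n"
  by (intro power_increasing jbracket_ge_1)

lemma jbracket_power_ge_1: "1 \<le> jbracket x ^ m"
  by (simp add: jbracket_ge_1)

text \<open>Lists of directions in place of multi-indices make Leibniz' formula and induction on the order immediate.\<close>

definition growth_bound :: "nat \<Rightarrow> real \<Rightarrow> nat \<Rightarrow> (real ^ 'n::finite \<Rightarrow> 'b::real_normed_vector) \<Rightarrow> bool" where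
  "growth_bound L C m b \<longleftrightarrow>
     smooth b \<and> (\<forall>is x. length is \<le> L \<longrightarrow> norm (iter_partial is b x) \<le> C * jbracket x ^ m)"

lemma growth_boundD: "growth_bound L C m b \<Longrightarrow> length is \<le> L \<Longrightarrow> norm (iter_partial is b x) \<le> C * jbracket x ^ m"
  by (simp add: growth_bound_def)

lemma growth_bound_nonneg:
  fixes b :: "real ^ 'n::finite \<Rightarrow> 'b::real_normed_vector"
  assumes "growth_bound L C m b"
  shows "0 \<le> C"
proof -
  from growth_boundD[OF assms, of "[]" 0] have "norm (b 0) \<le> C * jbracket (0 :: real ^ 'n) ^ m" by simp
  then have "0 \<le> C * jbracket (0 :: real ^ 'n) ^ m" by (rule order_trans[OF norm_ge_zero])
  then show "0 \<le> C" by (simp add: jbracket_def)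
qed

lemma growth_bound_mono:
  assumes "growth_bound L C m b" "L' \<le> L" "C \<le> C'" "m \<le> m'"
  shows "growth_bound L' C' m' b"
proof -
  have "C * jbracket x ^ m \<le> C' * jbracket x ^ m'" for x
    using assms growth_bound_nonneg[OF assms(1)] by (intro mult_mono jbracket_power_mono) (auto simp: jbracket_ge_0)
  with assms show ?thesis
    unfolding growth_bound_def by (meson order_trans)
qed

text \<open>Membership in \<open>O_M\<close>, uniformly for the members of a family.\<close>

definition bounded_growth :: "('i \<Rightarrow> real ^ 'n::finite \<Rightarrow> 'b::real_normed_vector) \<Rightarrow> 'i set \<Rightarrow> bool" where
  "bounded_growth b I \<longleftrightarrow> (\<forall>L. \<exists>C m. \<forall>t\<in>I. growth_bound L C m (b t))"

lemma bounded_growth_subset: "bounded_growth b I \<Longrightarrow> J \<subseteq> I \<Longrightarrow> bounded_growth b J"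
  unfolding bounded_growth_def by (meson subsetD)

lemma growth_bound_bilinear:
  fixes b :: "real ^ 'n::finite \<Rightarrow> 'b::real_normed_vector" and c :: "real ^ 'n \<Rightarrow> 'c::real_normed_vector"
  assumes B: "bounded_bilinear B" "K \<ge> 0" "\<And>x y. norm (B x y) \<le> norm x * norm y * K"
    and b: "growth_bound L C m b" and c: "growth_bound L D k c"
  shows "growth_bound L (2 ^ L * (C * D * K)) (m + k) (\<lambda>x. B (b x) (c x))"
proof -
  have sm: "smooth b" "smooth c" using b c by (auto simp: growth_bound_def)
  have "norm (iter_partial is (\<lambda>x. B (b x) (c x)) x) \<le> 2 ^ L * ((C * jbracket x ^ m) * (D * jbracket x ^ k) * K)"
    if "length is \<le> L" for "is" :: "'n list" and x :: "real ^ 'n"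
    by (rule norm_iter_partial_bilinear_le[OF B sm growth_boundD[OF b] growth_boundD[OF c] that])
  then show ?thesis
    using smooth_bilinear[OF B(1) sm] by (simp add: growth_bound_def power_add mult_ac)
qed

lemma bounded_growth_bilinear:
  assumes B: "bounded_bilinear B" and b: "bounded_growth b I" and c: "bounded_growth c I"
  shows "bounded_growth (\<lambda>t x. B (b t x) (c t x)) I"
  unfolding bounded_growth_def
proof
  fix L
  obtain C m D k where "\<And>t. t \<in> I \<Longrightarrow> growth_bound L C m (b t)" "\<And>t. t \<in> I \<Longrightarrow> growth_bound L D k (c t)"
    using b c unfolding bounded_growth_def by metis
  moreover obtain K where "K \<ge> 0" "\<And>x y. norm (B x y) \<le> norm x * norm y * K"
    using bounded_bilinear.nonneg_bounded[OF B] by blast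
  ultimately show "\<exists>C m. \<forall>t\<in>I. growth_bound L C m (\<lambda>x. B (b t x) (c t x))"
    using growth_bound_bilinear[OF B] by blast
qed

lemma growth_bound_linear:
  fixes b :: "real ^ 'n::finite \<Rightarrow> 'b::real_normed_vector"
  assumes B: "bounded_linear B" "\<And>x. norm (B x) \<le> norm x * K" "K \<ge> 0"
    and b: "growth_bound L C m b"
  shows "growth_bound L (C * K) m (\<lambda>x. B (b x))"
  unfolding growth_bound_def
proof (intro conjI allI impI)
  have sm: "smooth b" using b by (simp add: growth_bound_def)
  then show "smooth (\<lambda>x. B (b x))" by (rule smooth_bounded_linear[OF B(1)])
  fix "is" :: "'n list" and x :: "real ^ 'n" assume "length is \<le> L"
  then have "norm (B (iter_partial is b x)) \<le> (C * jbracket x ^ m) * K"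
    by (intro order_trans[OF B(2)] mult_right_mono B(3) growth_boundD[OF b])
  then show "norm (iter_partial is (\<lambda>x. B (b x)) x) \<le> (C * K) * jbracket x ^ m"
    by (simp add: iter_partial_bounded_linear[OF B(1) sm] mult_ac)
qed

lemma bounded_growth_linear:
  assumes B: "bounded_linear B" and b: "bounded_growth b I"
  shows "bounded_growth (\<lambda>t x. B (b t x)) I"
  unfolding bounded_growth_def
proof
  fix L
  obtain C m where "\<And>t. t \<in> I \<Longrightarrow> growth_bound L C m (b t)"
    using b unfolding bounded_growth_def by metis
  moreover obtain K where "K \<ge> 0" "\<And>x. norm (B x) \<le> norm x * K"
    using bounded_linear.nonneg_bounded[OF B] by blast
  ultimately show "\<exists>C m. \<forall>t\<in>I. growth_bound L C m (\<lambda>x. B (b t x))"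
    using growth_bound_linear[OF B] by blast
qed

lemma is_schwartz_iff:
  fixes f :: "real ^ 'n::finite \<Rightarrow> 'b::real_normed_vector"
  shows "is_schwartz f \<longleftrightarrow> smooth f \<and> (\<forall>k is. \<exists>A. \<forall>x. jbracket x ^ k * norm (iter_partial is f x) \<le> A)"
proof safe
  assume f: "is_schwartz f"
  show sm: "smooth f" using f by (simp add: is_schwartz_def)
  fix k and "is" :: "'n list"
  show "\<exists>A. \<forall>x. jbracket x ^ k * norm (iter_partial is f x) \<le> A"
    using is_schwartzD[OF f, of k "index_of is"] by (simp add: mpartial_index_of[OF sm])
next
  assume sm: "smooth f" and *: "\<forall>k is. \<exists>A. \<forall>x. jbracket x ^ k * norm (iter_partial is f x) \<le> A"
  show "is_schwartz f"
    unfolding is_schwartz_def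
  proof (intro conjI sm allI)
    fix k and \<alpha> :: "nat ^ 'n"
    obtain "is" where "\<alpha> = index_of is" using ex_list_index_of by metis
    moreover obtain A where "\<forall>x. jbracket x ^ k * norm (iter_partial is f x) \<le> A" using * by blast
    ultimately show "bdd_above (range (\<lambda>x. jbracket x ^ k * norm (mpartial \<alpha> f x)))"
      by (intro bdd_aboveI2[where M = A]) (simp add: mpartial_index_of[OF sm])
  qed
qed

text \<open>One index bounds both the power of the weight and the number of derivatives, so that these seminorms increase with it.\<close>

definition snorm :: "nat \<Rightarrow> ('n::finite, 'b::real_normed_vector) schwartz \<Rightarrow> real" where
  "snorm L f = (SUP (is, x) \<in> {is. length is \<le> L} \<times> UNIV. jbracket x ^ L * norm (iter_partial is (Rep_schwartz f) x))"

lemma smooth_Rep: "smooth (Rep_schwartz f)"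
  using Rep_schwartz[of f] by (simp add: is_schwartz_def)

lemma is_schwartz_Rep: "is_schwartz (Rep_schwartz f)"
  using Rep_schwartz[of f] by simp

lemma finite_lists_le: "finite {is :: 'n::finite list. length is \<le> L}"
  using finite_lists_length_le[of "UNIV :: 'n set" L] by simp

lemma snorm_ge:
  fixes f :: "('n::finite, 'b::real_normed_vector) schwartz"
  assumes "length is \<le> L"
  shows "jbracket x ^ L * norm (iter_partial is (Rep_schwartz f) x) \<le> snorm L f"
proof -
  have "\<forall>is. \<exists>A. \<forall>x. jbracket x ^ L * norm (iter_partial is (Rep_schwartz f) x) \<le> A"
    using is_schwartz_Rep[of f] by (simp add: is_schwartz_iff)
  then obtain A where A: "\<And>is x. jbracket x ^ L * norm (iter_partial is (Rep_schwartz f) x) \<le> A is"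
    by metis
  have "A is \<le> Max (A ` {is. length is \<le> L})" if "length is \<le> L" for "is"
    using that by (intro Max_ge) (auto simp: finite_lists_le)
  with A have "jbracket x ^ L * norm (iter_partial is (Rep_schwartz f) x) \<le> Max (A ` {is. length is \<le> L})"
    if "length is \<le> L" for "is" x
    using that by (meson order_trans)
  then have "bdd_above ((\<lambda>(is, x). jbracket x ^ L * norm (iter_partial is (Rep_schwartz f) x)) ` ({is. length is \<le> L} \<times> UNIV))"
    by (intro bdd_aboveI2[where M = "Max (A ` {is. length is \<le> L})"]) auto
  then show ?thesis
    unfolding snorm_def using assms by (intro cSUP_upper2[where x = "(is, x)"]) auto
qed

lemma snorm_leI:
  fixes f :: "('n::finite, 'b::real_normed_vector) schwartz"
  assumes "\<And>is x. length is \<le> L \<Longrightarrow> jbracket x ^ L * norm (iter_partial is (Rep_schwartz f) x) \<le> A"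
  shows "snorm L f \<le> A"
  unfolding snorm_def by (rule cSUP_least) (use assms in \<open>auto intro: exI[of _ "[]"]\<close>)

lemma snorm_nonneg: "0 \<le> snorm L f"
  using snorm_ge[of "[]" L 0 f] by (rule order_trans[rotated]) (auto simp: jbracket_ge_0)

lemma norm_le_snorm: "norm (iter_partial is (Rep_schwartz f) x) \<le> snorm (length is) f"
proof -
  have "1 * norm (iter_partial is (Rep_schwartz f) x) \<le> jbracket x ^ (length is) * norm (iter_partial is (Rep_schwartz f) x)"
    by (intro mult_right_mono jbracket_power_ge_1) auto
  also have "\<dots> \<le> snorm (length is) f" by (rule snorm_ge) simp
  finally show ?thesis by simp
qed

lemma snorm_mono:
  fixes f :: "('n::finite, 'b::real_normed_vector) schwartz"
  assumes "L \<le> L'"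
  shows "snorm L f \<le> snorm L' f"
proof (rule snorm_leI)
  fix "is" :: "'n list" and x :: "real ^ 'n" assume "length is \<le> L"
  with assms show "jbracket x ^ L * norm (iter_partial is (Rep_schwartz f) x) \<le> snorm L' f"
    by (intro order_trans[OF mult_right_mono[OF jbracket_power_mono] snorm_ge]) auto
qed

lemma snorm_add:
  fixes f :: "('n::finite, 'b::real_normed_vector) schwartz"
  shows "snorm L (f + g) \<le> snorm L f + snorm L g"
proof (rule snorm_leI)
  fix "is" :: "'n list" and x :: "real ^ 'n" assume l: "length is \<le> L"
  have "jbracket x ^ L * norm (iter_partial is (Rep_schwartz (f + g)) x) \<le>
     jbracket x ^ L * (norm (iter_partial is (Rep_schwartz f) x) + norm (iter_partial is (Rep_schwartz g) x))"
    unfolding plus_schwartz.rep_eq iter_partial_add[OF smooth_Rep smooth_Rep]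
    by (intro mult_left_mono norm_triangle_ineq) (simp add: jbracket_ge_0)
  also have "\<dots> \<le> snorm L f + snorm L g"
    using snorm_ge[OF l, of x f] snorm_ge[OF l, of x g] by (simp add: distrib_left)
  finally show "jbracket x ^ L * norm (iter_partial is (Rep_schwartz (f + g)) x) \<le> snorm L f + snorm L g" .
qed

lemma snorm_linear_le:
  fixes f :: "('n::finite, 'b::real_normed_vector) schwartz"
  assumes "bounded_linear B" "\<And>x. norm (B x) \<le> r * norm x" "r \<ge> 0" "Rep_schwartz g = (\<lambda>x. B (Rep_schwartz f x))"
  shows "snorm L g \<le> r * snorm L f"
proof (rule snorm_leI)
  fix "is" :: "'n list" and x :: "real ^ 'n" assume l: "length is \<le> L"
  have "jbracket x ^ L * norm (iter_partial is (Rep_schwartz g) x) \<le>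
      jbracket x ^ L * (r * norm (iter_partial is (Rep_schwartz f) x))"
    unfolding assms(4) iter_partial_bounded_linear[OF assms(1) smooth_Rep]
    by (intro mult_left_mono assms(2)) (simp add: jbracket_ge_0)
  also have "\<dots> \<le> r * snorm L f"
    using mult_left_mono[OF snorm_ge[OF l, of x f] assms(3)] by (simp add: mult_ac)
  finally show "jbracket x ^ L * norm (iter_partial is (Rep_schwartz g) x) \<le> r * snorm L f" .
qed

lemma snorm_scaleR_le: "snorm L (r *\<^sub>R f) \<le> \<bar>r\<bar> * snorm L f"
  by (rule snorm_linear_le[OF bounded_linear_scaleR_right]) (auto simp: scaleR_schwartz.rep_eq)

lemma snorm_scaleC_le: "snorm L (c *\<^sub>C f) \<le> cmod c * snorm L (f :: ('n::finite, 'b::complex_normed_vector) schwartz)"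
  by (rule snorm_linear_le[OF bounded_linear_scaleC]) (auto simp: scaleC_schwartz.rep_eq norm_scaleC)

lemma snorm_scaleR: "snorm L (r *\<^sub>R f) = \<bar>r\<bar> * snorm L f"
proof (cases "r = 0")
  case True
  then show ?thesis using snorm_scaleR_le[of L r f] snorm_nonneg[of L "r *\<^sub>R f"] by simp
next
  case False
  have "snorm L f \<le> \<bar>1 / r\<bar> * snorm L (r *\<^sub>R f)"
    using snorm_scaleR_le[of L "1 / r" "r *\<^sub>R f"] False by simp
  then have "\<bar>r\<bar> * snorm L f \<le> snorm L (r *\<^sub>R f)"
    using False by (simp add: field_simps)
  with snorm_scaleR_le[of L r f] show ?thesis by simp
qed

lemma snorm_minus: "snorm L (- f) = snorm L f"
  using snorm_scaleR[of L "- 1" f] by simp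

lemma snorm_diff_commute: "snorm L (f - g) = snorm L (g - f)"
  using snorm_minus[of L "f - g"] by simp

lemma snorm_zero [simp]: "snorm L 0 = 0"
  using snorm_scaleR[of L 0 0] by simp

lemma snorm_diff_triangle: "snorm L (f - h) \<le> snorm L (f - g) + snorm L (g - h)"
proof -
  have "f - h = (f - g) + (g - h)" by (simp add: algebra_simps)
  from snorm_add[of L "f - g" "g - h", folded this] show ?thesis .
qed

lemma Rep_schwartz_diff: "Rep_schwartz (f - g) x = Rep_schwartz f x - Rep_schwartz g x"
  unfolding minus_schwartz_def plus_schwartz.rep_eq uminus_schwartz.rep_eq by simp

lemma schwartz_seminorm_index_of:
  "schwartz_seminorm k (index_of is) f = (SUP x. jbracket x ^ k * norm (iter_partial is (Rep_schwartz f) x))"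
  by (simp add: schwartz_seminorm_def mpartial_index_of[OF smooth_Rep])

lemma schwartz_seminorm_le_snorm:
  assumes "k \<le> L" "length is \<le> L"
  shows "schwartz_seminorm k (index_of is) f \<le> snorm L f"
  unfolding schwartz_seminorm_index_of
proof (rule cSUP_least)
  show "jbracket x ^ k * norm (iter_partial is (Rep_schwartz f) x) \<le> snorm L f" for x
    using assms by (intro order_trans[OF mult_right_mono[OF jbracket_power_mono] snorm_ge]) auto
qed simp

lemma schwartz_seminorm_ge:
  "jbracket x ^ k * norm (iter_partial is (Rep_schwartz f) x) \<le> schwartz_seminorm k (index_of is) f"
proof -
  obtain A where "\<forall>x. jbracket x ^ k * norm (iter_partial is (Rep_schwartz f) x) \<le> A"
    using is_schwartz_Rep[of f] unfolding is_schwartz_iff by blast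
  then show ?thesis
    unfolding schwartz_seminorm_index_of by (intro cSUP_upper bdd_aboveI2) auto
qed

text \<open>Finitely many of the defining seminorms are bounded by one \<open>snorm\<close>, and \<open>snorm m\<close> is the largest of the
  defining seminorms for the finitely many lists of length at most \<open>m\<close>.\<close>

lemma open_schwartz_iff:
  fixes U :: "('n::finite, 'b::real_normed_vector) schwartz set"
  shows "open U \<longleftrightarrow> (\<forall>f\<in>U. \<exists>m \<epsilon>. \<epsilon> > 0 \<and> {g. snorm m (g - f) < \<epsilon>} \<subseteq> U)"
proof
  assume U: "open U"
  show "\<forall>f\<in>U. \<exists>m \<epsilon>. \<epsilon> > 0 \<and> {g. snorm m (g - f) < \<epsilon>} \<subseteq> U"
  proof
    fix f assume "f \<in> U"
    then obtain F \<epsilon> where F: "finite F" "\<epsilon> > 0" "{g. \<forall>(k, \<alpha>)\<in>F. schwartz_seminorm k \<alpha> (g - f) < \<epsilon>} \<subseteq> U"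
      using U unfolding open_schwartz_def by blast
    define m where "m = Max (insert 0 ((\<lambda>(k, \<alpha>). max k (mi_order \<alpha>)) ` F))"
    have "schwartz_seminorm k \<alpha> g \<le> snorm m g" if "(k, \<alpha>) \<in> F" for k \<alpha> g
    proof -
      obtain "is" where "is": "\<alpha> = index_of is" using ex_list_index_of by metis
      have "max k (mi_order \<alpha>) \<le> m"
        unfolding m_def using F(1) that by (intro Max_ge) (auto intro: rev_image_eqI)
      then show ?thesis
        unfolding "is" by (intro schwartz_seminorm_le_snorm) (auto simp: mi_order_index_of)
    qed
    then have "{g. snorm m (g - f) < \<epsilon>} \<subseteq> U"
      using F(3) by (fastforce intro: le_less_trans)
    with F(2) show "\<exists>m \<epsilon>. \<epsilon> > 0 \<and> {g. snorm m (g - f) < \<epsilon>} \<subseteq> U" by blast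
  qed
next
  assume *: "\<forall>f\<in>U. \<exists>m \<epsilon>. \<epsilon> > 0 \<and> {g. snorm m (g - f) < \<epsilon>} \<subseteq> U"
  show "open U"
    unfolding open_schwartz_def
  proof
    fix f assume "f \<in> U"
    then obtain m \<epsilon> where m: "\<epsilon> > 0" "{g. snorm m (g - f) < \<epsilon>} \<subseteq> U" using * by blast
    define F where "F = (\<lambda>is. (m, index_of is :: nat ^ 'n)) ` {is. length is \<le> m}"
    have "snorm m (g - f) < \<epsilon>" if g: "\<forall>(k, \<alpha>)\<in>F. schwartz_seminorm k \<alpha> (g - f) < \<epsilon> / 2" for g
    proof -
      have "snorm m (g - f) \<le> \<epsilon> / 2"
      proof (rule snorm_leI)
        fix "is" :: "'n list" and x :: "real ^ 'n" assume "length is \<le> m"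
        then have "(m, index_of is) \<in> F" by (auto simp: F_def)
        with g have "schwartz_seminorm m (index_of is) (g - f) < \<epsilon> / 2" by blast
        with schwartz_seminorm_ge[of x m "is" "g - f"]
        show "jbracket x ^ m * norm (iter_partial is (Rep_schwartz (g - f)) x) \<le> \<epsilon> / 2" by simp
      qed
      with m(1) show ?thesis by simp
    qed
    with m(2) have "{g. \<forall>(k, \<alpha>)\<in>F. schwartz_seminorm k \<alpha> (g - f) < \<epsilon> / 2} \<subseteq> U" by blast
    with m(1) show "\<exists>F (\<epsilon>::real). finite F \<and> \<epsilon> > 0 \<and> {g. \<forall>(k, \<alpha>)\<in>F. schwartz_seminorm k \<alpha> (g - f) < \<epsilon>} \<subseteq> U"
      by (intro exI[of _ F] exI[of _ "\<epsilon> / 2"]) (auto simp: F_def finite_lists_le)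
  qed
qed

lemma open_snorm_ball: "open {g. snorm m (g - f) < \<epsilon>}"
  unfolding open_schwartz_iff
proof
  fix h assume h: "h \<in> {g. snorm m (g - f) < \<epsilon>}"
  have "snorm m (g - f) < \<epsilon>" if "snorm m (g - h) < \<epsilon> - snorm m (h - f)" for g
    using snorm_diff_triangle[of m g f h] that by simp
  with h show "\<exists>k d. d > 0 \<and> {g. snorm k (g - h) < d} \<subseteq> {g. snorm m (g - f) < \<epsilon>}"
    by (intro exI[of _ m] exI[of _ "\<epsilon> - snorm m (h - f)"]) auto
qed

lemma tendsto_schwartz_iff: "(f \<longlongrightarrow> l) F \<longleftrightarrow> (\<forall>m. ((\<lambda>x. snorm m (f x - l)) \<longlongrightarrow> 0) F)"
proof
  assume f: "(f \<longlongrightarrow> l) F"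
  show "\<forall>m. ((\<lambda>x. snorm m (f x - l)) \<longlongrightarrow> 0) F"
  proof
    fix m
    show "((\<lambda>x. snorm m (f x - l)) \<longlongrightarrow> 0) F"
      unfolding tendsto_iff
    proof (intro allI impI)
      fix e :: real assume "e > 0"
      then have "\<forall>\<^sub>F x in F. f x \<in> {g. snorm m (g - l) < e}"
        using open_snorm_ball by (intro topological_tendstoD[OF f]) auto
      then show "\<forall>\<^sub>F x in F. dist (snorm m (f x - l)) 0 < e"
        by (simp add: snorm_nonneg dist_real_def)
    qed
  qed
next
  assume *: "\<forall>m. ((\<lambda>x. snorm m (f x - l)) \<longlongrightarrow> 0) F"
  show "(f \<longlongrightarrow> l) F"
  proof (rule topological_tendstoI)
    fix S assume "open S" "l \<in> S"
    then obtain m \<epsilon> where m: "\<epsilon> > 0" "{g. snorm m (g - l) < \<epsilon>} \<subseteq> S"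
      unfolding open_schwartz_iff by blast
    have "\<forall>\<^sub>F x in F. snorm m (f x - l) < \<epsilon>"
      using *[rule_format, of m] m(1) by (auto simp: tendsto_iff dist_real_def snorm_nonneg)
    then show "\<forall>\<^sub>F x in F. f x \<in> S" by eventually_elim (use m(2) in auto)
  qed
qed

lemma tendsto_schwartzI:
  assumes "\<And>m. \<exists>g. (\<forall>\<^sub>F x in F. snorm m (f x - l) \<le> g x) \<and> (g \<longlongrightarrow> 0) F"
  shows "(f \<longlongrightarrow> l) F"
  unfolding tendsto_schwartz_iff
proof
  fix m
  obtain g where g: "\<forall>\<^sub>F x in F. snorm m (f x - l) \<le> g x" "(g \<longlongrightarrow> 0) F" using assms by blast
  show "((\<lambda>x. snorm m (f x - l)) \<longlongrightarrow> 0) F"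
    by (rule tendsto_sandwich[OF _ g(1) tendsto_const g(2)]) (simp add: snorm_nonneg)
qed

lemma continuous_on_schwartz_op:
  assumes T: "\<And>f g. T (f - g) = T f - T g" and b: "\<And>m. \<exists>k C. \<forall>f. snorm m (T f) \<le> C * snorm k f"
  shows "continuous_on UNIV (T :: ('n::finite, 'b::real_normed_vector) schwartz \<Rightarrow> ('k::finite, 'c::real_normed_vector) schwartz)"
  unfolding continuous_on_def
proof (intro ballI tendsto_schwartzI)
  fix f :: "('n, 'b) schwartz" and m
  obtain k C where C: "\<And>f. snorm m (T f) \<le> C * snorm k f" using b by blast
  have "((\<lambda>g. C * snorm k (g - f)) \<longlongrightarrow> 0) (at f)"
    using tendsto_ident_at[of f UNIV] unfolding tendsto_schwartz_iff by (intro tendsto_mult_right_zero) auto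
  with C show "\<exists>d. (\<forall>\<^sub>F g in at f. snorm m (T g - T f) \<le> d g) \<and> (d \<longlongrightarrow> 0) (at f)"
    by (intro exI[of _ "\<lambda>g. C * snorm k (g - f)"]) (auto simp: T[symmetric])
qed

text \<open>The preimage of the unit ball contains a ball of some \<open>snorm\<close>, and homogeneity turns this into an inequality.\<close>

lemma continuous_schwartz_functional_bound:
  fixes u :: "('n::finite, 'b::real_normed_vector) schwartz \<Rightarrow> 'c::real_normed_vector"
  assumes T: "\<And>r f. u (r *\<^sub>R f) = r *\<^sub>R u f" and c: "continuous_on UNIV u"
  obtains C k where "C \<ge> 0" "\<And>f. norm (u f) \<le> C * snorm k f"
proof -
  have "open (u -` ball 0 1)"
    by (rule open_vimage[OF open_ball c])
  moreover have "0 \<in> u -` ball 0 1" using T[of 0 0] by simp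
  ultimately obtain m \<epsilon> where m: "\<epsilon> > 0" "{g. snorm m (g - 0) < \<epsilon>} \<subseteq> u -` ball 0 1"
    unfolding open_schwartz_iff by blast
  have "norm (u f) \<le> 1 / \<epsilon> * snorm m f" for f
  proof (rule field_le_epsilon)
    fix e :: real assume e: "e > 0"
    define r where "r = 1 / \<epsilon> * snorm m f + e"
    have r: "r > 0" "snorm m f < \<epsilon> * r"
      using e m(1) snorm_nonneg[of m f] by (auto simp: r_def distrib_left intro: add_nonneg_pos)
    then have "snorm m (((1 / r) *\<^sub>R f) - 0) < \<epsilon>"
      using m(1) by (simp add: snorm_scaleR field_simps)
    then have "norm (u ((1 / r) *\<^sub>R f)) < 1" using m(2) by auto
    then show "norm (u f) \<le> r" using r(1) by (simp add: T field_simps)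
  qed
  with m(1) show ?thesis by (intro that[of "1 / \<epsilon>" m]) auto
qed

text \<open>Being absorbed by the unit ball of a seminorm is the same as a bound on this seminorm.\<close>

lemma vn_bounded_schwartz_iff: "vn_bounded B \<longleftrightarrow> (\<forall>m. \<exists>A. \<forall>f\<in>B. snorm m f \<le> A)"
proof
  assume B: "vn_bounded B"
  show "\<forall>m. \<exists>A. \<forall>f\<in>B. snorm m f \<le> A"
  proof
    fix m
    have "open {g :: ('a, 'b) schwartz. snorm m (g - 0) < 1} \<and> 0 \<in> {g :: ('a, 'b) schwartz. snorm m (g - 0) < 1}"
      by (intro conjI open_snorm_ball) simp
    then obtain r where r: "r > 0" "\<And>s. s > r \<Longrightarrow> B \<subseteq> (\<lambda>x. s *\<^sub>R x) ` {g. snorm m (g - 0) < 1}"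
      using B unfolding vn_bounded_def by blast
    have "snorm m f \<le> r + 1" if "f \<in> B" for f
    proof -
      have "f \<in> (\<lambda>x. (r + 1) *\<^sub>R x) ` {g. snorm m (g - 0) < 1}"
        using r(2)[of "r + 1", OF less_add_one] that by (rule subsetD)
      then obtain g where "f = (r + 1) *\<^sub>R g" "snorm m (g - 0) < 1" by blast
      then show ?thesis using r(1) by (simp add: snorm_scaleR mult_le_cancel_left2)
    qed
    then show "\<exists>A. \<forall>f\<in>B. snorm m f \<le> A" by blast
  qed
next
  assume *: "\<forall>m. \<exists>A. \<forall>f\<in>B. snorm m f \<le> A"
  show "vn_bounded B"
    unfolding vn_bounded_def
  proof (intro allI impI)
    fix U :: "('a, 'b) schwartz set" assume U: "open U \<and> 0 \<in> U"
    then obtain m \<epsilon> where m: "\<epsilon> > 0" "{g. snorm m (g - 0) < \<epsilon>} \<subseteq> U"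
      unfolding open_schwartz_iff by blast
    obtain A where A: "\<forall>f\<in>B. snorm m f \<le> A" using * by blast
    define r where "r = (\<bar>A\<bar> + 1) / \<epsilon>"
    have r: "r > 0" using m(1) by (simp add: r_def add_nonneg_pos)
    have "B \<subseteq> (\<lambda>x. s *\<^sub>R x) ` U" if s: "s > r" for s
    proof
      fix f assume "f \<in> B"
      then have "snorm m f < \<epsilon> * r" using A m(1) by (auto simp: r_def)
      also have "\<dots> < \<epsilon> * s" using s m(1) by simp
      finally have "snorm m ((1 / s) *\<^sub>R f - 0) < \<epsilon>" using s r by (simp add: snorm_scaleR field_simps)
      then have "(1 / s) *\<^sub>R f \<in> U" using m(2) by blast
      then show "f \<in> (\<lambda>x. s *\<^sub>R x) ` U" using s r by (intro image_eqI[of _ _ "(1 / s) *\<^sub>R f"]) auto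
    qed
    with r show "\<exists>r>0. \<forall>s>r. B \<subseteq> (\<lambda>x. s *\<^sub>R x) ` U" by blast
  qed
qed

lemma vn_bounded_image:
  fixes T :: "'a::{real_vector, topological_space} \<Rightarrow> 'b::{real_vector, topological_space}"
  assumes lin: "\<And>r x. T (r *\<^sub>R x) = r *\<^sub>R T x" and c: "continuous_on UNIV T" and B: "vn_bounded B"
  shows "vn_bounded (T ` B)"
  unfolding vn_bounded_def
proof (intro allI impI)
  fix U :: "'b set" assume U: "open U \<and> 0 \<in> U"
  then have "open (T -` U)" using c open_vimage by blast
  moreover have "0 \<in> T -` U" using U lin[of 0 0] by simp
  ultimately obtain r where r: "r > 0" "\<And>s. s > r \<Longrightarrow> B \<subseteq> (\<lambda>x. s *\<^sub>R x) ` (T -` U)"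
    using B unfolding vn_bounded_def by blast
  have "T ` B \<subseteq> (\<lambda>x. s *\<^sub>R x) ` U" if "s > r" for s
  proof
    fix y assume "y \<in> T ` B"
    then obtain x where x: "x \<in> B" "y = T x" by blast
    from r(2)[OF that] x(1) have "x \<in> (\<lambda>x. s *\<^sub>R x) ` (T -` U)" by (rule subsetD)
    then obtain z where "x = s *\<^sub>R z" "T z \<in> U" by blast
    then show "y \<in> (\<lambda>x. s *\<^sub>R x) ` U" unfolding x(2) by (auto simp: lin)
  qed
  with r(1) show "\<exists>r>0. \<forall>s>r. T ` B \<subseteq> (\<lambda>x. s *\<^sub>R x) ` U" by blast
qed

subsection \<open>Multiplication by functions of polynomial growth\<close>

text \<open>Multiplication by a function of growth \<open>m\<close> costs \<open>m\<close> powers of the weight.\<close>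

lemma weighted_bilinear_le:
  fixes b :: "real ^ 'n::finite \<Rightarrow> 'b::real_normed_vector" and f :: "real ^ 'n \<Rightarrow> 'c::real_normed_vector"
  assumes B: "bounded_bilinear B" "K \<ge> 0" "\<And>x y. norm (B x y) \<le> norm x * norm y * K"
    and b: "growth_bound L C m b" and sf: "smooth f"
    and f: "\<And>v. length v \<le> L \<Longrightarrow> jbracket x ^ (k + m) * norm (iter_partial v f x) \<le> S"
    and l: "length is \<le> L"
  shows "jbracket x ^ k * norm (iter_partial is (\<lambda>x. B (b x) (f x)) x) \<le> 2 ^ L * (C * K) * S"
proof -
  have J: "jbracket x ^ k > 0" "jbracket x ^ m > 0" by (simp_all add: jbracket_pos)
  have sb: "smooth b" using b by (simp add: growth_bound_def)
  have f': "norm (iter_partial v f x) \<le> S / (jbracket x ^ k * jbracket x ^ m)" if "length v \<le> L" for v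
    using f[OF that] J by (simp add: power_add field_simps)
  have "jbracket x ^ k * norm (iter_partial is (\<lambda>x. B (b x) (f x)) x) \<le>
      jbracket x ^ k * (2 ^ L * ((C * jbracket x ^ m) * (S / (jbracket x ^ k * jbracket x ^ m)) * K))"
    using norm_iter_partial_bilinear_le[OF B sb sf growth_boundD[OF b] f' l] J by (intro mult_left_mono) auto
  also have "\<dots> = 2 ^ L * (C * K) * S" using jbracket_pos[of x] by simp
  finally show ?thesis .
qed

lemma is_schwartz_bilinear:
  fixes b :: "real ^ 'n::finite \<Rightarrow> 'b::real_normed_vector" and f :: "real ^ 'n \<Rightarrow> 'c::real_normed_vector"
  assumes B: "bounded_bilinear B" and b: "\<And>L. \<exists>C m. growth_bound L C m b" and f: "is_schwartz f"
  shows "is_schwartz (\<lambda>x. B (b x) (f x))"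
proof -
  have sb: "smooth b" using b unfolding growth_bound_def by blast
  have sf: "smooth f" using f by (simp add: is_schwartz_def)
  obtain K where K: "K \<ge> 0" "\<And>x y. norm (B x y) \<le> norm x * norm y * K"
    using bounded_bilinear.nonneg_bounded[OF B] by blast
  show ?thesis
    unfolding is_schwartz_iff
  proof (intro conjI allI)
    show "smooth (\<lambda>x. B (b x) (f x))" by (rule smooth_bilinear[OF B sb sf])
    fix k and "is" :: "'n list"
    obtain C m where C: "growth_bound (length is) C m b" using b by blast
    obtain A where A: "\<And>v x. jbracket x ^ (k + m) * norm (iter_partial v f x) \<le> A v"
      using f unfolding is_schwartz_iff by metis
    define S where "S = (\<Sum>v | length v \<le> length is. \<bar>A v\<bar>)"
    have "jbracket x ^ (k + m) * norm (iter_partial v f x) \<le> S" if "length v \<le> length is" for v x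
    proof -
      have "\<bar>A v\<bar> \<le> S" unfolding S_def using that by (intro member_le_sum) (auto simp: finite_lists_le)
      with A[of x v] show ?thesis by simp
    qed
    then have "jbracket x ^ k * norm (iter_partial is (\<lambda>x. B (b x) (f x)) x) \<le> 2 ^ length is * (C * K) * S" for x
      by (intro weighted_bilinear_le[OF B K C sf]) auto
    then show "\<exists>A. \<forall>x. jbracket x ^ k * norm (iter_partial is (\<lambda>x. B (b x) (f x)) x) \<le> A" by blast
  qed
qed

lemma snorm_bilinear_le:
  fixes f :: "('n::finite, 'b::real_normed_vector) schwartz"
  assumes B: "bounded_bilinear B" "K \<ge> 0" "\<And>x y. norm (B x y) \<le> norm x * norm y * K"
    and C: "growth_bound L C m b" and g: "Rep_schwartz g = (\<lambda>x. B (b x) (Rep_schwartz f x))"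
  shows "snorm L g \<le> 2 ^ L * (C * K) * snorm (L + m) f"
proof (rule snorm_leI)
  fix "is" :: "'n list" and x :: "real ^ 'n" assume "length is \<le> L"
  then show "jbracket x ^ L * norm (iter_partial is (Rep_schwartz g) x) \<le> 2 ^ L * (C * K) * snorm (L + m) f"
    unfolding g by (intro weighted_bilinear_le[OF B C smooth_Rep] snorm_ge) auto
qed

section \<open>The strong topology of tempered distributions\<close>

lemma Rep_tempered_clinear: "clinear (Rep_tempered u)"
  and continuous_on_Rep_tempered: "continuous_on UNIV (Rep_tempered u)"
  using Rep_tempered[of u] by auto

lemma Rep_tempered_add: "Rep_tempered u (f + g) = Rep_tempered u f + Rep_tempered u g"
  and Rep_tempered_scaleC: "Rep_tempered u (c *\<^sub>C f) = c *\<^sub>C Rep_tempered u f"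
  using Rep_tempered_clinear[of u] by (auto simp: clinear_iff)

lemma clinear_imp_linear: "clinear T \<Longrightarrow> linear T"
  by (rule linearI) (auto simp: clinear_iff scaleC_of_real[symmetric])

lemma linear_Rep_tempered: "linear (Rep_tempered u)"
  by (rule clinear_imp_linear[OF Rep_tempered_clinear])

lemmas Rep_tempered_scaleR = linear_cmul[OF linear_Rep_tempered]
lemmas Rep_tempered_diff = linear_diff[OF linear_Rep_tempered]

lemma tempered_diff: "Rep_tempered (u - v) f = Rep_tempered u f - Rep_tempered v f"
  unfolding minus_tempered_def uminus_tempered_def plus_tempered.rep_eq scaleC_tempered.rep_eq
  by (simp add: scaleC_minus_one)

lemma tempered_scaleR: "Rep_tempered (r *\<^sub>R u) f = r *\<^sub>R Rep_tempered u f"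
  by (simp only: scaleR_tempered_def scaleC_tempered.rep_eq) (rule scaleC_of_real)

lemma tempered_bound:
  obtains C k where "C \<ge> 0" "\<And>f. norm (Rep_tempered u f) \<le> C * snorm k f"
  using continuous_schwartz_functional_bound[OF Rep_tempered_scaleR continuous_on_Rep_tempered] by blast

text \<open>The sets \<open>{v. \<forall>\<phi>\<in>B. norm (v \<phi> - u \<phi>) < \<epsilon>}\<close> need not be open when \<open>B\<close> is infinite;
  keeping a uniform distance from \<open>\<epsilon>\<close> makes them so.\<close>

lemma open_tempered_nbhd:
  "open {v. \<exists>\<delta><\<epsilon>. \<forall>\<phi>\<in>B. norm (Rep_tempered v \<phi> - Rep_tempered u \<phi>) \<le> \<delta>}"
    (is "open ?U") if B: "vn_bounded B"
  unfolding open_tempered_def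
proof
  fix v assume "v \<in> ?U"
  then obtain \<delta> where \<delta>: "\<delta> < \<epsilon>" "\<And>\<phi>. \<phi> \<in> B \<Longrightarrow> norm (Rep_tempered v \<phi> - Rep_tempered u \<phi>) \<le> \<delta>" by blast
  define \<eta> where "\<eta> = (\<epsilon> - \<delta>) / 2"
  have "w \<in> ?U" if w: "\<forall>\<phi>\<in>B. norm (Rep_tempered w \<phi> - Rep_tempered v \<phi>) < \<eta>" for w
  proof -
    have "norm (Rep_tempered w \<phi> - Rep_tempered u \<phi>) \<le> \<eta> + \<delta>" if "\<phi> \<in> B" for \<phi>
    proof -
      have "norm (Rep_tempered w \<phi> - Rep_tempered u \<phi>) \<le>
          norm (Rep_tempered w \<phi> - Rep_tempered v \<phi>) + norm (Rep_tempered v \<phi> - Rep_tempered u \<phi>)"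
        using norm_triangle_ineq[of "Rep_tempered w \<phi> - Rep_tempered v \<phi>" "Rep_tempered v \<phi> - Rep_tempered u \<phi>"] by simp
      with w that \<delta>(2)[OF that] show ?thesis by fastforce
    qed
    moreover have "\<eta> + \<delta> < \<epsilon>" using \<delta>(1) by (simp add: \<eta>_def field_simps)
    ultimately show ?thesis by blast
  qed
  moreover have "\<eta> > 0" using \<delta>(1) by (simp add: \<eta>_def)
  ultimately show "\<exists>B (\<epsilon>'::real). vn_bounded B \<and> \<epsilon>' > 0 \<and>
     {w. \<forall>\<phi>\<in>B. norm (Rep_tempered w \<phi> - Rep_tempered v \<phi>) < \<epsilon>'} \<subseteq> ?U"
    using B by (intro exI[of _ B] exI[of _ \<eta>]) blast
qed

lemma tendsto_temperedI:
  assumes "\<And>B. vn_bounded B \<Longrightarrow>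
    \<exists>g. (\<forall>\<^sub>F x in F. \<forall>\<phi>\<in>B. norm (Rep_tempered (u x - l) \<phi>) \<le> g x) \<and> (g \<longlongrightarrow> (0::real)) F"
  shows "(u \<longlongrightarrow> l) F"
proof (rule topological_tendstoI)
  fix S assume "open S" "l \<in> S"
  then obtain B \<epsilon> where B: "vn_bounded B" "\<epsilon> > (0::real)"
     "{v. \<forall>\<phi>\<in>B. norm (Rep_tempered v \<phi> - Rep_tempered l \<phi>) < \<epsilon>} \<subseteq> S"
    unfolding open_tempered_def by blast
  from assms[OF B(1)] obtain g where g: "\<forall>\<^sub>F x in F. \<forall>\<phi>\<in>B. norm (Rep_tempered (u x - l) \<phi>) \<le> g x" "(g \<longlongrightarrow> (0::real)) F"
    by blast
  have "\<forall>\<^sub>F x in F. g x < \<epsilon>"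
    using order_tendstoD(2)[OF g(2) B(2)] .
  with g(1) show "\<forall>\<^sub>F x in F. u x \<in> S"
    by eventually_elim (use B(3) in \<open>force simp: tempered_diff\<close>)
qed

lemma tendsto_temperedD:
  assumes u: "(u \<longlongrightarrow> l) F" and B: "vn_bounded B" and e: "\<epsilon> > 0"
  shows "\<forall>\<^sub>F x in F. \<forall>\<phi>\<in>B. norm (Rep_tempered (u x - l) \<phi>) < \<epsilon>"
proof -
  have "\<forall>\<^sub>F x in F. u x \<in> {v. \<exists>\<delta><\<epsilon>. \<forall>\<phi>\<in>B. norm (Rep_tempered v \<phi> - Rep_tempered l \<phi>) \<le> \<delta>}"
    using e by (intro topological_tendstoD[OF u] open_tempered_nbhd[OF B]) (auto intro: exI[of _ 0])
  then show ?thesis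
    by eventually_elim (force simp: tempered_diff)
qed

lemma vn_bounded_temperedD:
  assumes V: "vn_bounded V" and B: "vn_bounded B"
  obtains A where "A \<ge> 0" "\<And>u \<phi>. u \<in> V \<Longrightarrow> \<phi> \<in> B \<Longrightarrow> norm (Rep_tempered u \<phi>) \<le> A"
proof -
  let ?U = "{v. \<exists>\<delta><1. \<forall>\<phi>\<in>B. norm (Rep_tempered v \<phi> - Rep_tempered 0 \<phi>) \<le> \<delta>}"
  have "open ?U \<and> 0 \<in> ?U"
    by (intro conjI open_tempered_nbhd[OF B]) (auto intro: exI[of _ 0])
  then obtain r where r: "r > 0" "\<And>s. s > r \<Longrightarrow> V \<subseteq> (\<lambda>x. s *\<^sub>R x) ` ?U"
    using V unfolding vn_bounded_def by blast
  have "norm (Rep_tempered u \<phi>) \<le> r + 1" if u: "u \<in> V" and \<phi>: "\<phi> \<in> B" for u \<phi>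
  proof -
    have "u \<in> (\<lambda>x. (r + 1) *\<^sub>R x) ` ?U"
      using r(2)[of "r + 1", OF less_add_one] u by (rule subsetD)
    then obtain v where v: "u = (r + 1) *\<^sub>R v" "v \<in> ?U" by blast
    then have "norm (Rep_tempered v \<phi>) \<le> 1"
      using \<phi> by (fastforce simp: zero_tempered.rep_eq)
    then show ?thesis using r(1) by (simp add: v(1) tempered_scaleR mult_left_le)
  qed
  with r(1) show ?thesis by (intro that[of "r + 1"]) auto
qed

lemma vn_bounded_temperedI:
  assumes "\<And>B. vn_bounded B \<Longrightarrow> \<exists>A. \<forall>u\<in>V. \<forall>\<phi>\<in>B. norm (Rep_tempered u \<phi>) \<le> A"
  shows "vn_bounded V"
  unfolding vn_bounded_def
proof (intro allI impI)
  fix U :: "('a, 'b) tempered set" assume U: "open U \<and> 0 \<in> U"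
  then obtain B \<epsilon> where B: "vn_bounded B" "\<epsilon> > (0::real)"
     "{v. \<forall>\<phi>\<in>B. norm (Rep_tempered v \<phi> - Rep_tempered 0 \<phi>) < \<epsilon>} \<subseteq> U"
    unfolding open_tempered_def by blast
  obtain A where A: "\<And>u \<phi>. u \<in> V \<Longrightarrow> \<phi> \<in> B \<Longrightarrow> norm (Rep_tempered u \<phi>) \<le> A"
    using assms[OF B(1)] by blast
  define r where "r = (\<bar>A\<bar> + 1) / \<epsilon>"
  have r: "r > 0" using B(2) by (simp add: r_def add_nonneg_pos)
  have "V \<subseteq> (\<lambda>x. s *\<^sub>R x) ` U" if s: "s > r" for s
  proof
    fix u assume u: "u \<in> V"
    have "norm (Rep_tempered ((1 / s) *\<^sub>R u) \<phi> - Rep_tempered 0 \<phi>) < \<epsilon>" if "\<phi> \<in> B" for \<phi>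
    proof -
      have "norm (Rep_tempered u \<phi>) < \<epsilon> * r" using A[OF u that] B(2) by (auto simp: r_def)
      also have "\<dots> < \<epsilon> * s" using s B(2) by simp
      finally show ?thesis using s r by (simp add: tempered_scaleR zero_tempered.rep_eq field_simps)
    qed
    then have "(1 / s) *\<^sub>R u \<in> U" using B(3) by blast
    then show "u \<in> (\<lambda>x. s *\<^sub>R x) ` U" using s r by (intro image_eqI[of _ _ "(1 / s) *\<^sub>R u"]) auto
  qed
  with r show "\<exists>r>0. \<forall>s>r. V \<subseteq> (\<lambda>x. s *\<^sub>R x) ` U" by blast
qed

text \<open>Operators on distributions arise by transposition, and the strong topology only sees how the
  transposed operators act on bounded sets of test functions.\<close>

definition dual_controlled :: "(('n::finite, 'N::finite) tempered \<Rightarrow> ('n, 'N) tempered) set \<Rightarrow> bool" where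
  "dual_controlled \<T> \<longleftrightarrow> (\<forall>B. vn_bounded B \<longrightarrow> (\<exists>B' C. vn_bounded B' \<and>
     (\<forall>T\<in>\<T>. \<forall>u A. A \<ge> 0 \<longrightarrow> (\<forall>\<psi>\<in>B'. norm (Rep_tempered u \<psi>) \<le> A) \<longrightarrow>
        (\<forall>\<phi>\<in>B. norm (Rep_tempered (T u) \<phi>) \<le> C * A))))"

lemma dual_controlled_bounded:
  fixes \<T> :: "(('n::finite, 'N::finite) tempered \<Rightarrow> ('n, 'N) tempered) set"
  assumes "dual_controlled \<T>"
  shows "bounded_operators \<T>"
  unfolding bounded_operators_def
proof (intro allI impI vn_bounded_temperedI)
  fix V :: "('n, 'N) tempered set" and B :: "('n, complex) schwartz set" assume V: "vn_bounded V" and B: "vn_bounded B"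
  obtain B' C where B': "vn_bounded B'" "\<forall>T\<in>\<T>. \<forall>u A. A \<ge> 0 \<longrightarrow> (\<forall>\<psi>\<in>B'. norm (Rep_tempered u \<psi>) \<le> A) \<longrightarrow>
        (\<forall>\<phi>\<in>B. norm (Rep_tempered (T u) \<phi>) \<le> C * A)"
    using assms B unfolding dual_controlled_def by blast
  obtain A where A: "A \<ge> 0" "\<And>u \<psi>. u \<in> V \<Longrightarrow> \<psi> \<in> B' \<Longrightarrow> norm (Rep_tempered u \<psi>) \<le> A"
    using vn_bounded_temperedD[OF V B'(1)] by blast
  have "norm (Rep_tempered (T u) \<phi>) \<le> C * A" if "T \<in> \<T>" "u \<in> V" "\<phi> \<in> B" for T u \<phi>
    using B'(2) A that by blast
  then show "\<exists>A. \<forall>u\<in>\<Union>T\<in>\<T>. T ` V. \<forall>\<phi>\<in>B. norm (Rep_tempered u \<phi>) \<le> A" by blast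
qed

lemma dual_controlled_continuous:
  fixes T :: "('n::finite, 'N::finite) tempered \<Rightarrow> ('n, 'N) tempered"
  assumes "dual_controlled {T}" and lin: "linear T"
  shows "continuous_on UNIV T"
  unfolding continuous_on_def
proof (intro ballI topological_tendstoI)
  fix u :: "('n, 'N) tempered" and S assume "open S" "T u \<in> S"
  then obtain B \<epsilon> where B: "vn_bounded B" "\<epsilon> > (0::real)"
     "{v. \<forall>\<phi>\<in>B. norm (Rep_tempered v \<phi> - Rep_tempered (T u) \<phi>) < \<epsilon>} \<subseteq> S"
    unfolding open_tempered_def by blast
  obtain B' C where B': "vn_bounded B'" "\<And>u A. A \<ge> 0 \<Longrightarrow> (\<forall>\<psi>\<in>B'. norm (Rep_tempered u \<psi>) \<le> A) \<Longrightarrow>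
        (\<forall>\<phi>\<in>B. norm (Rep_tempered (T u) \<phi>) \<le> C * A)"
    using assms B(1) unfolding dual_controlled_def by (metis singletonI)
  define \<eta> where "\<eta> = \<epsilon> / (\<bar>C\<bar> + 1)"
  have \<eta>: "\<eta> > 0" using B(2) by (simp add: \<eta>_def add_nonneg_pos)
  have C\<eta>: "C * \<eta> < \<epsilon>"
  proof -
    have "C * \<eta> < (\<bar>C\<bar> + 1) * \<eta>" using \<eta> by (intro mult_strict_right_mono) auto
    then show ?thesis by (simp add: \<eta>_def add_nonneg_pos)
  qed
  have "\<forall>\<^sub>F v in at u. \<forall>\<psi>\<in>B'. norm (Rep_tempered (v - u) \<psi>) < \<eta>"
    by (rule tendsto_temperedD[OF tendsto_ident_at B'(1) \<eta>])
  then show "\<forall>\<^sub>F v in at u. T v \<in> S"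
  proof eventually_elim
    case (elim v)
    have "\<forall>\<phi>\<in>B. norm (Rep_tempered (T (v - u)) \<phi>) \<le> C * \<eta>"
      using elim \<eta> by (intro B'(2)) (auto intro: less_imp_le)
    then have "\<forall>\<phi>\<in>B. norm (Rep_tempered (T v) \<phi> - Rep_tempered (T u) \<phi>) < \<epsilon>"
      using C\<eta> by (auto simp: linear_diff[OF lin] tempered_diff)
    then show ?case using B(3) by blast
  qed
qed

section \<open>Integrals over Euclidean space and Gaussians\<close>

lemma bounded_bilinear_scaleC: "bounded_bilinear (scaleC :: complex \<Rightarrow> 'b::complex_normed_vector \<Rightarrow> 'b)"
proof
  fix a a' :: complex and b b' :: 'b and r :: real
  show "(a + a') *\<^sub>C b = a *\<^sub>C b + a' *\<^sub>C b" "a *\<^sub>C (b + b') = a *\<^sub>C b + a *\<^sub>C b'"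
    by (simp_all add: scaleC_add_left scaleC_add_right)
  show "(r *\<^sub>R a) *\<^sub>C b = r *\<^sub>R a *\<^sub>C b"
    by (simp add: scaleC_of_real[symmetric] scaleC_scaleC scaleC_complex_def)
  show "a *\<^sub>C r *\<^sub>R b = r *\<^sub>R a *\<^sub>C b"
    by (simp add: scaleC_of_real[symmetric] scaleC_scaleC mult.commute)
  show "\<exists>K. \<forall>(a :: complex) (b :: 'b). norm (a *\<^sub>C b) \<le> norm a * norm b * K"
    by (intro exI[of _ 1]) (simp add: norm_scaleC)
qed

lemmas continuous_on_scaleC [continuous_intros] = bounded_bilinear.continuous_on[OF bounded_bilinear_scaleC]
lemmas tendsto_scaleC [tendsto_intros] = bounded_bilinear.tendsto[OF bounded_bilinear_scaleC]

lemma borel_measurable_scaleC [measurable]: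
  fixes g :: "'a \<Rightarrow> 'b::{complex_normed_vector, second_countable_topology}"
  assumes "f \<in> borel_measurable M" "g \<in> borel_measurable M"
  shows "(\<lambda>x. f x *\<^sub>C g x) \<in> borel_measurable M"
  by (rule borel_measurable_continuous_Pair[OF assms]) (intro continuous_intros)

text \<open>The exponent is twice the dimension, enough for integrability; the type argument carries the dimension.\<close>

definition weight_exp :: "'n::finite itself \<Rightarrow> nat" where
  "weight_exp _ = 2 * CARD('n)"

definition weight :: "real ^ 'n::finite \<Rightarrow> real" where
  "weight x = 1 / jbracket x ^ weight_exp TYPE('n)"

lemma weight_pos: "0 < weight x"
  by (simp add: weight_def jbracket_pos)

lemma continuous_on_jbracket [continuous_intros]:
  "continuous_on S f \<Longrightarrow> continuous_on S (\<lambda>x. jbracket (f x))"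
  unfolding jbracket_def by (intro continuous_intros)

lemma borel_measurable_jbracket [measurable]: "jbracket \<in> borel_measurable borel"
  by (intro borel_measurable_continuous_onI continuous_intros)

lemma borel_measurable_weight [measurable]: "weight \<in> borel_measurable borel"
  unfolding weight_def[abs_def] by measurable

text \<open>Each of the factors \<open>1 + x\<^sub>j\<^sup>2\<close> is at most \<open>1 + \<bar>x\<bar>\<^sup>2\<close>, so a product of one-dimensional integrals
  dominates the weight.\<close>

lemma integrable_weight: "integrable lborel (weight :: real ^ 'n::finite \<Rightarrow> real)"
proof (rule integrableI_bounded)
  have le: "norm (weight x) \<le> (\<Prod>b\<in>Basis. inverse (1 + (x \<bullet> b)\<^sup>2))" for x :: "real ^ 'n"
  proof -
    have "(\<Prod>b\<in>Basis. 1 + (x \<bullet> b)\<^sup>2) \<le> (\<Prod>b\<in>(Basis :: (real ^ 'n) set). 1 + (norm x)\<^sup>2)"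
      by (intro prod_mono) (auto simp: abs_le_square_iff[symmetric] Basis_le_norm)
    also have "\<dots> = jbracket x ^ weight_exp TYPE('n)"
      by (simp add: weight_exp_def power_mult jbracket_squared)
    finally have "(\<Prod>b\<in>Basis. 1 + (x \<bullet> b)\<^sup>2) \<le> jbracket x ^ weight_exp TYPE('n)" .
    moreover have "0 < (\<Prod>b\<in>Basis. 1 + (x \<bullet> b)\<^sup>2)"
      by (intro prod_pos) (simp add: add_pos_nonneg)
    ultimately show ?thesis
      using weight_pos[of x] by (simp add: weight_def prod_inversef[unfolded comp_def] divide_inverse le_imp_inverse_le)
  qed
  have "set_integrable lborel UNIV (\<lambda>t::real. inverse (1 + t\<^sup>2))"
    using integrable_inverse_1_plus_square by (simp add: einterval_def)
  then have fin: "(\<integral>\<^sup>+t. ennreal (inverse (1 + (t::real)\<^sup>2)) \<partial>lborel) < \<infinity>"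
    by (simp add: set_integrable_def integrable_iff_bounded)
  have "(\<integral>\<^sup>+x. ennreal (norm (weight (x :: real ^ 'n))) \<partial>lborel) \<le>
      (\<integral>\<^sup>+x. (\<Prod>b\<in>(Basis :: (real ^ 'n) set). ennreal (inverse (1 + (x \<bullet> b)\<^sup>2))) \<partial>lborel)"
    by (intro nn_integral_mono) (simp add: prod_ennreal le ennreal_leI del: real_norm_def)
  also have "\<dots> = (\<Prod>b\<in>(Basis :: (real ^ 'n) set). (\<integral>\<^sup>+t. ennreal (inverse (1 + (t::real)\<^sup>2)) \<partial>lborel))"
    by (rule nn_integral_lborel_prod) auto
  also have "\<dots> < \<infinity>"
    using fin by (simp add: power_less_top_ennreal)
  finally show "(\<integral>\<^sup>+x. ennreal (norm (weight (x :: real ^ 'n))) \<partial>lborel) < \<infinity>" .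
qed simp

definition weight_integral :: "'n::finite itself \<Rightarrow> real" where
  "weight_integral _ = integral\<^sup>L lborel (weight :: real ^ 'n \<Rightarrow> real)"

lemma weight_integral_nonneg: "0 \<le> weight_integral TYPE('n::finite)"
  unfolding weight_integral_def by (intro integral_nonneg_AE) (simp add: less_imp_le[OF weight_pos])

lemma integrable_of_weight_bound:
  fixes f :: "real ^ 'n::finite \<Rightarrow> 'b::{banach, second_countable_topology}"
  assumes "f \<in> borel_measurable borel" "\<And>x. norm (f x) \<le> A * weight x"
  shows "integrable lborel f" and "norm (integral\<^sup>L lborel f) \<le> A * weight_integral TYPE('n)"
proof -
  have w: "integrable lborel (\<lambda>x :: real ^ 'n. A * weight x)"
    by (intro integrable_mult_right integrable_weight)
  show i: "integrable lborel f"
    by (rule Bochner_Integration.integrable_bound[OF w])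
      (use assms in \<open>auto intro: order_trans[OF _ abs_ge_self]\<close>)
  have "norm (integral\<^sup>L lborel f) \<le> (\<integral>x. norm (f x) \<partial>lborel)"
    by (rule integral_norm_bound)
  also have "\<dots> \<le> (\<integral>x. A * weight (x :: real ^ 'n) \<partial>lborel)"
    by (intro integral_mono w integrable_norm i assms(2))
  finally show "norm (integral\<^sup>L lborel f) \<le> A * weight_integral TYPE('n)"
    by (simp add: weight_integral_def)
qed

lemma integral_lborel_affine:
  fixes f :: "'a::euclidean_space \<Rightarrow> 'b::{banach, second_countable_topology}"
  assumes "c > 0" and [measurable]: "f \<in> borel_measurable borel"
  shows "(\<integral>x. f x \<partial>lborel) = c ^ DIM('a) *\<^sub>R (\<integral>x. f (t + c *\<^sub>R x) \<partial>lborel)"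
proof -
  have "(\<integral>x. f x \<partial>lborel) = (\<integral>x. f x \<partial>density (distr lborel borel (\<lambda>x. t + c *\<^sub>R x)) (\<lambda>_. \<bar>c\<bar> ^ DIM('a)))"
    using lborel_affine[of c t] assms(1) by simp
  also have "\<dots> = (\<integral>x. (\<bar>c\<bar> ^ DIM('a)) *\<^sub>R f x \<partial>distr lborel borel (\<lambda>x. t + c *\<^sub>R x))"
    by (subst integral_density) auto
  also have "\<dots> = (\<integral>x. (\<bar>c\<bar> ^ DIM('a)) *\<^sub>R f (t + c *\<^sub>R x) \<partial>lborel)"
    by (subst integral_distr) auto
  finally show ?thesis using assms(1) by simp
qed

definition gaussian :: "real ^ 'n::finite \<Rightarrow> real" where
  "gaussian x = exp (- (norm x)\<^sup>2 / 2)"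

lemma integral_gaussian_real:
  "integrable lborel (\<lambda>x. iexp (t * x) * complex_of_real (exp (- x\<^sup>2 / 2)))"
  "(\<integral>x. iexp (t * x) * complex_of_real (exp (- x\<^sup>2 / 2)) \<partial>lborel) = complex_of_real (sqrt (2 * pi) * exp (- t\<^sup>2 / 2))"
proof -
  have eq: "iexp (t * x) * complex_of_real (exp (- x\<^sup>2 / 2)) =
      complex_of_real (sqrt (2 * pi)) * (std_normal_density x *\<^sub>R iexp (t * x))" for x
    by (simp add: std_normal_density_def scaleR_conv_of_real)
  have "integrable lborel (\<lambda>x. std_normal_density x *\<^sub>R iexp (t * x))"
    by (rule Bochner_Integration.integrable_bound[OF integrable_normal_density[of 1 0]]) auto
  then show "integrable lborel (\<lambda>x. iexp (t * x) * complex_of_real (exp (- x\<^sup>2 / 2)))"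
    unfolding eq by (rule integrable_mult_right)
  have "(\<integral>x. std_normal_density x *\<^sub>R iexp (t * x) \<partial>lborel) = char std_normal_distribution t"
    unfolding char_def by (subst integral_density) auto
  then show "(\<integral>x. iexp (t * x) * complex_of_real (exp (- x\<^sup>2 / 2)) \<partial>lborel) = complex_of_real (sqrt (2 * pi) * exp (- t\<^sup>2 / 2))"
    unfolding eq integral_mult_right_zero by (simp only: char_std_normal_distribution of_real_mult)
qed

text \<open>Lebesgue measure is the image of a product of one-dimensional measures under the coordinates.\<close>

lemma integral_lborel_prod_complex:
  fixes f :: "'a::euclidean_space \<Rightarrow> real \<Rightarrow> complex"
  assumes f: "\<And>b. b \<in> Basis \<Longrightarrow> integrable lborel (f b)"
  shows "integrable lborel (\<lambda>x::'a. \<Prod>b\<in>Basis. f b (x \<bullet> b))"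
    and "(\<integral>x. (\<Prod>b\<in>Basis. f b (x \<bullet> b)) \<partial>lborel) = (\<Prod>b\<in>Basis. integral\<^sup>L lborel (f b))"
proof -
  interpret product_sigma_finite "\<lambda>_::'a. lborel :: real measure" ..
  have m [measurable]: "f b \<in> borel_measurable borel" if "b \<in> Basis" for b
    using borel_measurable_integrable[OF f[OF that]] by simp
  have eq: "(\<Prod>b\<in>Basis. f b ((\<Sum>c\<in>Basis. x c *\<^sub>R c) \<bullet> b)) = (\<Prod>b\<in>Basis. f b (x b))" for x
    by (intro prod.cong) auto
  have T: "(\<lambda>x. \<Sum>b\<in>Basis. x b *\<^sub>R b :: 'a) \<in> measurable (\<Pi>\<^sub>M b\<in>Basis. lborel) borel"
    by simp
  have g: "(\<lambda>x::'a. \<Prod>b\<in>Basis. f b (x \<bullet> b)) \<in> borel_measurable borel"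
    by measurable
  show "integrable lborel (\<lambda>x::'a. \<Prod>b\<in>Basis. f b (x \<bullet> b))"
    by (subst lborel_eq, subst integrable_distr_eq[OF T g]) (simp add: eq product_integrable_prod f)
  show "(\<integral>x. (\<Prod>b\<in>Basis. f b (x \<bullet> b)) \<partial>lborel) = (\<Prod>b\<in>Basis. integral\<^sup>L lborel (f b))"
    by (subst lborel_eq, subst integral_distr[OF T g]) (simp add: eq product_integral_prod f)
qed

text \<open>Both the Gaussian and the character are products over the coordinates, and in one dimension the integral is the characteristic
  function of the standard normal distribution.\<close>

lemma integral_gaussian:
  fixes \<xi> :: "real ^ 'n::finite"
  shows "integrable lborel (\<lambda>x. iexp (x \<bullet> \<xi>) * complex_of_real (gaussian x))"
    and "(\<integral>x. iexp (x \<bullet> \<xi>) * complex_of_real (gaussian x) \<partial>lborel) =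
      complex_of_real ((2 * pi) powr (real CARD('n) / 2) * gaussian \<xi>)"
proof -
  define f where "f b x = iexp ((\<xi> \<bullet> b) * x) * complex_of_real (exp (- x\<^sup>2 / 2))" for b :: "real ^ 'n" and x
  have eq: "iexp (x \<bullet> \<xi>) * complex_of_real (gaussian x) = (\<Prod>b\<in>Basis. f b (x \<bullet> b))" for x
  proof -
    have g: "gaussian x = (\<Prod>b\<in>Basis. exp (- (x \<bullet> b)\<^sup>2 / 2))"
      unfolding gaussian_def power2_norm_eq_inner euclidean_inner[of x x]
      by (simp add: exp_sum[symmetric] sum_negf sum_divide_distrib power2_eq_square)
    have "iexp (x \<bullet> \<xi>) = (\<Prod>b\<in>Basis. iexp ((\<xi> \<bullet> b) * (x \<bullet> b)))"
      unfolding euclidean_inner[of x \<xi>]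
      by (simp add: exp_sum[symmetric] sum_distrib_left mult_ac)
    then show ?thesis by (simp add: g f_def prod.distrib)
  qed
  have i: "integrable lborel (f b)" for b
    unfolding f_def[abs_def] by (rule integral_gaussian_real)
  show "integrable lborel (\<lambda>x. iexp (x \<bullet> \<xi>) * complex_of_real (gaussian x))"
    unfolding eq by (rule integral_lborel_prod_complex[OF i])
  have "(\<integral>x. iexp (x \<bullet> \<xi>) * complex_of_real (gaussian x) \<partial>lborel) =
      (\<Prod>b\<in>(Basis :: (real ^ 'n) set). complex_of_real (sqrt (2 * pi) * exp (- (\<xi> \<bullet> b)\<^sup>2 / 2)))"
    unfolding eq integral_lborel_prod_complex(2)[of f, OF i]
    by (intro prod.cong refl) (simp only: f_def[abs_def] integral_gaussian_real)
  also have "\<dots> = complex_of_real (sqrt (2 * pi) ^ CARD('n) * (\<Prod>b\<in>Basis. exp (- (\<xi> \<bullet> b)\<^sup>2 / 2)))"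
    by (simp add: prod.distrib)
  also have "(\<Prod>b\<in>Basis. exp (- (\<xi> \<bullet> b)\<^sup>2 / 2)) = gaussian \<xi>"
    unfolding gaussian_def power2_norm_eq_inner euclidean_inner[of \<xi> \<xi>]
    by (simp add: exp_sum[symmetric] sum_negf sum_divide_distrib power2_eq_square)
  also have "sqrt (2 * pi) ^ CARD('n) = (2 * pi) powr (real CARD('n) / 2)"
    by (simp add: powr_half_sqrt[symmetric] powr_realpow[symmetric] powr_powr)
  finally show "(\<integral>x. iexp (x \<bullet> \<xi>) * complex_of_real (gaussian x) \<partial>lborel) =
      complex_of_real ((2 * pi) powr (real CARD('n) / 2) * gaussian \<xi>)" .
qed

section \<open>The Fourier transform on the Schwartz space\<close>

lemma Rep_schwartz_eqI: "(\<And>x. Rep_schwartz f x = Rep_schwartz g x) \<Longrightarrow> f = g"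
  by (metis Rep_schwartz_inject ext)

lemma growth_bound_coordinate: "growth_bound L 1 1 (\<lambda>x :: real ^ 'n::finite. x $ j)"
proof -
  have d: "((\<lambda>x :: real ^ 'n. x $ j) has_derivative (\<lambda>h. h $ j)) (at x)" for x
    by (rule bounded_linear.has_derivative[OF bounded_linear_vec_nth has_derivative_ident])
  have p: "partial i (\<lambda>x :: real ^ 'n. x $ j) = (\<lambda>x. axis i 1 $ j)" for i
    by (rule ext) (rule partial_eqI[OF d])
  show ?thesis
    unfolding growth_bound_def
  proof (intro conjI allI impI)
    show "smooth (\<lambda>x :: real ^ 'n. x $ j)"
      by (rule smooth_partialI) (auto simp: p smooth_const intro: differentiableI[OF d])
    fix "is" :: "'n list" and x :: "real ^ 'n"
    show "norm (iter_partial is (\<lambda>x. x $ j) x) \<le> 1 * jbracket x ^ 1"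
    proof (cases "is" rule: rev_exhaust)
      case Nil
      then show ?thesis using component_le_jbracket[of x j] by simp
    next
      case (snoc js i)
      then show ?thesis using jbracket_ge_1[of x]
        by (simp add: iter_partial_append p iter_partial_const axis_def)
    qed
  qed
qed

definition coord_mult :: "'n \<Rightarrow> ('n::finite, 'b::real_normed_vector) schwartz \<Rightarrow> ('n, 'b) schwartz" where
  "coord_mult j f = Abs_schwartz (\<lambda>x. (x $ j) *\<^sub>R Rep_schwartz f x)"

lemma Rep_coord_mult: "Rep_schwartz (coord_mult j f) = (\<lambda>x. (x $ j) *\<^sub>R Rep_schwartz f x)"
  unfolding coord_mult_def
  using is_schwartz_bilinear[OF bounded_bilinear_scaleR _ is_schwartz_Rep, of "\<lambda>x. x $ j" f] growth_bound_coordinate[of _ j]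
  by (intro Abs_schwartz_inverse) blast

lemma snorm_coord_mult: "snorm L (coord_mult j f) \<le> 2 ^ L * snorm (Suc L) f"
  using snorm_bilinear_le[OF bounded_bilinear_scaleR _ _ growth_bound_coordinate[of L j] Rep_coord_mult, of 1 f]
  by simp

definition partial_schwartz :: "'n \<Rightarrow> ('n::finite, 'b::real_normed_vector) schwartz \<Rightarrow> ('n, 'b) schwartz" where
  "partial_schwartz j f = Abs_schwartz (partial j (Rep_schwartz f))"

lemma iter_partial_partial: "iter_partial is (partial j f) = iter_partial (is @ [j]) f"
  by (simp add: iter_partial_append)

lemma Rep_partial_schwartz: "Rep_schwartz (partial_schwartz j f) = partial j (Rep_schwartz f)"
  unfolding partial_schwartz_def
proof (intro Abs_schwartz_inverse CollectI)
  show "is_schwartz (partial j (Rep_schwartz f))"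
    using is_schwartz_Rep[of f] by (auto simp: is_schwartz_iff iter_partial_partial smooth_partial)
qed

lemma snorm_partial_schwartz:
  fixes f :: "('n::finite, 'b::real_normed_vector) schwartz"
  shows "snorm L (partial_schwartz j f) \<le> snorm (Suc L) f"
proof (rule snorm_leI)
  fix "is" :: "'n list" and x :: "real ^ 'n" assume "length is \<le> L"
  then show "jbracket x ^ L * norm (iter_partial is (Rep_schwartz (partial_schwartz j f)) x) \<le> snorm (Suc L) f"
    unfolding Rep_partial_schwartz iter_partial_partial
    by (intro order_trans[OF mult_right_mono[OF jbracket_power_mono] snorm_ge]) auto
qed

lemma continuous_on_Rep_schwartz: "continuous_on S (Rep_schwartz f)"
  by (intro continuous_at_imp_continuous_on ballI differentiable_imp_continuous_within smooth_differentiable smooth_Rep)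

lemma borel_measurable_Rep_schwartz [measurable]: "Rep_schwartz f \<in> borel_measurable borel"
  by (intro borel_measurable_continuous_onI continuous_on_Rep_schwartz)

lemma schwartz_decay:
  fixes f :: "('n::finite, 'b::real_normed_vector) schwartz"
  assumes "length is \<le> k + weight_exp TYPE('n)"
  shows "jbracket x ^ k * norm (iter_partial is (Rep_schwartz f) x) \<le> snorm (k + weight_exp TYPE('n)) f * weight x"
proof -
  have J: "jbracket x ^ weight_exp TYPE('n) > 0" by (simp add: jbracket_pos)
  have "jbracket x ^ (k + weight_exp TYPE('n)) * norm (iter_partial is (Rep_schwartz f) x) \<le> snorm (k + weight_exp TYPE('n)) f"
    by (rule snorm_ge[OF assms])
  then show ?thesis using J by (simp add: weight_def power_add field_simps)
qed

definition ft :: "('n::finite, 'b::{complex_normed_vector, banach, second_countable_topology}) schwartz \<Rightarrow> real ^ 'n \<Rightarrow> 'b" where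
  "ft f \<xi> = (\<integral>x. iexp (x \<bullet> \<xi>) *\<^sub>C Rep_schwartz f x \<partial>lborel)"

lemma norm_iexp [simp]: "norm (iexp x) = 1"
  by (simp add: norm_exp_eq_Re)

lemma
  fixes f :: "('n::finite, 'b::{complex_normed_vector, banach, second_countable_topology}) schwartz"
  shows integrable_ft: "integrable lborel (\<lambda>x. iexp (x \<bullet> \<xi>) *\<^sub>C Rep_schwartz f x)"
    and norm_ft_le: "norm (ft f \<xi>) \<le> snorm (weight_exp TYPE('n)) f * weight_integral TYPE('n)"
proof -
  have "norm (iexp (x \<bullet> \<xi>) *\<^sub>C Rep_schwartz f x) \<le> snorm (weight_exp TYPE('n)) f * weight x" for x
    using schwartz_decay[of "[]" 0 x f] by (simp add: norm_scaleC)
  then show "integrable lborel (\<lambda>x. iexp (x \<bullet> \<xi>) *\<^sub>C Rep_schwartz f x)"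
    "norm (ft f \<xi>) \<le> snorm (weight_exp TYPE('n)) f * weight_integral TYPE('n)"
    unfolding ft_def by (intro integrable_of_weight_bound; measurable; simp)+
qed

lemma scaleC_sum_left: "(\<Sum>i\<in>A. c i) *\<^sub>C (x :: 'b::complex_normed_vector) = (\<Sum>i\<in>A. c i *\<^sub>C x)"
  by (rule bounded_bilinear.sum_left[OF bounded_bilinear_scaleC])

lemma ft_add: "ft (f + g) \<xi> = ft f \<xi> + ft g \<xi>"
  unfolding ft_def plus_schwartz.rep_eq
  by (simp add: scaleC_add_right Bochner_Integration.integral_add integrable_ft)

lemma ft_scaleC: "ft (c *\<^sub>C f) \<xi> = c *\<^sub>C ft f \<xi>"
proof -
  have "ft (c *\<^sub>C f) \<xi> = (\<integral>x. c *\<^sub>C (iexp (x \<bullet> \<xi>) *\<^sub>C Rep_schwartz f x) \<partial>lborel)"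
    unfolding ft_def scaleC_schwartz.rep_eq by (simp add: scaleC_scaleC mult.commute)
  also have "\<dots> = c *\<^sub>C ft f \<xi>"
    unfolding ft_def by (rule integral_bounded_linear[OF bounded_linear_scaleC integrable_ft])
  finally show ?thesis .
qed

lemma clinear_ft: "clinear (\<lambda>f. ft f \<xi>)"
  by (simp add: clinear_iff ft_add ft_scaleC)

lemma linear_ft: "linear (\<lambda>f. ft f \<xi>)"
  by (rule clinear_imp_linear[OF clinear_ft])

lemma has_derivative_quadratic:
  assumes L: "bounded_linear L" and q: "\<And>h. norm (f (x + h) - f x - L h) \<le> C * (norm h)\<^sup>2"
  shows "(f has_derivative L) (at x)"
  unfolding has_derivative_at_alt
proof (intro conjI L allI impI)
  fix e :: real assume e: "e > 0"
  define d where "d = e / (\<bar>C\<bar> + 1)"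
  have d: "d > 0" using e by (simp add: d_def add_nonneg_pos)
  have "norm (f y - f x - L (y - x)) \<le> e * norm (y - x)" if y: "norm (y - x) < d" for y
  proof -
    have "norm (f y - f x - L (y - x)) \<le> (\<bar>C\<bar> + 1) * (norm (y - x))\<^sup>2"
    proof -
      have "C * (norm (y - x))\<^sup>2 \<le> (\<bar>C\<bar> + 1) * (norm (y - x))\<^sup>2" by (intro mult_right_mono) auto
      with q[of "y - x"] show ?thesis by simp
    qed
    also have "\<dots> = ((\<bar>C\<bar> + 1) * norm (y - x)) * norm (y - x)" by (simp add: power2_eq_square)
    also have "\<dots> \<le> e * norm (y - x)"
    proof (intro mult_right_mono)
      have "(\<bar>C\<bar> + 1) * norm (y - x) \<le> (\<bar>C\<bar> + 1) * d" using y by (intro mult_left_mono) auto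
      also have "\<dots> = e" by (simp add: d_def add_nonneg_pos)
      finally show "(\<bar>C\<bar> + 1) * norm (y - x) \<le> e" .
    qed simp
    finally show ?thesis .
  qed
  with d show "\<exists>d>0. \<forall>y. norm (y - x) < d \<longrightarrow> norm (f y - f x - L (y - x)) \<le> e * norm (y - x)" by blast
qed

lemma norm_iexp_linear_approx: "norm (iexp t - 1 - \<i> * complex_of_real t) \<le> t\<^sup>2"
proof -
  have "norm (iexp t - (\<Sum>k\<le>1. (\<i> * complex_of_real t) ^ k / fact k)) \<le> \<bar>t\<bar> ^ Suc 1 / fact (Suc 1)"
    by (rule iexp_approx1)
  moreover have "(\<Sum>k\<le>1. (\<i> * complex_of_real t) ^ k / fact k) = 1 + \<i> * complex_of_real t"
    by simp
  moreover have "\<bar>t\<bar> ^ Suc 1 / fact (Suc 1) = t\<^sup>2 / 2"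
    by (simp only: Suc_1 power2_abs fact_2)
  ultimately have "norm (iexp t - 1 - \<i> * complex_of_real t) \<le> t\<^sup>2 / 2"
    by (simp only: diff_diff_eq)
  then show ?thesis by (rule order_trans) simp
qed

text \<open>The second order Taylor remainder of \<open>e\<^sup>i\<^sup>t\<close> is at most \<open>t\<^sup>2\<close>. With \<open>t = x \<bullet> h\<close> the factor \<open>\<bar>x\<bar>\<^sup>2\<close> is absorbed by the
  Schwartz function, which leaves an error quadratic in \<open>h\<close>.\<close>

lemma has_derivative_ft:
  fixes f :: "('n::finite, 'b::{complex_normed_vector, banach, second_countable_topology}) schwartz"
  shows "(ft f has_derivative (\<lambda>h. \<Sum>j\<in>UNIV. (h $ j) *\<^sub>R ft (\<i> *\<^sub>C coord_mult j f) \<xi>)) (at \<xi>)"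
proof (rule has_derivative_quadratic)
  let ?f = "Rep_schwartz f"
  show "bounded_linear (\<lambda>h. \<Sum>j\<in>UNIV. (h $ j) *\<^sub>R ft (\<i> *\<^sub>C coord_mult j f) \<xi>)"
    by (intro bounded_linear_sum bounded_linear_compose[OF bounded_linear_scaleR_left] bounded_linear_vec_nth)
  fix h :: "real ^ 'n"
  have i: "integrable lborel (\<lambda>x. (h $ j) *\<^sub>R (iexp (x \<bullet> \<xi>) *\<^sub>C Rep_schwartz (\<i> *\<^sub>C coord_mult j f) x))" for j
    by (intro integrable_scaleR_right integrable_ft)
  have pt: "(\<Sum>j\<in>UNIV. (h $ j) *\<^sub>R (iexp (x \<bullet> \<xi>) *\<^sub>C Rep_schwartz (\<i> *\<^sub>C coord_mult j f) x)) =
      (iexp (x \<bullet> \<xi>) * (\<i> * complex_of_real (x \<bullet> h))) *\<^sub>C ?f x" for x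
  proof -
    have "x \<bullet> h = (\<Sum>j\<in>UNIV. x $ j * h $ j)" by (simp add: inner_vec_def)
    then show ?thesis
      by (simp add: sum_distrib_left scaleC_sum_left scaleC_schwartz.rep_eq Rep_coord_mult
          scaleC_of_real[symmetric] scaleC_scaleC mult_ac)
  qed
  have S: "(\<Sum>j\<in>UNIV. (h $ j) *\<^sub>R ft (\<i> *\<^sub>C coord_mult j f) \<xi>) =
      (\<integral>x. (iexp (x \<bullet> \<xi>) * (\<i> * complex_of_real (x \<bullet> h))) *\<^sub>C ?f x \<partial>lborel)"
    unfolding ft_def pt[symmetric] by (simp add: i integral_scaleR_right)
  have iS: "integrable lborel (\<lambda>x. (iexp (x \<bullet> \<xi>) * (\<i> * complex_of_real (x \<bullet> h))) *\<^sub>C ?f x)"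
    unfolding pt[symmetric] by (intro Bochner_Integration.integrable_sum i)
  have eq: "iexp (x \<bullet> (\<xi> + h)) *\<^sub>C ?f x - iexp (x \<bullet> \<xi>) *\<^sub>C ?f x - (iexp (x \<bullet> \<xi>) * (\<i> * complex_of_real (x \<bullet> h))) *\<^sub>C ?f x =
      (iexp (x \<bullet> \<xi>) * (iexp (x \<bullet> h) - 1 - \<i> * complex_of_real (x \<bullet> h))) *\<^sub>C ?f x" for x
    by (simp add: inner_add_right exp_add distrib_left bounded_bilinear.diff_left[OF bounded_bilinear_scaleC]
        right_diff_distrib)
  have "ft f (\<xi> + h) - ft f \<xi> - (\<Sum>j\<in>UNIV. (h $ j) *\<^sub>R ft (\<i> *\<^sub>C coord_mult j f) \<xi>) =
      (\<integral>x. (iexp (x \<bullet> \<xi>) * (iexp (x \<bullet> h) - 1 - \<i> * complex_of_real (x \<bullet> h))) *\<^sub>C ?f x \<partial>lborel)"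
    unfolding S eq[symmetric] by (simp add: ft_def integrable_ft iS Bochner_Integration.integral_diff)
  also have "norm \<dots> \<le> ((norm h)\<^sup>2 * snorm (2 + weight_exp TYPE('n)) f) * weight_integral TYPE('n)"
  proof (rule integrable_of_weight_bound(2))
    show "norm ((iexp (x \<bullet> \<xi>) * (iexp (x \<bullet> h) - 1 - \<i> * complex_of_real (x \<bullet> h))) *\<^sub>C ?f x)
        \<le> (norm h)\<^sup>2 * snorm (2 + weight_exp TYPE('n)) f * weight x" for x
    proof -
      have "(x \<bullet> h)\<^sup>2 \<le> (norm x * norm h)\<^sup>2"
        using Cauchy_Schwarz_ineq2[of x h] by (metis abs_ge_zero power2_abs power_mono)
      also have "\<dots> \<le> (jbracket x)\<^sup>2 * (norm h)\<^sup>2"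
        by (simp add: power_mult_distrib mult_right_mono jbracket_squared)
      finally have "(x \<bullet> h)\<^sup>2 * norm (?f x) \<le> ((jbracket x)\<^sup>2 * (norm h)\<^sup>2) * norm (?f x)"
        by (rule mult_right_mono) simp
      also have "\<dots> = (norm h)\<^sup>2 * ((jbracket x)\<^sup>2 * norm (?f x))" by simp
      also have "\<dots> \<le> (norm h)\<^sup>2 * (snorm (2 + weight_exp TYPE('n)) f * weight x)"
        using schwartz_decay[of "[]" 2 x f] by (intro mult_left_mono) auto
      finally have "(x \<bullet> h)\<^sup>2 * norm (?f x) \<le> (norm h)\<^sup>2 * (snorm (2 + weight_exp TYPE('n)) f * weight x)" .
      moreover have "norm ((iexp (x \<bullet> \<xi>) * (iexp (x \<bullet> h) - 1 - \<i> * complex_of_real (x \<bullet> h))) *\<^sub>C ?f x) \<le> (x \<bullet> h)\<^sup>2 * norm (?f x)"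
        unfolding norm_scaleC norm_mult norm_iexp mult_1 by (intro mult_right_mono norm_iexp_linear_approx norm_ge_zero)
      ultimately show ?thesis by (simp add: mult.assoc)
    qed
  qed measurable
  finally show "norm (ft f (\<xi> + h) - ft f \<xi> - (\<Sum>j\<in>UNIV. (h $ j) *\<^sub>R ft (\<i> *\<^sub>C coord_mult j f) \<xi>)) \<le>
      (snorm (2 + weight_exp TYPE('n)) f * weight_integral TYPE('n)) * (norm h)\<^sup>2"
    by (simp add: mult_ac)
qed

lemma partial_ft: "partial j (ft f) = ft (\<i> *\<^sub>C coord_mult j f)"
proof
  fix \<xi>
  have "partial j (ft f) \<xi> = (\<Sum>k\<in>UNIV. (axis j 1 $ k) *\<^sub>R ft (\<i> *\<^sub>C coord_mult k f) \<xi>)"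
    by (rule partial_eqI[OF has_derivative_ft])
  also have "\<dots> = (\<Sum>k\<in>UNIV. if k = j then ft (\<i> *\<^sub>C coord_mult k f) \<xi> else 0)"
    by (intro sum.cong) (auto simp: axis_def)
  finally show "partial j (ft f) \<xi> = ft (\<i> *\<^sub>C coord_mult j f) \<xi>" by simp
qed

text \<open>\<open>moments is f\<close> is \<open>f\<close> multiplied by \<open>i x\<^sub>j\<close> for each \<open>j\<close> in the list; its transform is a derivative of that of \<open>f\<close>.\<close>

primrec moments :: "'n::finite list \<Rightarrow> ('n, 'b::complex_normed_vector) schwartz \<Rightarrow> ('n, 'b) schwartz" where
  "moments [] f = f"
| "moments (i # is) f = \<i> *\<^sub>C coord_mult i (moments is f)"

lemma iter_partial_ft: "iter_partial is (ft f) = ft (moments is f)"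
  by (induction "is") (simp_all add: partial_ft)

lemma smooth_ft: "smooth (ft f)"
  unfolding smooth_def iter_partial_ft using has_derivative_ft differentiableI by blast

lemma snorm_moments: "snorm L (moments is f) \<le> (2 ^ (L + length is)) ^ length is * snorm (L + length is) f"
proof (induction "is" arbitrary: L)
  case (Cons i "is")
  have "snorm L (moments (i # is) f) \<le> 1 * snorm L (coord_mult i (moments is f))"
    using snorm_scaleC_le[of L \<i> "coord_mult i (moments is f)"] by simp
  also have "\<dots> \<le> 2 ^ L * snorm (Suc L) (moments is f)"
    using snorm_coord_mult by simp
  also have "\<dots> \<le> 2 ^ (Suc L + length is) * ((2 ^ (Suc L + length is)) ^ length is * snorm (Suc L + length is) f)"
    by (intro mult_mono Cons.IH power_increasing) (auto simp: snorm_nonneg)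
  finally show ?case by (simp add: mult.assoc)
qed simp

lemma jbracket_shift:
  fixes x v :: "'a::real_normed_vector"
  assumes "norm v \<le> 1"
  shows "jbracket x \<le> 2 * jbracket (x + v)"
proof -
  have "norm x \<le> norm (x + v) + 1"
    using norm_triangle_ineq4[of "x + v" v] assms by simp
  then have "(norm x)\<^sup>2 \<le> (norm (x + v) + 1)\<^sup>2" by (intro power_mono) auto
  also have "\<dots> \<le> 2 * (norm (x + v))\<^sup>2 + 2"
    using zero_le_power2[of "norm (x + v) - 1"] by (simp add: power2_eq_square algebra_simps)
  finally have "1 + (norm x)\<^sup>2 \<le> 4 * (1 + (norm (x + v))\<^sup>2)"
    by (rule order_trans[OF add_left_mono]) simp
  then have "(jbracket x)\<^sup>2 \<le> (2 * jbracket (x + v))\<^sup>2"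
    unfolding power_mult_distrib jbracket_squared by simp
  then show ?thesis by (rule power2_le_imp_le) (simp add: jbracket_ge_0)
qed

text \<open>A translation of length at most \<open>1\<close> changes the weight by a bounded factor, so the remainder of Taylor's formula decays like
  the second derivative itself.\<close>

lemma schwartz_difference_quotient:
  fixes f :: "('n::finite, 'b::real_normed_vector) schwartz"
  assumes h: "0 < h" "h \<le> 1"
  shows "norm (Rep_schwartz f (x + h *\<^sub>R axis j 1) - Rep_schwartz f x - h *\<^sub>R partial j (Rep_schwartz f) x)
    \<le> h\<^sup>2 * (2 ^ weight_exp TYPE('n) * snorm (2 + weight_exp TYPE('n)) f) * weight x"
proof -
  let ?f = "Rep_schwartz f" and ?e = "axis j (1::real)" and ?w = "weight_exp TYPE('n)"
  define M where "M = 2 ^ ?w * snorm (2 + ?w) f * weight x"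
  have df: "?f differentiable (at y)" "partial j ?f differentiable (at y)" for y
    using smooth_Rep[of f] smooth_differentiable smooth_partial by blast+
  have M: "norm (partial j (partial j ?f) (x + s *\<^sub>R ?e)) \<le> M" if s: "s \<in> {0..h}" for s
  proof -
    let ?y = "x + s *\<^sub>R ?e"
    have "norm (s *\<^sub>R ?e) \<le> 1" using s h by (simp add: norm_axis_1)
    then have "jbracket x \<le> 2 * jbracket ?y" by (rule jbracket_shift)
    then have "jbracket x ^ ?w \<le> 2 ^ ?w * jbracket ?y ^ ?w"
      unfolding power_mult_distrib[symmetric] by (intro power_mono) (auto simp: jbracket_ge_0)
    then have w: "weight ?y \<le> 2 ^ ?w * weight x"
      using jbracket_pos[of x] jbracket_pos[of ?y] by (simp add: weight_def field_simps)
    have "1 * norm (iter_partial [j, j] ?f ?y) \<le> jbracket ?y ^ 2 * norm (iter_partial [j, j] ?f ?y)"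
      by (intro mult_right_mono jbracket_power_ge_1) auto
    also have "\<dots> \<le> snorm (2 + ?w) f * weight ?y" by (rule schwartz_decay) simp
    also have "\<dots> \<le> snorm (2 + ?w) f * (2 ^ ?w * weight x)"
      by (intro mult_left_mono w snorm_nonneg)
    finally show ?thesis by (simp add: M_def mult_ac)
  qed
  have D1: "norm (partial j ?f (x + s *\<^sub>R ?e) - partial j ?f x) \<le> M * h" if s: "s \<in> {0..h}" for s
  proof -
    have "norm (partial j ?f (x + s *\<^sub>R ?e) - partial j ?f (x + 0 *\<^sub>R ?e)) \<le> M * \<bar>s - 0\<bar>"
    proof (rule vector_differentiable_bound[where S = "{0..h}" and g = "\<lambda>s. partial j ?f (x + s *\<^sub>R ?e)"])
      show "((\<lambda>s. partial j ?f (x + s *\<^sub>R ?e)) has_vector_derivative partial j (partial j ?f) (x + s *\<^sub>R ?e)) (at s within {0..h})" for s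
        by (rule has_vector_derivative_line) (rule df)
    qed (use s h M in auto)
    also have "\<dots> \<le> M * h"
      using s order_trans[OF norm_ge_zero M[OF s]] by (intro mult_left_mono) auto
    finally show ?thesis by simp
  qed
  define g where "g s = ?f (x + s *\<^sub>R ?e) - s *\<^sub>R partial j ?f x" for s
  have "norm (g h - g 0) \<le> (M * h) * \<bar>h - 0\<bar>"
  proof (rule vector_differentiable_bound[where S = "{0..h}"])
    show "(g has_vector_derivative (partial j ?f (x + s *\<^sub>R ?e) - partial j ?f x)) (at s within {0..h})" for s
      unfolding g_def by (auto intro!: derivative_eq_intros has_vector_derivative_line df)
  qed (use h D1 in auto)
  then show ?thesis using h by (simp add: g_def M_def power2_eq_square mult_ac algebra_simps)
qed

lemma iexp_add: "iexp (s + t) = iexp s * iexp t"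
  by (simp add: exp_add distrib_left)

text \<open>Translating \<open>f\<close> by \<open>h\<close> in the direction \<open>j\<close> multiplies its transform by \<open>exp (- i h \<xi>\<^sub>j)\<close>. The terms of first order
  in \<open>h\<close> give the transform of the partial derivative.\<close>

lemma ft_partial:
  fixes f :: "('n::finite, 'b::{complex_normed_vector, banach, second_countable_topology}) schwartz"
  shows "ft (partial_schwartz j f) \<xi> = (- \<i> * complex_of_real (\<xi> $ j)) *\<^sub>C ft f \<xi>"
proof -
  let ?f = "Rep_schwartz f" and ?w = "weight_exp TYPE('n)"
  let ?D = "ft (partial_schwartz j f) \<xi> - (- \<i> * complex_of_real (\<xi> $ j)) *\<^sub>C ft f \<xi>"
  \<comment> \<open>the two summands bound the second order remainders of the translation and of the character\<close>
  define M where "M = 2 ^ ?w * snorm (2 + ?w) f * weight_integral TYPE('n) + (\<xi> $ j)\<^sup>2 * norm (ft f \<xi>)"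
  have "norm ?D \<le> h * M" if h: "0 < h" "h \<le> 1" for h
  proof -
    let ?e = "h *\<^sub>R axis j (1::real)"
    let ?E = "\<lambda>x. iexp (x \<bullet> \<xi>)"
    have tr: "(\<integral>x. ?E x *\<^sub>C ?f (x + ?e) \<partial>lborel) = iexp (- (h * \<xi> $ j)) *\<^sub>C ft f \<xi>"
    proof -
      have "iexp (- (h * \<xi> $ j)) *\<^sub>C ft f \<xi> = (\<integral>x. iexp (- (h * \<xi> $ j)) *\<^sub>C (?E x *\<^sub>C ?f x) \<partial>lborel)"
        unfolding ft_def by (rule integral_bounded_linear[OF bounded_linear_scaleC integrable_ft, symmetric])
      also have "\<dots> = 1 ^ DIM(real ^ 'n) *\<^sub>R
          (\<integral>x. iexp (- (h * \<xi> $ j)) *\<^sub>C (?E (?e + 1 *\<^sub>R x) *\<^sub>C ?f (?e + 1 *\<^sub>R x)) \<partial>lborel)"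
        by (rule integral_lborel_affine) (simp, measurable)
      also have "\<dots> = (\<integral>x. ?E x *\<^sub>C ?f (x + ?e) \<partial>lborel)"
      proof -
        have e: "- (h * \<xi> $ j) + (?e + x) \<bullet> \<xi> = x \<bullet> \<xi>" for x
          by (simp add: inner_add_left inner_axis')
        have "iexp (- (h * \<xi> $ j)) * ?E (?e + x) = ?E x" for x
          unfolding iexp_add[symmetric] e ..
        then show ?thesis
          by (simp only: scaleC_scaleC scaleR_one power_one add.commute[of ?e])
      qed
      finally show ?thesis ..
    qed
    have i1: "integrable lborel (\<lambda>x. ?E x *\<^sub>C ?f (x + ?e))"
    proof (rule integrable_of_weight_bound(1))
      show "norm (?E x *\<^sub>C ?f (x + ?e)) \<le> (2 ^ ?w * snorm ?w f) * weight x" for x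
      proof -
        have "norm ?e \<le> 1" using h by (simp add: norm_axis_1)
        then have "jbracket x \<le> 2 * jbracket (x + ?e)" by (rule jbracket_shift)
        then have "jbracket x ^ ?w \<le> 2 ^ ?w * jbracket (x + ?e) ^ ?w"
          unfolding power_mult_distrib[symmetric] by (intro power_mono) (auto simp: jbracket_ge_0)
        then have w: "weight (x + ?e) \<le> 2 ^ ?w * weight x"
          using jbracket_pos[of x] jbracket_pos[of "x + ?e"] by (simp add: weight_def field_simps)
        have "norm (?f (x + ?e)) \<le> snorm ?w f * weight (x + ?e)"
          using schwartz_decay[of "[]" 0 "x + ?e" f] by simp
        also have "\<dots> \<le> snorm ?w f * (2 ^ ?w * weight x)" by (intro mult_left_mono w snorm_nonneg)
        finally show ?thesis by (simp add: norm_scaleC mult_ac)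
      qed
    qed measurable
    have i2: "integrable lborel (\<lambda>x. h *\<^sub>R (?E x *\<^sub>C partial j ?f x))"
      using integrable_ft[of \<xi> "partial_schwartz j f"] by (simp add: Rep_partial_schwartz)
    have m [measurable]: "partial j ?f \<in> borel_measurable borel"
      using borel_measurable_Rep_schwartz[of "partial_schwartz j f"] by (simp add: Rep_partial_schwartz)
    have "iexp (- (h * \<xi> $ j)) *\<^sub>C ft f \<xi> - ft f \<xi> - h *\<^sub>R ft (partial_schwartz j f) \<xi> =
        (\<integral>x. ?E x *\<^sub>C (?f (x + ?e) - ?f x - h *\<^sub>R partial j ?f x) \<partial>lborel)"
    proof -
      have "(\<integral>x. ?E x *\<^sub>C (?f (x + ?e) - ?f x - h *\<^sub>R partial j ?f x) \<partial>lborel) =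
          (\<integral>x. ?E x *\<^sub>C ?f (x + ?e) - ?E x *\<^sub>C ?f x - h *\<^sub>R (?E x *\<^sub>C partial j ?f x) \<partial>lborel)"
        by (simp add: bounded_bilinear.diff_right[OF bounded_bilinear_scaleC] bounded_bilinear.scaleR_right[OF bounded_bilinear_scaleC])
      also have "\<dots> = (\<integral>x. ?E x *\<^sub>C ?f (x + ?e) \<partial>lborel) - (\<integral>x. ?E x *\<^sub>C ?f x \<partial>lborel) - (\<integral>x. h *\<^sub>R (?E x *\<^sub>C partial j ?f x) \<partial>lborel)"
        by (simp only: Bochner_Integration.integral_diff Bochner_Integration.integrable_diff i1 i2 integrable_ft)
      finally show ?thesis unfolding tr by (simp add: ft_def Rep_partial_schwartz)
    qed
    also have "norm \<dots> \<le> (h\<^sup>2 * (2 ^ ?w * snorm (2 + ?w) f)) * weight_integral TYPE('n)"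
      using schwartz_difference_quotient[OF h, of f _ j]
      by (intro integrable_of_weight_bound(2)) (measurable, simp add: norm_scaleC)
    finally have 1: "norm (iexp (- (h * \<xi> $ j)) *\<^sub>C ft f \<xi> - ft f \<xi> - h *\<^sub>R ft (partial_schwartz j f) \<xi>) \<le>
        h\<^sup>2 * (2 ^ ?w * snorm (2 + ?w) f * weight_integral TYPE('n))" by (simp add: mult_ac)
    have 2: "norm ((iexp (- (h * \<xi> $ j)) - 1 - \<i> * complex_of_real (- (h * \<xi> $ j))) *\<^sub>C ft f \<xi>) \<le> h\<^sup>2 * ((\<xi> $ j)\<^sup>2 * norm (ft f \<xi>))"
      using mult_right_mono[OF norm_iexp_linear_approx[of "- (h * \<xi> $ j)"] norm_ge_zero[of "ft f \<xi>"]]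
      by (simp add: norm_scaleC power_mult_distrib mult_ac)
    have "h *\<^sub>R ?D = (iexp (- (h * \<xi> $ j)) - 1 - \<i> * complex_of_real (- (h * \<xi> $ j))) *\<^sub>C ft f \<xi> -
        (iexp (- (h * \<xi> $ j)) *\<^sub>C ft f \<xi> - ft f \<xi> - h *\<^sub>R ft (partial_schwartz j f) \<xi>)"
      by (simp add: bounded_bilinear.diff_left[OF bounded_bilinear_scaleC] scaleR_diff_right scaleC_one
          scaleC_of_real[symmetric, of h] scaleC_scaleC scaleC_add_left mult_ac
          bounded_bilinear.minus_left[OF bounded_bilinear_scaleC] scaleC_add_right)
    also have "norm \<dots> \<le> h\<^sup>2 * ((\<xi> $ j)\<^sup>2 * norm (ft f \<xi>)) + h\<^sup>2 * (2 ^ ?w * snorm (2 + ?w) f * weight_integral TYPE('n))"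
      by (intro order_trans[OF norm_triangle_ineq4 add_mono] 1 2)
    also have "\<dots> = h * (h * M)" by (simp add: M_def power2_eq_square algebra_simps)
    finally show ?thesis using h by simp
  qed
  note small = this
  have M0: "M \<ge> 0" unfolding M_def by (simp add: snorm_nonneg weight_integral_nonneg)
  have "norm ?D \<le> 0 + e" if e: "e > 0" for e
  proof -
    define h where "h = min 1 (e / (M + 1))"
    have h: "0 < h" "h \<le> 1" using e M0 by (auto simp: h_def add_nonneg_pos)
    have "h * M \<le> (e / (M + 1)) * (M + 1)"
      using h M0 e by (intro mult_mono) (auto simp: h_def)
    also have "\<dots> = e" using M0 by simp
    finally show ?thesis using small[OF h] by simp
  qed
  then have "norm ?D \<le> 0" by (rule field_le_epsilon)
  then show ?thesis by simp
qed

text \<open>The operator \<open>1 - \<Delta>\<close>, whose transform is multiplication by \<open>1 + \<bar>\<xi>\<bar>\<^sup>2\<close>.\<close>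

definition helmholtz :: "('n::finite, 'b::real_normed_vector) schwartz \<Rightarrow> ('n, 'b) schwartz" where
  "helmholtz f = f - (\<Sum>j\<in>UNIV. partial_schwartz j (partial_schwartz j f))"

lemma ft_helmholtz: "ft (helmholtz f) \<xi> = (jbracket \<xi>)\<^sup>2 *\<^sub>R ft f \<xi>"
proof -
  have "ft (partial_schwartz j (partial_schwartz j f)) \<xi> = - ((\<xi> $ j)\<^sup>2 *\<^sub>R ft f \<xi>)" for j
  proof -
    have "(- \<i> * complex_of_real (\<xi> $ j)) * (- \<i> * complex_of_real (\<xi> $ j)) = complex_of_real (- ((\<xi> $ j)\<^sup>2))"
      by (simp add: complex_eq_iff power2_eq_square)
    then show ?thesis
      unfolding ft_partial scaleC_scaleC by (simp only: scaleC_of_real scaleR_minus_left)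
  qed
  then have "ft (helmholtz f) \<xi> = ft f \<xi> + (\<Sum>j\<in>UNIV. (\<xi> $ j)\<^sup>2 *\<^sub>R ft f \<xi>)"
    unfolding helmholtz_def by (simp add: linear_diff[OF linear_ft] linear_sum[OF linear_ft] sum_negf)
  also have "\<dots> = (1 + (norm \<xi>)\<^sup>2) *\<^sub>R ft f \<xi>"
    unfolding power2_norm_eq_inner
    by (simp add: scaleR_sum_left[symmetric] scaleR_add_left inner_vec_def power2_eq_square)
  finally show ?thesis by (simp add: jbracket_squared)
qed

lemma snorm_sum_le: "finite A \<Longrightarrow> snorm L (\<Sum>i\<in>A. f i) \<le> (\<Sum>i\<in>A. snorm L (f i))"
proof (induction A rule: finite_induct)
  case (insert i A)
  then show ?case using snorm_add[of L "f i" "sum f A"] by simp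
qed simp

lemma snorm_diff_le: "snorm L (f - g) \<le> snorm L f + snorm L g"
  using snorm_diff_triangle[where L = L and f = f and h = g and g = 0]
  unfolding snorm_diff_commute[of L 0 g] diff_zero .

lemma snorm_helmholtz:
  fixes f :: "('n::finite, 'b::real_normed_vector) schwartz"
  shows "snorm L (helmholtz f) \<le> (1 + real CARD('n)) * snorm (L + 2) f"
proof -
  have "snorm L (partial_schwartz j (partial_schwartz j f)) \<le> snorm (L + 2) f" for j
    using snorm_partial_schwartz[of L j "partial_schwartz j f"] snorm_partial_schwartz[of "Suc L" j f] by simp
  then have "(\<Sum>j\<in>UNIV. snorm L (partial_schwartz j (partial_schwartz j f))) \<le> real CARD('n) * snorm (L + 2) f"
    using sum_bounded_above[of "UNIV :: 'n set" "\<lambda>j. snorm L (partial_schwartz j (partial_schwartz j f))"] by simp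
  moreover have "snorm L (helmholtz f) \<le> snorm L f + (\<Sum>j\<in>UNIV. snorm L (partial_schwartz j (partial_schwartz j f)))"
    unfolding helmholtz_def by (intro order_trans[OF snorm_diff_le] add_mono snorm_sum_le) auto
  moreover have "snorm L f \<le> snorm (L + 2) f" by (rule snorm_mono) simp
  ultimately show ?thesis by (simp add: distrib_right)
qed

lemma snorm_helmholtz_power:
  fixes f :: "('n::finite, 'b::real_normed_vector) schwartz"
  shows "snorm L ((helmholtz ^^ k) f) \<le> (1 + real CARD('n)) ^ k * snorm (L + 2 * k) f"
proof (induction k arbitrary: L)
  case (Suc k)
  have "snorm L ((helmholtz ^^ Suc k) f) \<le> (1 + real CARD('n)) * snorm (L + 2) ((helmholtz ^^ k) f)"
    using snorm_helmholtz[of L "(helmholtz ^^ k) f"] by simp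
  also have "\<dots> \<le> (1 + real CARD('n)) * ((1 + real CARD('n)) ^ k * snorm (L + 2 + 2 * k) f)"
    by (intro mult_left_mono Suc.IH) simp
  finally show ?case by (simp add: mult_ac add_ac)
qed simp

lemma ft_helmholtz_power: "ft ((helmholtz ^^ k) f) \<xi> = (jbracket \<xi>) ^ (2 * k) *\<^sub>R ft f \<xi>"
proof (induction k)
  case (Suc k)
  have "ft ((helmholtz ^^ Suc k) f) \<xi> = (jbracket \<xi>)\<^sup>2 *\<^sub>R (jbracket \<xi> ^ (2 * k) *\<^sub>R ft f \<xi>)"
    by (simp add: ft_helmholtz Suc.IH)
  also have "\<dots> = jbracket \<xi> ^ (2 + 2 * k) *\<^sub>R ft f \<xi>" by (simp only: scaleR_scaleR power_add)
  finally show ?case by simp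
qed simp

text \<open>Powers of \<open>\<xi>\<close> in front of the transform come from \<open>(1 - \<Delta>)\<^sup>m\<close> applied to \<open>f\<close>, and derivatives of the transform from
  multiplying \<open>f\<close> by coordinates; both operations are bounded in the seminorms.\<close>

lemma ft_decay:
  obtains C k where "C \<ge> 0" "\<And>f :: ('n::finite, 'b::{complex_normed_vector, banach, second_countable_topology}) schwartz. \<And>is \<xi>. length is \<le> m \<Longrightarrow>
    jbracket \<xi> ^ m * norm (iter_partial is (ft f) \<xi>) \<le> C * snorm k f"
proof -
  let ?w = "weight_exp TYPE('n)" and ?W = "weight_integral TYPE('n)"
  let ?l = "?w + 2 * m"
  define C where "C = (1 + real CARD('n)) ^ m * (2 ^ (?l + m)) ^ m * ?W"
  have "jbracket \<xi> ^ m * norm (iter_partial is (ft f) \<xi>) \<le> C * snorm (?l + m) f"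
    if l: "length is \<le> m" for f :: "('n, 'b) schwartz" and "is" :: "'n list" and \<xi>
  proof -
    have "jbracket \<xi> ^ m * norm (iter_partial is (ft f) \<xi>) \<le> jbracket \<xi> ^ (2 * m) * norm (iter_partial is (ft f) \<xi>)"
      by (intro mult_right_mono jbracket_power_mono) auto
    also have "\<dots> = norm (ft ((helmholtz ^^ m) (moments is f)) \<xi>)"
      by (simp add: ft_helmholtz_power iter_partial_ft jbracket_ge_0)
    also have "\<dots> \<le> snorm ?w ((helmholtz ^^ m) (moments is f)) * ?W"
      by (rule norm_ft_le)
    also have "\<dots> \<le> ((1 + real CARD('n)) ^ m * ((2 ^ (?l + length is)) ^ length is * snorm (?l + length is) f)) * ?W"
      by (intro mult_right_mono weight_integral_nonneg order_trans[OF snorm_helmholtz_power] mult_left_mono snorm_moments) auto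
    also have "\<dots> \<le> ((1 + real CARD('n)) ^ m * ((2 ^ (?l + m)) ^ m * snorm (?l + m) f)) * ?W"
    proof (intro mult_right_mono weight_integral_nonneg mult_left_mono mult_mono)
      have "(2 ^ (?l + length is)) ^ length is \<le> ((2::real) ^ (?l + m)) ^ length is"
        using l by (intro power_mono power_increasing) auto
      also have "\<dots> \<le> (2 ^ (?l + m)) ^ m" using l by (intro power_increasing) auto
      finally show "(2 ^ (?l + length is)) ^ length is \<le> ((2::real) ^ (?l + m)) ^ m" .
    qed (use l in \<open>auto intro: snorm_mono simp: snorm_nonneg\<close>)
    finally show ?thesis by (simp add: C_def mult_ac)
  qed
  moreover have "C \<ge> 0" by (simp add: C_def weight_integral_nonneg)
  ultimately show ?thesis using that by blast
qed

lemma is_schwartz_ft: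
  fixes f :: "('n::finite, 'b::{complex_normed_vector, banach, second_countable_topology}) schwartz"
  shows "is_schwartz (ft f)"
  unfolding is_schwartz_iff
proof (intro conjI smooth_ft allI)
  fix k and "is" :: "'n list"
  obtain C l where C: "\<And>\<xi>. jbracket \<xi> ^ (max k (length is)) * norm (iter_partial is (ft f) \<xi>) \<le> C * snorm l f"
    using ft_decay[where m = "max k (length is)"] by (metis max.cobounded2)
  have "jbracket \<xi> ^ k * norm (iter_partial is (ft f) \<xi>) \<le> C * snorm l f" for \<xi>
    by (rule order_trans[OF mult_right_mono[OF jbracket_power_mono] C]) auto
  then show "\<exists>A. \<forall>\<xi>. jbracket \<xi> ^ k * norm (iter_partial is (ft f) \<xi>) \<le> A" by blast
qed

lemma Rep_fourier:
  "Rep_schwartz (fourier f) = (\<lambda>\<xi>. (2 * pi) powr (- real CARD('n) / 2) *\<^sub>R ft f \<xi>)"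
  for f :: "('n::finite, 'b::{complex_normed_vector, banach, second_countable_topology}) schwartz"
  unfolding fourier_def ft_def[symmetric]
  by (intro Abs_schwartz_inverse CollectI is_schwartz_bounded_linear[OF bounded_linear_scaleR_right] is_schwartz_ft)

lemma clinear_fourier: "clinear fourier"
  unfolding clinear_iff
  by (auto intro!: Rep_schwartz_eqI simp: Rep_fourier plus_schwartz.rep_eq scaleC_schwartz.rep_eq ft_add ft_scaleC
      scaleR_add_right bounded_bilinear.scaleR_right[OF bounded_bilinear_scaleC])

lemma snorm_fourier:
  fixes f :: "('n::finite, 'b::{complex_normed_vector, banach, second_countable_topology}) schwartz"
  shows "\<exists>k C. \<forall>f :: ('n, 'b) schwartz. snorm m (fourier f) \<le> C * snorm k f"
proof -
  obtain C k where C: "C \<ge> 0" "\<And>f :: ('n, 'b) schwartz. \<And>is \<xi>. length is \<le> m \<Longrightarrow>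
    jbracket \<xi> ^ m * norm (iter_partial is (ft f) \<xi>) \<le> C * snorm k f"
    using ft_decay[where m = m] by blast
  let ?c = "(2 * pi) powr (- real CARD('n) / 2)"
  have "snorm m (fourier f) \<le> (?c * C) * snorm k f" for f :: "('n, 'b) schwartz"
  proof (rule snorm_leI)
    fix "is" :: "'n list" and x :: "real ^ 'n" assume l: "length is \<le> m"
    show "jbracket x ^ m * norm (iter_partial is (Rep_schwartz (fourier f)) x) \<le> (?c * C) * snorm k f"
      using mult_left_mono[OF C(2)[OF l, of x f], of ?c]
      by (simp add: Rep_fourier iter_partial_bounded_linear[OF bounded_linear_scaleR_right smooth_ft] mult_ac)
  qed
  then show ?thesis by blast
qed

lemma continuous_on_fourier:
  "continuous_on UNIV (fourier :: ('n::finite, 'b::{complex_normed_vector, banach, second_countable_topology}) schwartz \<Rightarrow> _)"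
  using snorm_fourier by (intro continuous_on_schwartz_op linear_diff[OF clinear_imp_linear[OF clinear_fourier]]) blast

section \<open>Fourier inversion\<close>

lemma integrable_lborel_affine:
  fixes f :: "'a::euclidean_space \<Rightarrow> 'b::{banach, second_countable_topology}"
  assumes "c > 0" and f: "integrable lborel f"
  shows "integrable lborel (\<lambda>x. f (t + c *\<^sub>R x))"
proof -
  have m [measurable]: "f \<in> borel_measurable borel" using f by simp
  have "integrable (density (distr lborel borel (\<lambda>x. t + c *\<^sub>R x)) (\<lambda>_. \<bar>c\<bar> ^ DIM('a))) f"
    using lborel_affine[of c t] assms by simp
  then have "integrable (distr lborel borel (\<lambda>x. t + c *\<^sub>R x)) (\<lambda>x. (\<bar>c\<bar> ^ DIM('a)) *\<^sub>R f x)"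
    by (subst (asm) integrable_density) auto
  then have "integrable lborel (\<lambda>x. (\<bar>c\<bar> ^ DIM('a)) *\<^sub>R f (t + c *\<^sub>R x))"
    by (subst (asm) integrable_distr_eq) auto
  then have "integrable lborel (\<lambda>x. (1 / c ^ DIM('a)) *\<^sub>R (c ^ DIM('a)) *\<^sub>R f (t + c *\<^sub>R x))"
    unfolding abs_of_pos[OF assms(1)] by (rule integrable_scaleR_right)
  then show ?thesis using assms(1) unfolding scaleR_scaleR by simp
qed

lemma integrable_gaussian: "integrable lborel (gaussian :: real ^ 'n::finite \<Rightarrow> real)"
  using integrable_norm[OF integral_gaussian(1)[of "0 :: real ^ 'n"]]
  by (simp add: norm_mult gaussian_def[abs_def])

lemma borel_measurable_gaussian [measurable]: "gaussian \<in> borel_measurable borel"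
  unfolding gaussian_def[abs_def] by measurable

lemma gaussian_pos: "0 < gaussian x" and gaussian_le_1: "gaussian x \<le> 1"
  by (simp_all add: gaussian_def)

lemma tendsto_gaussian_scaled: "(\<lambda>m. gaussian ((1 / real (Suc m)) *\<^sub>R y)) \<longlonglongrightarrow> 1"
proof -
  have "(\<lambda>m. gaussian ((1 / real (Suc m)) *\<^sub>R y)) \<longlonglongrightarrow> exp (- (norm (0 *\<^sub>R y))\<^sup>2 / 2)"
    unfolding gaussian_def by (intro tendsto_intros LIMSEQ_Suc lim_1_over_n) auto
  then show ?thesis by simp
qed

text \<open>With the integrand damped by a Gaussian of width \<open>1/\<epsilon>\<close>, Fubini's theorem turns the double integral
  into the mean of \<open>f\<close> over a Gaussian of width \<open>\<epsilon>\<close> around \<open>- x\<close>.\<close>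

lemma damped_inversion:
  fixes f :: "('n::finite, 'b::{complex_normed_vector, banach, second_countable_topology}) schwartz"
  assumes e: "e > 0"
  shows "(\<integral>y. (complex_of_real (gaussian (e *\<^sub>R y)) * iexp (y \<bullet> x)) *\<^sub>C ft f y \<partial>lborel) =
    (2 * pi) powr (real CARD('n) / 2) *\<^sub>R (\<integral>z. gaussian z *\<^sub>R Rep_schwartz f (- x + e *\<^sub>R z) \<partial>lborel)"
proof -
  let ?f = "Rep_schwartz f" and ?K = "(2 * pi) powr (real CARD('n) / 2)"
  let ?G = "\<lambda>y. complex_of_real (gaussian (e *\<^sub>R y))"
  define F where "F y z = (?G y * iexp (y \<bullet> x) * iexp (z \<bullet> y)) *\<^sub>C ?f z" for y z
  have f1: "integrable lborel ?f"
    using integrable_ft[of 0 f] by (simp add: scaleC_one)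
  have g1: "integrable lborel (\<lambda>y :: real ^ 'n. gaussian (e *\<^sub>R y))"
    using integrable_lborel_affine[OF e integrable_gaussian, of 0] by simp
  have nF: "norm (F y z) = gaussian (e *\<^sub>R y) * norm (?f z)" for y z
    by (simp add: F_def norm_scaleC norm_mult less_imp_le[OF gaussian_pos])
  have "integrable (lborel \<Otimes>\<^sub>M lborel) (case_prod F)"
  proof (rule lborel_pair.Fubini_integrable)
    show "case_prod F \<in> borel_measurable (lborel \<Otimes>\<^sub>M lborel)"
      unfolding F_def by measurable
    show "integrable lborel (\<lambda>y. \<integral>z. norm (case_prod F (y, z)) \<partial>lborel)"
      by (simp add: nF g1)
    show "AE y in lborel. integrable lborel (\<lambda>z. case_prod F (y, z))"
    proof (intro AE_I2)
      fix y
      have "integrable lborel (\<lambda>z. (?G y * iexp (y \<bullet> x)) *\<^sub>C (iexp (z \<bullet> y) *\<^sub>C ?f z))"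
        by (rule integrable_bounded_linear[OF bounded_linear_scaleC integrable_ft])
      then show "integrable lborel (\<lambda>z. case_prod F (y, z))"
        by (simp add: F_def scaleC_scaleC)
    qed
  qed
  from lborel_pair.Fubini_integral[OF this]
  have fub: "(\<integral>z. (\<integral>y. F y z \<partial>lborel) \<partial>lborel) = (\<integral>y. (\<integral>z. F y z \<partial>lborel) \<partial>lborel)" .
  have inner1: "(\<integral>z. F y z \<partial>lborel) = (?G y * iexp (y \<bullet> x)) *\<^sub>C ft f y" for y
    unfolding ft_def integral_bounded_linear[OF bounded_linear_scaleC integrable_ft, symmetric]
    by (simp add: F_def scaleC_scaleC)
  have gs: "(\<integral>y. iexp (y \<bullet> u) * ?G y \<partial>lborel) = complex_of_real ((1 / e) ^ CARD('n) * ?K * gaussian ((1 / e) *\<^sub>R u))" for u :: "real ^ 'n"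
  proof -
    have "(\<integral>y. iexp (y \<bullet> u) * ?G y \<partial>lborel) =
        (1 / e) ^ DIM(real ^ 'n) *\<^sub>R (\<integral>y. iexp ((0 + (1 / e) *\<^sub>R y) \<bullet> u) * ?G (0 + (1 / e) *\<^sub>R y) \<partial>lborel)"
      by (rule integral_lborel_affine) (use e in simp, measurable)
    also have "\<dots> = (1 / e) ^ CARD('n) *\<^sub>R (\<integral>y. iexp (y \<bullet> ((1 / e) *\<^sub>R u)) * complex_of_real (gaussian y) \<partial>lborel)"
      using e by simp
    also have "\<dots> = complex_of_real ((1 / e) ^ CARD('n) * ?K * gaussian ((1 / e) *\<^sub>R u))"
      unfolding integral_gaussian(2) by (simp add: scaleR_conv_of_real mult_ac)
    finally show ?thesis .
  qed
  have ig: "integrable lborel (\<lambda>y. iexp (y \<bullet> u) * ?G y)" for u :: "real ^ 'n"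
    by (rule Bochner_Integration.integrable_bound[OF g1]) (auto simp: norm_mult)
  have inner2: "(\<integral>y. F y z \<partial>lborel) = ((1 / e) ^ CARD('n) * ?K * gaussian ((1 / e) *\<^sub>R (x + z))) *\<^sub>R ?f z" for z
  proof -
    have "F y z = (iexp (y \<bullet> (x + z)) * ?G y) *\<^sub>C ?f z" for y
      unfolding F_def inner_add_right iexp_add inner_commute[of z y] by (simp only: mult_ac)
    then have "(\<integral>y. F y z \<partial>lborel) = (\<integral>y. (iexp (y \<bullet> (x + z)) * ?G y) *\<^sub>C ?f z \<partial>lborel)" by simp
    also have "\<dots> = (\<integral>y. iexp (y \<bullet> (x + z)) * ?G y \<partial>lborel) *\<^sub>C ?f z"
      by (rule integral_bounded_linear[OF bounded_bilinear.bounded_linear_left[OF bounded_bilinear_scaleC] ig])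
    finally show ?thesis unfolding gs scaleC_of_real .
  qed
  have "(\<integral>y. (?G y * iexp (y \<bullet> x)) *\<^sub>C ft f y \<partial>lborel) =
      (\<integral>z. ((1 / e) ^ CARD('n) * ?K * gaussian ((1 / e) *\<^sub>R (x + z))) *\<^sub>R ?f z \<partial>lborel)"
    using fub unfolding inner1 inner2 ..
  also have "\<dots> = e ^ DIM(real ^ 'n) *\<^sub>R
      (\<integral>z. ((1 / e) ^ CARD('n) * ?K * gaussian ((1 / e) *\<^sub>R (x + (- x + e *\<^sub>R z)))) *\<^sub>R ?f (- x + e *\<^sub>R z) \<partial>lborel)"
    by (rule integral_lborel_affine) (use e in simp, measurable)
  also have "\<dots> = e ^ CARD('n) *\<^sub>R
      (\<integral>z. ((1 / e) ^ CARD('n) * ?K) *\<^sub>R (gaussian z *\<^sub>R ?f (- x + e *\<^sub>R z)) \<partial>lborel)"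
    using e by simp
  also have "\<dots> = (e ^ CARD('n) * ((1 / e) ^ CARD('n) * ?K)) *\<^sub>R (\<integral>z. gaussian z *\<^sub>R ?f (- x + e *\<^sub>R z) \<partial>lborel)"
    unfolding scaleR_scaleR[symmetric, of "e ^ CARD('n)"] integral_scaleR_right ..
  also have "e ^ CARD('n) * ((1 / e) ^ CARD('n) * ?K) = ?K" using e by (simp add: power_divide)
  finally show ?thesis .
qed

text \<open>Dominated convergence removes the damping: as \<open>\<epsilon>\<close> tends to \<open>0\<close>, the Gaussian mean of \<open>f\<close> around \<open>- x\<close> tends to \<open>f (- x)\<close>.\<close>

theorem fourier_fourier:
  fixes f :: "('n::finite, 'b::{complex_normed_vector, banach, second_countable_topology}) schwartz"
  shows "Rep_schwartz (fourier (fourier f)) x = Rep_schwartz f (- x)"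
proof -
  let ?f = "Rep_schwartz f" and ?K = "(2 * pi) powr (real CARD('n) / 2)"
  have K: "?K > 0" by simp
  have c: "(2 * pi) powr (- real CARD('n) / 2) = 1 / ?K" by (simp add: powr_minus_divide[symmetric])
  have ftK: "ft f y = ?K *\<^sub>R Rep_schwartz (fourier f) y" for y
    using K unfolding Rep_fourier c scaleR_scaleR by simp
  have ftm [measurable]: "ft f \<in> borel_measurable borel"
    unfolding ftK[abs_def] by measurable
  have fti: "integrable lborel (\<lambda>y. norm (ft f y))"
    unfolding ftK using integrable_norm[OF integrable_ft[of 0 "fourier f"]] by (simp add: scaleC_one)
  have l1: "(\<lambda>m. \<integral>y. (complex_of_real (gaussian ((1 / real (Suc m)) *\<^sub>R y)) * iexp (y \<bullet> x)) *\<^sub>C ft f y \<partial>lborel)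
      \<longlonglongrightarrow> (\<integral>y. iexp (y \<bullet> x) *\<^sub>C ft f y \<partial>lborel)"
  proof (rule integral_dominated_convergence[OF _ _ fti])
    show "AE y in lborel. (\<lambda>m. (complex_of_real (gaussian ((1 / real (Suc m)) *\<^sub>R y)) * iexp (y \<bullet> x)) *\<^sub>C ft f y)
        \<longlonglongrightarrow> iexp (y \<bullet> x) *\<^sub>C ft f y"
    proof (intro AE_I2)
      fix y
      have "(\<lambda>m. (complex_of_real (gaussian ((1 / real (Suc m)) *\<^sub>R y)) * iexp (y \<bullet> x)) *\<^sub>C ft f y)
          \<longlonglongrightarrow> (complex_of_real 1 * iexp (y \<bullet> x)) *\<^sub>C ft f y"
        by (intro tendsto_intros tendsto_gaussian_scaled)
      then show "(\<lambda>m. (complex_of_real (gaussian ((1 / real (Suc m)) *\<^sub>R y)) * iexp (y \<bullet> x)) *\<^sub>C ft f y)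
          \<longlonglongrightarrow> iexp (y \<bullet> x) *\<^sub>C ft f y" by simp
    qed
    show "AE y in lborel. norm ((complex_of_real (gaussian ((1 / real (Suc m)) *\<^sub>R y)) * iexp (y \<bullet> x)) *\<^sub>C ft f y) \<le> norm (ft f y)" for m
    proof (intro AE_I2)
      fix y
      have "\<bar>gaussian ((1 / real (Suc m)) *\<^sub>R y)\<bar> * norm (ft f y) \<le> 1 * norm (ft f y)"
        using gaussian_pos[of "(1 / real (Suc m)) *\<^sub>R y"] gaussian_le_1[of "(1 / real (Suc m)) *\<^sub>R y"]
        by (intro mult_right_mono) auto
      then show "norm ((complex_of_real (gaussian ((1 / real (Suc m)) *\<^sub>R y)) * iexp (y \<bullet> x)) *\<^sub>C ft f y) \<le> norm (ft f y)"
        unfolding norm_scaleC norm_mult norm_iexp norm_of_real by simp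
    qed
  qed measurable
  have l2: "(\<lambda>m. \<integral>z. gaussian z *\<^sub>R ?f (- x + (1 / real (Suc m)) *\<^sub>R z) \<partial>lborel) \<longlonglongrightarrow> (\<integral>z. gaussian (z :: real ^ 'n) *\<^sub>R ?f (- x) \<partial>lborel)"
  proof (rule integral_dominated_convergence)
    show "integrable lborel (\<lambda>z :: real ^ 'n. gaussian z * snorm 0 f)"
      by (intro integrable_mult_left integrable_gaussian)
    show "AE z in lborel. (\<lambda>m. gaussian z *\<^sub>R ?f (- x + (1 / real (Suc m)) *\<^sub>R z)) \<longlonglongrightarrow> gaussian z *\<^sub>R ?f (- x)"
    proof (intro AE_I2 tendsto_scaleR tendsto_const)
      fix z
      have "(\<lambda>m. - x + (1 / real (Suc m)) *\<^sub>R z) \<longlonglongrightarrow> - x + 0 *\<^sub>R z"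
        by (intro tendsto_intros LIMSEQ_Suc lim_1_over_n)
      moreover have "isCont ?f (- x)"
        using continuous_on_Rep_schwartz[of UNIV f] by (simp add: continuous_on_eq_continuous_at)
      ultimately show "(\<lambda>m. ?f (- x + (1 / real (Suc m)) *\<^sub>R z)) \<longlonglongrightarrow> ?f (- x)"
        using isCont_tendsto_compose by fastforce
    qed
    show "AE z in lborel. norm (gaussian z *\<^sub>R ?f (- x + (1 / real (Suc m)) *\<^sub>R z)) \<le> gaussian z * snorm 0 f" for m
    proof (intro AE_I2)
      fix z
      show "norm (gaussian z *\<^sub>R ?f (- x + (1 / real (Suc m)) *\<^sub>R z)) \<le> gaussian z * snorm 0 f"
        using norm_le_snorm[of "[]" f "- x + (1 / real (Suc m)) *\<^sub>R z"] less_imp_le[OF gaussian_pos[of z]]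
        by (simp add: mult_left_mono)
    qed
  qed measurable
  have gK: "(\<integral>z. gaussian (z :: real ^ 'n) \<partial>lborel) = ?K"
  proof -
    have "complex_of_real (\<integral>z. gaussian (z :: real ^ 'n) \<partial>lborel) = complex_of_real (?K * gaussian (0 :: real ^ 'n))"
      using integral_gaussian(2)[of "0 :: real ^ 'n"] by (simp add: integral_complex_of_real)
    then show ?thesis unfolding of_real_eq_iff by (simp add: gaussian_def[of 0])
  qed
  have "(\<integral>z. gaussian (z :: real ^ 'n) *\<^sub>R ?f (- x) \<partial>lborel) = ?K *\<^sub>R ?f (- x)"
    unfolding gK[symmetric] by (rule integral_scaleR_left[OF integrable_gaussian])
  with l2 have "(\<lambda>m. ?K *\<^sub>R (\<integral>z. gaussian z *\<^sub>R ?f (- x + (1 / real (Suc m)) *\<^sub>R z) \<partial>lborel)) \<longlonglongrightarrow> ?K *\<^sub>R (?K *\<^sub>R ?f (- x))"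
    by (intro tendsto_intros) simp
  moreover have "(\<integral>y. (complex_of_real (gaussian ((1 / real (Suc m)) *\<^sub>R y)) * iexp (y \<bullet> x)) *\<^sub>C ft f y \<partial>lborel) =
      ?K *\<^sub>R (\<integral>z. gaussian z *\<^sub>R ?f (- x + (1 / real (Suc m)) *\<^sub>R z) \<partial>lborel)" for m
    by (rule damped_inversion) simp
  ultimately have lim: "(\<integral>y. iexp (y \<bullet> x) *\<^sub>C ft f y \<partial>lborel) = ?K *\<^sub>R (?K *\<^sub>R ?f (- x))"
    using LIMSEQ_unique[OF l1] by simp
  have "ft (fourier f) x = (\<integral>y. (1 / ?K) *\<^sub>R (iexp (y \<bullet> x) *\<^sub>C ft f y) \<partial>lborel)"
    unfolding ft_def[of "fourier f"] Rep_fourier c bounded_bilinear.scaleR_right[OF bounded_bilinear_scaleC] ..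
  also have "\<dots> = (1 / ?K) *\<^sub>R (?K *\<^sub>R (?K *\<^sub>R ?f (- x)))"
    unfolding integral_scaleR_right lim ..
  finally show ?thesis using K unfolding Rep_fourier[of "fourier f"] c scaleR_scaleR by simp
qed

text \<open>Consequently the inverse of the transform is its third power, and inherits linearity and continuity.\<close>

lemma fourier_four_times: "fourier (fourier (fourier (fourier f))) = f"
  by (rule Rep_schwartz_eqI) (simp add: fourier_fourier)

section \<open>The matrix exponential\<close>

lemma bounded_bilinear_matrix_mult:
  "bounded_bilinear ((**) :: complex ^ 'n::finite ^ 'm::finite \<Rightarrow> complex ^ 'p::finite ^ 'n \<Rightarrow> complex ^ 'p ^ 'm)"
  unfolding bilinear_conv_bounded_bilinear[symmetric] bilinear_def
  by (intro conjI allI linearI)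
    (simp_all add: vec_eq_iff matrix_matrix_mult_def scaleR_sum_right distrib_left distrib_right sum.distrib)

lemma bounded_bilinear_matrix_vector_mult:
  "bounded_bilinear ((*v) :: complex ^ 'n::finite ^ 'm::finite \<Rightarrow> complex ^ 'n \<Rightarrow> complex ^ 'm)"
  unfolding bilinear_conv_bounded_bilinear[symmetric] bilinear_def
  by (intro conjI allI linearI)
    (simp_all add: vec_eq_iff matrix_vector_mult_def scaleR_sum_right distrib_left distrib_right sum.distrib)

lemmas mm_bounded_linear_left = bounded_bilinear.bounded_linear_left[OF bounded_bilinear_matrix_mult]
lemmas mm_bounded_linear_right = bounded_bilinear.bounded_linear_right[OF bounded_bilinear_matrix_mult]
lemmas mm_diff_left = bounded_bilinear.diff_left[OF bounded_bilinear_matrix_mult]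
lemmas mm_diff_right = bounded_bilinear.diff_right[OF bounded_bilinear_matrix_mult]
lemmas mm_scaleR_left = bounded_bilinear.scaleR_left[OF bounded_bilinear_matrix_mult]
lemmas mm_scaleR_right = bounded_bilinear.scaleR_right[OF bounded_bilinear_matrix_mult]
lemmas mm_zero_right = bounded_bilinear.zero_right[OF bounded_bilinear_matrix_mult]

definition mpow :: "complex ^ 'N::finite ^ 'N \<Rightarrow> nat \<Rightarrow> complex ^ 'N ^ 'N" where
  "mpow A k = (((**) A) ^^ k) (mat 1)"

lemma mpow_0 [simp]: "mpow A 0 = mat 1"
  and mpow_Suc: "mpow A (Suc k) = A ** mpow A k"
  by (simp_all add: mpow_def)

lemma mpow_Suc2: "mpow A (Suc k) = mpow A k ** A"
  by (induction k) (simp_all add: mpow_Suc matrix_mul_assoc)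

lemma mpow_scaleR: "mpow (t *\<^sub>R A) k = t ^ k *\<^sub>R mpow A k"
  by (induction k) (simp_all add: mpow_Suc mm_scaleR_left mm_scaleR_right mult.commute)

lemma matexp_scaleR: "matexp (t *\<^sub>R A) = (\<Sum>k. (t ^ k / fact k) *\<^sub>R mpow A k)"
  by (simp add: matexp_def mpow_def[symmetric] mpow_scaleR)

text \<open>The tails of the majorant \<open>b\<close> make the differentiated series converge uniformly.\<close>

lemma has_derivative_suminf:
  fixes f :: "nat \<Rightarrow> 'a::real_normed_vector \<Rightarrow> 'b::banach"
  assumes S: "convex S" "open S"
    and f': "\<And>n x. x \<in> S \<Longrightarrow> (f n has_derivative f' n x) (at x)"
    and le: "\<And>n x h. x \<in> S \<Longrightarrow> norm (f' n x h) \<le> b n * norm h"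
    and b: "summable b" and f: "\<And>x. x \<in> S \<Longrightarrow> summable (\<lambda>n. f n x)" and x: "x \<in> S"
  shows "((\<lambda>x. \<Sum>n. f n x) has_derivative (\<lambda>h. \<Sum>n. f' n x h)) (at x)"
proof -
  have sf': "summable (\<lambda>n. norm (f' n y h))" if "y \<in> S" for y h
    by (rule summable_comparison_test'[OF summable_mult2[OF b, of "norm h"]]) (simp add: le that)
  have "\<exists>g. \<forall>x\<in>S. (\<lambda>n. f n x) sums (g x) \<and> (g has_derivative (\<lambda>h. \<Sum>n. f' n x h)) (at x within S)"
  proof (rule has_derivative_series[OF S(1)])
    show "(f n has_derivative f' n y) (at y within S)" if "y \<in> S" for n y
      using f'[OF that] has_derivative_at_withinI by blast
    show "\<forall>\<^sub>F n in sequentially. \<forall>y\<in>S. \<forall>h. norm ((\<Sum>i<n. f' i y h) - (\<Sum>n. f' n y h)) \<le> e * norm h"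
      if e: "e > 0" for e
    proof -
      obtain N where N: "\<And>n. n \<ge> N \<Longrightarrow> norm (\<Sum>i. b (i + n)) < e"
        using suminf_exist_split[OF e b] by blast
      have "norm ((\<Sum>i<n. f' i y h) - (\<Sum>n. f' n y h)) \<le> e * norm h" if n: "n \<ge> N" and y: "y \<in> S" for n y h
      proof -
        have "(\<Sum>n. f' n y h) = (\<Sum>i. f' (i + n) y h) + (\<Sum>i<n. f' i y h)"
          by (rule suminf_split_initial_segment[OF summable_norm_cancel[OF sf'[OF y]]])
        then have "norm ((\<Sum>i<n. f' i y h) - (\<Sum>n. f' n y h)) = norm (\<Sum>i. f' (i + n) y h)"
          by simp
        also have "\<dots> \<le> (\<Sum>i. norm (f' (i + n) y h))"
          by (rule summable_norm) (use sf'[OF y] in \<open>simp add: summable_iff_shift[of "\<lambda>n. norm (f' n y h)"]\<close>)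
        also have "\<dots> \<le> (\<Sum>i. b (i + n) * norm h)"
          using sf'[OF y] summable_mult2[OF b, of "norm h"]
          by (intro suminf_le le[OF y]) (simp_all add: summable_iff_shift[of "\<lambda>n. norm (f' n y h)"] summable_iff_shift[of "\<lambda>n. b n * norm h"])
        also have "\<dots> = (\<Sum>i. b (i + n)) * norm h"
          using b by (intro suminf_mult2[symmetric]) (simp add: summable_iff_shift)
        also have "\<dots> \<le> e * norm h"
          using N[OF n] by (intro mult_right_mono) auto
        finally show ?thesis .
      qed
      then show ?thesis unfolding eventually_sequentially by blast
    qed
    show "(\<lambda>n. f n x) sums (\<Sum>n. f n x)" by (rule summable_sums[OF f[OF x]])
  qed (rule x)
  then obtain g where g: "\<And>x. x \<in> S \<Longrightarrow> (\<lambda>n. f n x) sums (g x)"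
      "(g has_derivative (\<lambda>h. \<Sum>n. f' n x h)) (at x within S)" using x by blast
  have "(g has_derivative (\<lambda>h. \<Sum>n. f' n x h)) (at x)"
    using g(2) unfolding at_within_open[OF x S(2)] .
  then show ?thesis
    by (rule has_derivative_transform_within_open[OF _ S(2) x]) (rule sums_unique[OF g(1)])
qed

text \<open>These bounds on the coefficients make \<open>\<Sum>k. t ^ k / fact k * c\<^sub>k\<close> converge locally uniformly together with all its derivatives.\<close>

definition exp_type :: "(nat \<Rightarrow> real ^ 'n::finite \<Rightarrow> 'b::real_normed_vector) \<Rightarrow> bool" where
  "exp_type c \<longleftrightarrow> (\<forall>k. smooth (c k)) \<and>
     (\<forall>is r. \<exists>C\<ge>0. \<exists>R\<ge>0. \<forall>k x. norm x < r \<longrightarrow> norm (iter_partial is (c k) x) \<le> C * R ^ k)"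

definition expser :: "(nat \<Rightarrow> 'a \<Rightarrow> 'b::real_normed_vector) \<Rightarrow> real \<Rightarrow> 'a \<Rightarrow> 'b" where
  "expser c t x = (\<Sum>k. (t ^ k / fact k) *\<^sub>R c k x)"

lemma summable_exp_series: "summable (\<lambda>k. \<bar>t\<bar> ^ k / fact k * (C * R ^ k))" for t :: real
  using summable_mult[OF summable_exp[of "\<bar>t\<bar> * R"], of C]
  by (simp add: power_mult_distrib field_simps)

lemma exp_type_iter_partial: "exp_type c \<Longrightarrow> exp_type (\<lambda>k. iter_partial is (c k))"
  unfolding exp_type_def by (auto simp: smooth_iter_partial iter_partial_append[symmetric])

lemma exp_typeE:
  assumes "exp_type c"
  obtains C R where "C \<ge> 0" "R \<ge> 0" "\<And>k x. norm x < r \<Longrightarrow> norm (iter_partial is (c k) x) \<le> C * R ^ k"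
  using assms unfolding exp_type_def by metis

lemma exp_type_summable:
  fixes c :: "nat \<Rightarrow> real ^ 'n::finite \<Rightarrow> 'b::banach"
  assumes "exp_type c"
  shows "summable (\<lambda>k. (t ^ k / fact k) *\<^sub>R c k x)"
proof -
  obtain C R where C: "C \<ge> 0" "R \<ge> 0" "\<And>k y. norm y < norm x + 1 \<Longrightarrow> norm (iter_partial [] (c k) y) \<le> C * R ^ k"
    using exp_typeE[OF assms] by blast
  have le: "norm ((t ^ k / fact k) *\<^sub>R c k x) \<le> \<bar>t\<bar> ^ k / fact k * (C * R ^ k)" for k
    using C(3)[of x k] by (simp add: power_abs divide_simps mult_left_mono)
  show ?thesis
    by (rule summable_comparison_test'[OF summable_exp_series le])
qed

lemma has_derivative_expser:
  fixes c :: "nat \<Rightarrow> real ^ 'n::finite \<Rightarrow> 'b::banach"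
  assumes c: "exp_type c"
  shows "(expser c t has_derivative (\<lambda>h. \<Sum>k. (t ^ k / fact k) *\<^sub>R (\<Sum>j\<in>UNIV. (h $ j) *\<^sub>R partial j (c k) x))) (at x)"
proof -
  have "\<forall>j. \<exists>C R. C \<ge> 0 \<and> R \<ge> 0 \<and> (\<forall>k y. norm y < norm x + 1 \<longrightarrow> norm (iter_partial [j] (c k) y) \<le> C * R ^ k)"
    using exp_typeE[OF c] by metis
  then obtain C R where C: "\<And>j. C j \<ge> 0" "\<And>j. R j \<ge> 0"
    "\<And>j k y. norm y < norm x + 1 \<Longrightarrow> norm (iter_partial [j] (c k) y) \<le> C j * R j ^ k" by metis
  define b where "b k = (\<Sum>j\<in>UNIV. \<bar>t\<bar> ^ k / fact k * (C j * R j ^ k))" for k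
  have "((\<lambda>x. \<Sum>k. (t ^ k / fact k) *\<^sub>R c k x) has_derivative (\<lambda>h. \<Sum>k. (t ^ k / fact k) *\<^sub>R (\<Sum>j\<in>UNIV. (h $ j) *\<^sub>R partial j (c k) x))) (at x)"
  proof (rule has_derivative_suminf[where S = "ball 0 (norm x + 1)" and b = b])
    show "((\<lambda>x. (t ^ k / fact k) *\<^sub>R c k x) has_derivative (\<lambda>h. (t ^ k / fact k) *\<^sub>R (\<Sum>j\<in>UNIV. (h $ j) *\<^sub>R partial j (c k) y))) (at y)" for k y
      using c by (intro has_derivative_scaleR_right has_derivative_partials smooth_differentiable) (auto simp: exp_type_def)
    show "norm ((t ^ k / fact k) *\<^sub>R (\<Sum>j\<in>UNIV. (h $ j) *\<^sub>R partial j (c k) y)) \<le> b k * norm h"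
      if "y \<in> ball 0 (norm x + 1)" for k y h
    proof -
      have "norm (\<Sum>j\<in>UNIV. (h $ j) *\<^sub>R partial j (c k) y) \<le> (\<Sum>j\<in>UNIV. norm h * (C j * R j ^ k))"
        using C that component_le_norm_cart[of h]
        by (intro sum_norm_le) (auto intro!: mult_mono)
      then have "\<bar>t\<bar> ^ k / fact k * norm (\<Sum>j\<in>UNIV. (h $ j) *\<^sub>R partial j (c k) y) \<le> \<bar>t\<bar> ^ k / fact k * (\<Sum>j\<in>UNIV. norm h * (C j * R j ^ k))"
        by (intro mult_left_mono) auto
      then show ?thesis by (simp add: b_def power_abs sum_distrib_left sum_distrib_right mult_ac)
    qed
    show "summable b" unfolding b_def by (intro summable_sum summable_exp_series)
  qed (auto intro: exp_type_summable c add_nonneg_pos)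
  then show ?thesis by (simp add: expser_def[abs_def])
qed

lemma iter_partial_expser:
  fixes c :: "nat \<Rightarrow> real ^ 'n::finite \<Rightarrow> 'b::banach"
  assumes c: "exp_type c"
  shows "iter_partial is (expser c t) = expser (\<lambda>k. iter_partial is (c k)) t"
proof (induction "is")
  case (Cons i "is")
  let ?c = "\<lambda>k. iter_partial is (c k)"
  have "partial i (expser ?c t) x = expser (\<lambda>k. partial i (?c k)) t x" for x
  proof -
    have unit: "(\<Sum>j\<in>UNIV. (axis i 1 $ j) *\<^sub>R partial j (?c k) x) = partial i (?c k) x" for k
    proof -
      have "(\<Sum>j\<in>UNIV. (axis i 1 $ j) *\<^sub>R partial j (?c k) x) = (\<Sum>j\<in>UNIV. if j = i then partial j (?c k) x else 0)"
        by (intro sum.cong) (auto simp: axis_def)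
      then show ?thesis by simp
    qed
    have "partial i (expser ?c t) x = (\<Sum>k. (t ^ k / fact k) *\<^sub>R (\<Sum>j\<in>UNIV. (axis i 1 $ j) *\<^sub>R partial j (?c k) x))"
      by (rule partial_eqI[OF has_derivative_expser[OF exp_type_iter_partial[OF c]]])
    then show ?thesis unfolding unit by (simp add: expser_def)
  qed
  then show ?case by (simp add: Cons.IH fun_eq_iff)
qed simp

lemma smooth_expser: "exp_type c \<Longrightarrow> smooth (expser c t)" for c :: "nat \<Rightarrow> real ^ 'n::finite \<Rightarrow> 'b::banach"
  unfolding smooth_def iter_partial_expser
  using has_derivative_expser[OF exp_type_iter_partial] differentiableI by blast

text \<open>As for a scalar power series with factorials, differentiation in \<open>t\<close> shifts the coefficients.\<close>

lemma expser_has_vector_derivative: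
  fixes c :: "nat \<Rightarrow> real ^ 'n::finite \<Rightarrow> 'b::banach"
  assumes c: "exp_type c"
  shows "((\<lambda>t. expser c t x) has_vector_derivative expser (\<lambda>k. c (Suc k)) t x) (at t)"
proof -
  obtain C R where C: "C \<ge> 0" "R \<ge> 0" "\<And>k y. norm y < norm x + 1 \<Longrightarrow> norm (iter_partial [] (c k) y) \<le> C * R ^ k"
    using exp_typeE[OF c] by blast
  have Cx: "norm (c k x) \<le> C * R ^ k" for k using C(3)[of x k] by simp
  let ?T = "\<bar>t\<bar> + 1"
  define b where "b k = (real k * ?T ^ (k - 1) / fact k) * (C * R ^ k)" for k
  define f' where "f' k s h = (h * (real k * s ^ (k - 1) / fact k)) *\<^sub>R c k x" for k and s h :: real
  have "((\<lambda>t. \<Sum>k. (t ^ k / fact k) *\<^sub>R c k x) has_derivative (\<lambda>h. \<Sum>k. f' k t h)) (at t)"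
  proof (rule has_derivative_suminf[where S = "ball 0 ?T" and b = b])
    show "((\<lambda>t. (t ^ k / fact k) *\<^sub>R c k x) has_derivative f' k s) (at s)" for k s
    proof -
      have "((\<lambda>t. t ^ k / fact k) has_real_derivative (real k * s ^ (k - 1) / fact k)) (at s)"
        by (auto intro!: derivative_eq_intros)
      from has_derivative_scaleR_left[OF this[unfolded has_field_derivative_def], of "c k x"]
      show ?thesis by (simp add: f'_def[abs_def] mult.commute)
    qed
    show "norm (f' k s h) \<le> b k * norm h" if "s \<in> ball 0 ?T" for k s h
    proof -
      have "real k * \<bar>s\<bar> ^ (k - 1) / fact k \<le> real k * ?T ^ (k - 1) / fact k"
        using that by (intro divide_right_mono mult_left_mono power_mono) auto
      then have "(real k * \<bar>s\<bar> ^ (k - 1) / fact k) * norm (c k x) \<le> b k"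
        unfolding b_def by (intro mult_mono Cx) auto
      then have "\<bar>h\<bar> * ((real k * \<bar>s\<bar> ^ (k - 1) / fact k) * norm (c k x)) \<le> \<bar>h\<bar> * b k"
        by (rule mult_left_mono) simp
      then show ?thesis by (simp add: f'_def abs_mult power_abs mult_ac)
    qed
    have "b (Suc k) = (C * R) * (\<bar>?T\<bar> ^ k / fact k * (1 * R ^ k))" for k
      by (simp add: b_def field_simps del: of_nat_Suc)
    then have "summable (\<lambda>k. b (Suc k))"
      using summable_mult[OF summable_exp_series[of ?T 1 R], of "C * R"] by presburger
    then show "summable b" by (simp only: summable_Suc_iff)
  qed (auto intro: exp_type_summable c)
  moreover have "(\<Sum>k. f' k t h) = h *\<^sub>R expser (\<lambda>k. c (Suc k)) t x" for h
  proof -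
    have f'S: "f' (Suc k) t h = h *\<^sub>R ((t ^ k / fact k) *\<^sub>R c (Suc k) x)" for k
      by (simp add: f'_def field_simps del: of_nat_Suc)
    have "summable (\<lambda>k. (t ^ k / fact k) *\<^sub>R c (Suc k) x)"
    proof -
      have le: "norm ((t ^ k / fact k) *\<^sub>R c (Suc k) x) \<le> \<bar>t\<bar> ^ k / fact k * ((C * R) * R ^ k)" for k
        using Cx[of "Suc k"] by (simp add: power_abs divide_simps mult_left_mono mult.assoc)
      show ?thesis by (rule summable_comparison_test'[OF summable_exp_series le])
    qed
    note sums = sums_scaleR_right[OF summable_sums[OF this], of h, folded f'S]
    have "(\<lambda>k. f' k t h) sums (h *\<^sub>R (\<Sum>k. (t ^ k / fact k) *\<^sub>R c (Suc k) x) + f' 0 t h)"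
      by (rule sums_Suc_imp) (use sums in \<open>simp_all add: f'_def\<close>)
    then show ?thesis by (simp add: sums_iff f'_def expser_def)
  qed
  ultimately show ?thesis by (simp add: has_vector_derivative_def expser_def)
qed

lemma iter_partial_bounded_on_ball:
  fixes f :: "real ^ 'n::finite \<Rightarrow> 'b::real_normed_vector"
  assumes "smooth f"
  shows "\<exists>C\<ge>0. \<forall>x. norm x < r \<longrightarrow> norm (iter_partial is f x) \<le> C"
proof -
  have "continuous_on (cball 0 r) (iter_partial is f)"
    by (intro continuous_at_imp_continuous_on ballI differentiable_imp_continuous_within
        smooth_differentiable smooth_iter_partial assms)
  then have "bounded (iter_partial is f ` cball 0 r)"
    by (intro compact_imp_bounded compact_continuous_image compact_cball)
  then obtain C where C: "\<forall>x\<in>cball 0 r. norm (iter_partial is f x) \<le> C"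
    by (auto simp: bounded_iff)
  have "norm (iter_partial is f x) \<le> max C 0" if "norm x < r" for x
    using bspec[OF C, of x] that by simp
  then show ?thesis by (intro exI[of _ "max C 0"]) auto
qed

lemma smooth_mpow: "smooth a \<Longrightarrow> smooth (\<lambda>x. mpow (a x) k)"
  by (induction k) (auto simp: mpow_Suc smooth_const intro: smooth_bilinear[OF bounded_bilinear_matrix_mult])

text \<open>By Leibniz' formula one more factor \<open>a\<close> multiplies the bounds for the derivatives up to a given order by a constant that depends only on the
  ball.\<close>

lemma exp_type_mpow:
  fixes a :: "real ^ 'n::finite \<Rightarrow> complex ^ 'N::finite ^ 'N"
  assumes a: "smooth a"
  shows "exp_type (\<lambda>k x. mpow (a x) k)"
  unfolding exp_type_def
proof (intro conjI allI)
  show "smooth (\<lambda>x. mpow (a x) k)" for k by (rule smooth_mpow[OF a])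
  fix "is" :: "'n list" and r :: real
  let ?l = "length is" and ?M = "norm (mat 1 :: complex ^ 'N ^ 'N)"
  obtain K where K: "K \<ge> 0" "\<And>(x :: complex ^ 'N ^ 'N) (y :: complex ^ 'N ^ 'N). norm (x ** y) \<le> norm x * norm y * K"
    using bounded_bilinear.nonneg_bounded[OF bounded_bilinear_matrix_mult] by blast
  obtain C where C: "\<And>u :: 'n list. C u \<ge> 0" "\<And>u x. norm x < r \<Longrightarrow> norm (iter_partial u a x) \<le> C u"
    using iter_partial_bounded_on_ball[OF a] by metis
  define D where "D = (\<Sum>u | length u \<le> ?l. C u)"
  have CD: "C u \<le> D" if "length u \<le> ?l" for u
    unfolding D_def using that C(1) by (intro member_le_sum) (auto simp: finite_lists_le)
  have D: "D \<ge> 0" unfolding D_def by (intro sum_nonneg C(1))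
  let ?R = "2 ^ ?l * (D * K)"
  have "norm (iter_partial v (\<lambda>x. mpow (a x) k) x) \<le> ?M * ?R ^ k" if "norm x < r" "length v \<le> ?l" for v k x
    using that(2)
  proof (induction k arbitrary: v)
    case (Suc k)
    have "norm (iter_partial v (\<lambda>x. a x ** mpow (a x) k) x) \<le> 2 ^ ?l * (D * (?M * ?R ^ k) * K)"
      by (rule norm_iter_partial_bilinear_le[OF bounded_bilinear_matrix_mult K a smooth_mpow[OF a]
          order_trans[OF C(2)[OF \<open>norm x < r\<close>] CD] Suc.IH Suc.prems])
    then show ?case by (simp add: mpow_Suc mult_ac)
  qed (simp add: iter_partial_const)
  then show "\<exists>C\<ge>0. \<exists>R\<ge>0. \<forall>k x. norm x < r \<longrightarrow> norm (iter_partial is (\<lambda>x. mpow (a x) k) x) \<le> C * R ^ k"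
    using D K by (intro exI[of _ ?M] exI[of _ ?R] conjI) auto
qed

definition symexp :: "('a \<Rightarrow> complex ^ 'N::finite ^ 'N) \<Rightarrow> real \<Rightarrow> 'a \<Rightarrow> complex ^ 'N ^ 'N" where
  "symexp a t x = matexp (t *\<^sub>R a x)"

lemma symexp_expser: "symexp a t = expser (\<lambda>k x. mpow (a x) k) t"
  by (simp add: symexp_def expser_def matexp_scaleR fun_eq_iff)

lemma smooth_symexp: "smooth a \<Longrightarrow> smooth (symexp a t)"
  unfolding symexp_expser by (intro smooth_expser exp_type_mpow)

lemma summable_matexp: "summable (\<lambda>k. (t ^ k / fact k) *\<^sub>R mpow A k)"
proof -
  have "exp_type (\<lambda>k (x :: real ^ 1). mpow A k)"
    by (rule exp_type_mpow[OF smooth_const])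
  from exp_type_summable[OF this] show ?thesis .
qed

lemma expser_mpow_Suc: "expser (\<lambda>k x. mpow (a x) (Suc k)) t x = a x ** symexp a t x"
  unfolding symexp_expser expser_def mpow_Suc
  by (subst bounded_linear.suminf[OF mm_bounded_linear_right summable_matexp]) (simp add: mm_scaleR_right)

lemma symexp_has_vector_derivative:
  fixes a :: "real ^ 'n::finite \<Rightarrow> complex ^ 'N::finite ^ 'N"
  assumes a: "smooth a"
  shows "((\<lambda>t. iter_partial is (symexp a t) x) has_vector_derivative iter_partial is (\<lambda>x. a x ** symexp a t x) x) (at t)"
proof -
  let ?c = "\<lambda>k x. mpow (a x) k"
  have c: "exp_type ?c" by (rule exp_type_mpow[OF a])
  then have cS: "exp_type (\<lambda>k. ?c (Suc k))"
    unfolding exp_type_def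
  proof (intro conjI allI)
    fix "is" :: "'n list" and r :: real
    obtain C R where C: "C \<ge> 0" "R \<ge> 0" "\<And>k x. norm x < r \<Longrightarrow> norm (iter_partial is (?c k) x) \<le> C * R ^ k"
      using exp_typeE[OF c] by blast
    show "\<exists>C\<ge>0. \<exists>R\<ge>0. \<forall>k x. norm x < r \<longrightarrow> norm (iter_partial is (?c (Suc k)) x) \<le> C * R ^ k"
      using C(3)[of _ "Suc _"] C(1,2) by (intro exI[of _ "C * R"] exI[of _ R] conjI) (auto simp: mult.assoc)
  qed blast
  have "iter_partial is (\<lambda>x. a x ** symexp a t x) = iter_partial is (expser (\<lambda>k. ?c (Suc k)) t)"
    by (rule arg_cong[where f = "iter_partial is"]) (rule ext, rule expser_mpow_Suc[symmetric])
  also have "\<dots> = expser (\<lambda>k. iter_partial is (?c (Suc k))) t"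
    by (rule iter_partial_expser[OF cS])
  finally have eq: "iter_partial is (\<lambda>x. a x ** symexp a t x) = \<dots>" .
  have "((\<lambda>t. expser (\<lambda>k. iter_partial is (?c k)) t x) has_vector_derivative
      expser (\<lambda>k. iter_partial is (?c (Suc k))) t x) (at t)"
    by (rule expser_has_vector_derivative[OF exp_type_iter_partial[OF c]])
  then show ?thesis
    unfolding eq by (simp only: symexp_expser iter_partial_expser[OF c])
qed

lemma matexp_has_vector_derivative:
  "((\<lambda>t. matexp (t *\<^sub>R A)) has_vector_derivative A ** matexp (t *\<^sub>R A)) (at t)"
  using symexp_has_vector_derivative[OF smooth_const[of A], of "[]" "0 :: real ^ 1" t] by (simp add: symexp_def)

lemma matexp_commute: "A ** matexp (t *\<^sub>R A) = matexp (t *\<^sub>R A) ** A"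
  unfolding matexp_scaleR bounded_linear.suminf[OF mm_bounded_linear_right summable_matexp]
    bounded_linear.suminf[OF mm_bounded_linear_left summable_matexp]
  by (simp add: mm_scaleR_right mm_scaleR_left mpow_Suc[symmetric] mpow_Suc2[symmetric])

lemma matexp_zero: "matexp (0 *\<^sub>R A) = mat 1"
proof -
  have "(\<Sum>k. (0 ^ k / fact k) *\<^sub>R mpow A k) = (\<Sum>k\<in>{0}. (0 ^ k / fact k) *\<^sub>R mpow A k)"
    by (rule suminf_finite) auto
  then show ?thesis unfolding matexp_scaleR by simp
qed

lemma matexp_reverse_has_vector_derivative:
  "((\<lambda>s. matexp ((t - s) *\<^sub>R A)) has_vector_derivative - (A ** matexp ((t - s) *\<^sub>R A))) (at s)"
proof -
  have "((\<lambda>s. t - s) has_vector_derivative - 1) (at s)"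
    by (auto intro!: derivative_eq_intros)
  from vector_diff_chain_at[OF this matexp_has_vector_derivative] show ?thesis
    by (simp add: o_def)
qed

text \<open>The product \<open>e\<^sup>(\<^sup>s\<^sup>+\<^sup>t\<^sup>-\<^sup>r\<^sup>)\<^sup>A e\<^sup>r\<^sup>A\<close> does not depend on \<open>r\<close>.\<close>

lemma matexp_add: "matexp ((s + t) *\<^sub>R A) = matexp (s *\<^sub>R A) ** matexp (t *\<^sub>R A)"
proof -
  let ?Z = "\<lambda>r. matexp ((s + t - r) *\<^sub>R A) ** matexp (r *\<^sub>R A)"
  have "(?Z has_vector_derivative 0) (at r)" for r
  proof -
    have "(?Z has_vector_derivative (matexp ((s + t - r) *\<^sub>R A) ** (A ** matexp (r *\<^sub>R A)) +
        (- (A ** matexp ((s + t - r) *\<^sub>R A))) ** matexp (r *\<^sub>R A))) (at r)"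
      by (rule bounded_bilinear.has_vector_derivative[OF bounded_bilinear_matrix_mult
          matexp_reverse_has_vector_derivative matexp_has_vector_derivative])
    moreover have "matexp ((s + t - r) *\<^sub>R A) ** (A ** matexp (r *\<^sub>R A)) = (A ** matexp ((s + t - r) *\<^sub>R A)) ** matexp (r *\<^sub>R A)"
      unfolding matexp_commute[of A "s + t - r"] by (rule matrix_mul_assoc)
    ultimately show ?thesis
      by (simp only: bounded_bilinear.minus_left[OF bounded_bilinear_matrix_mult] add.right_inverse)
  qed
  then have "(?Z has_derivative (\<lambda>h. 0)) (at r within UNIV)" for r
    by (simp add: has_vector_derivative_def)
  then obtain c where c: "\<And>r. ?Z r = c"
    using has_derivative_zero_constant[OF convex_UNIV, of ?Z] by blast
  have "?Z 0 = ?Z t" by (simp only: c)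
  then show ?thesis using matexp_zero[of A] by simp
qed

section \<open>The exponential of a matrix with spectrum in a half plane\<close>

lemma mat_eq_scaleC: "mat z = z *\<^sub>C (mat 1 :: complex ^ 'N::finite ^ 'N)"
  by (simp add: vec_eq_iff mat_def scaleC_vec_def scaleC_complex_def)

lemma scaleC_matrix_mult: "(z *\<^sub>C A) ** B = z *\<^sub>C (A ** B)" "A ** (z *\<^sub>C B) = z *\<^sub>C (A ** B)"
  for A B :: "complex ^ 'N::finite ^ 'N"
  by (simp_all add: vec_eq_iff matrix_matrix_mult_def scaleC_vec_def scaleC_complex_def sum_distrib_left mult_ac)

lemma mat_mult: "mat z ** A = z *\<^sub>C A" "A ** mat z = z *\<^sub>C A" for A :: "complex ^ 'N::finite ^ 'N"
  unfolding mat_eq_scaleC[of z] scaleC_matrix_mult by simp_all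

text \<open>The value of a polynomial at a matrix; \<open>poly\<close> would multiply matrices entry by entry.\<close>

definition meval :: "complex ^ 'N::finite ^ 'N \<Rightarrow> complex poly \<Rightarrow> complex ^ 'N ^ 'N" where
  "meval A p = (\<Sum>i\<le>degree p. coeff p i *\<^sub>C mpow A i)"

lemma scaleC_zero_left: "0 *\<^sub>C x = (0 :: 'b::complex_normed_vector)"
  by (rule bounded_bilinear.zero_left[OF bounded_bilinear_scaleC])

lemma scaleC_zero_right: "c *\<^sub>C 0 = (0 :: 'b::complex_normed_vector)"
  by (rule bounded_bilinear.zero_right[OF bounded_bilinear_scaleC])

lemma meval_altdef: "degree p \<le> n \<Longrightarrow> meval A p = (\<Sum>i\<le>n. coeff p i *\<^sub>C mpow A i)"
  unfolding meval_def
  by (rule sum.mono_neutral_left) (auto simp: coeff_eq_0 scaleC_zero_left)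

lemma meval_add: "meval A (p + q) = meval A p + meval A q"
proof -
  let ?n = "max (degree p) (degree q)"
  have "meval A (p + q) = (\<Sum>i\<le>?n. coeff (p + q) i *\<^sub>C mpow A i)"
    by (rule meval_altdef) (rule degree_add_le_max)
  also have "\<dots> = meval A p + meval A q"
    by (simp add: meval_altdef[of p ?n] meval_altdef[of q ?n] scaleC_add_left sum.distrib)
  finally show ?thesis .
qed

lemma meval_smult: "meval A (smult c p) = c *\<^sub>C meval A p"
proof -
  have "meval A (smult c p) = (\<Sum>i\<le>degree p. coeff (smult c p) i *\<^sub>C mpow A i)"
    by (rule meval_altdef) (rule degree_smult_le)
  then show ?thesis
    by (simp add: meval_def scaleC_scaleC[symmetric] bounded_bilinear.sum_right[OF bounded_bilinear_scaleC])
qed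

lemma meval_pCons_0: "meval A (pCons 0 p) = A ** meval A p"
proof -
  have "meval A (pCons 0 p) = (\<Sum>i\<le>Suc (degree p). coeff (pCons 0 p) i *\<^sub>C mpow A i)"
    by (rule meval_altdef) (simp add: degree_pCons_le)
  also have "\<dots> = (\<Sum>i\<le>degree p. coeff p i *\<^sub>C (A ** mpow A i))"
    by (simp add: sum.atMost_Suc_shift scaleC_zero_left mpow_Suc del: sum.atMost_Suc)
  also have "\<dots> = A ** meval A p"
    by (simp add: meval_def bounded_bilinear.sum_right[OF bounded_bilinear_matrix_mult] scaleC_matrix_mult)
  finally show ?thesis .
qed

lemma meval_linear_factor: "meval A ([:- r, 1:] * p) = (A - mat r) ** meval A p"
proof -
  have "[:- r, 1:] * p = smult (- r) p + pCons 0 p" by simp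
  then show ?thesis
    by (simp only: meval_add meval_smult meval_pCons_0 mm_diff_left mat_mult
        bounded_bilinear.minus_left[OF bounded_bilinear_scaleC]) simp
qed

text \<open>The product of the factors \<open>A - r\<close> applied to \<open>X\<close>. With the last matrix as an argument, a factor can be moved into it, as the
  factors commute.\<close>

fun shifted_prod :: "complex ^ 'N::finite ^ 'N \<Rightarrow> complex list \<Rightarrow> complex ^ 'N ^ 'N \<Rightarrow> complex ^ 'N ^ 'N" where
  "shifted_prod A [] X = X"
| "shifted_prod A (r # rs) X = (A - mat r) ** shifted_prod A rs X"

lemma shifted_commute: "(A - mat a) ** ((A - mat r) ** X) = (A - mat r) ** ((A - mat a) ** X)"
  for A X :: "complex ^ 'N::finite ^ 'N"
  by (simp add: mm_diff_left mm_diff_right mat_mult scaleC_matrix_mult algebra_simps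
      bounded_bilinear.diff_right[OF bounded_bilinear_scaleC] scaleC_scaleC)

lemma shifted_prod_commute: "shifted_prod A rs ((A - mat r) ** X) = (A - mat r) ** shifted_prod A rs X"
proof (induction rs)
  case (Cons a rs)
  then show ?case by (simp only: shifted_prod.simps shifted_commute[of A a r])
qed simp

lemma meval_prod_list: "meval A (prod_list (map (\<lambda>r. [:- r, 1:]) rs)) = shifted_prod A rs (mat 1)"
proof (induction rs)
  case Nil
  then show ?case by (simp add: meval_def scaleC_one)
next
  case (Cons r rs)
  then show ?case by (simp only: list.map prod_list.Cons meval_linear_factor shifted_prod.simps)
qed

lemma linear_dependence_of_powers:
  fixes v :: "nat \<Rightarrow> 'v::euclidean_space"
  shows "\<exists>c. (\<exists>k\<le>DIM('v). c k \<noteq> 0) \<and> (\<Sum>k\<le>DIM('v). c k *\<^sub>R v k) = 0"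
proof (cases "inj_on v {..DIM('v)}")
  case True
  then have "card (v ` {..DIM('v)}) > DIM('v)" by (simp add: card_image)
  then have "dependent (v ` {..DIM('v)})" by (intro dependent_biggerset)
  then obtain u where u: "\<exists>x\<in>v ` {..DIM('v)}. u x \<noteq> 0" "(\<Sum>x\<in>v ` {..DIM('v)}. u x *\<^sub>R x) = 0"
    using dependent_finite[of "v ` {..DIM('v)}"] by auto
  then show ?thesis
    using True by (intro exI[of _ "\<lambda>k. u (v k)"]) (auto simp: sum.reindex)
next
  case False
  then obtain i j where ij: "i \<le> DIM('v)" "j \<le> DIM('v)" "i \<noteq> j" "v i = v j"
    by (auto simp: inj_on_def)
  \<comment> \<open>two equal powers are themselves a linear relation\<close>
  define c where "c k = (if k = i then 1 else if k = j then - 1 else 0 :: real)" for k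
  have "(\<Sum>k\<le>DIM('v). c k *\<^sub>R v k) = (\<Sum>k\<in>{i, j}. c k *\<^sub>R v k)"
    using ij by (intro sum.mono_neutral_right) (auto simp: c_def)
  also have "\<dots> = 0" using ij by (simp add: c_def)
  finally show ?thesis using ij(1) by (intro exI[of _ c]) (auto simp: c_def)
qed

text \<open>The powers of \<open>A\<close> up to the dimension of the space of matrices are linearly dependent, and the polynomial given by the
  relation splits into linear factors.\<close>

lemma annihilating_product:
  fixes A :: "complex ^ 'N::finite ^ 'N"
  shows "\<exists>rs. length rs \<le> DIM(complex ^ 'N ^ 'N) \<and> shifted_prod A rs (mat 1) = 0"
proof -
  let ?D = "DIM(complex ^ 'N ^ 'N)"
  obtain c where c: "\<exists>k\<le>?D. c k \<noteq> 0" "(\<Sum>k\<le>?D. c k *\<^sub>R mpow A k) = 0"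
    using linear_dependence_of_powers[of "mpow A"] by blast
  define p where "p = (\<Sum>k\<le>?D. monom (complex_of_real (c k)) k)"
  have cp: "coeff p i = (if i \<le> ?D then complex_of_real (c i) else 0)" for i
    by (simp add: p_def coeff_sum)
  have p0: "p \<noteq> 0" using c(1) cp by (metis coeff_0 of_real_eq_0_iff)
  have deg: "degree p \<le> ?D" by (rule degree_le) (simp add: cp)
  have "meval A p = (\<Sum>i\<le>?D. coeff p i *\<^sub>C mpow A i)" by (rule meval_altdef[OF deg])
  also have "\<dots> = 0" using c(2) by (simp add: cp scaleC_of_real)
  finally have mp: "meval A p = 0" .
  obtain M where M: "size M = degree p" "p = smult (lead_coeff p) (\<Prod>x\<in>#M. [:- x, 1:])"
    using alg_closed_imp_factorization[OF p0] by blast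
  obtain rs where rs: "mset rs = M" using ex_mset by blast
  have q: "(\<Prod>x\<in>#M. [:- x, 1:]) = prod_list (map (\<lambda>r. [:- r, 1:]) rs)"
    unfolding rs[symmetric] by (metis mset_map prod_mset_prod_list)
  have "lead_coeff p *\<^sub>C shifted_prod A rs (mat 1) = 0"
    using mp M(2) unfolding q by (metis meval_smult meval_prod_list)
  then have "inverse (lead_coeff p) *\<^sub>C lead_coeff p *\<^sub>C shifted_prod A rs (mat 1) = 0"
    by (simp add: scaleC_zero_right)
  then have "shifted_prod A rs (mat 1) = 0"
    using p0 by (simp add: scaleC_scaleC scaleC_one)
  moreover have "length rs \<le> ?D" using deg M(1) rs by auto
  ultimately show ?thesis by blast
qed

lemma eigenvalue_norm_le:
  "\<exists>\<kappa>\<ge>0. \<forall>(A :: complex ^ 'N::finite ^ 'N) z. det (mat z - A) = 0 \<longrightarrow> cmod z \<le> \<kappa> * norm A"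
proof -
  obtain K where K: "K \<ge> 0" "\<And>(x :: complex ^ 'N ^ 'N) (y :: complex ^ 'N). norm (x *v y) \<le> norm x * norm y * K"
    using bounded_bilinear.nonneg_bounded[OF bounded_bilinear_matrix_vector_mult] by blast
  have "cmod z \<le> K * norm A" if d: "det (mat z - A) = 0" for A :: "complex ^ 'N ^ 'N" and z
  proof -
    have "\<not> invertible (mat z - A)" using d by (simp add: invertible_det_nz)
    then obtain v where v: "v \<noteq> 0" "(mat z - A) *v v = 0"
      unfolding invertible_left_inverse matrix_left_invertible_ker by blast
    have "mat z *v v = z *\<^sub>C v"
      by (simp add: vec_eq_iff matrix_vector_mult_def mat_def scaleC_vec_def scaleC_complex_def
          if_distrib[of "\<lambda>x. x * _"] cong: if_cong)
    then have "z *\<^sub>C v = A *v v"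
      using v(2) by (simp add: bounded_bilinear.diff_left[OF bounded_bilinear_matrix_vector_mult])
    then have "cmod z * norm v \<le> (K * norm A) * norm v"
      using K(2)[of A v] by (simp add: norm_scaleC[symmetric] mult_ac)
    then show ?thesis using v(1) by simp
  qed
  with K(1) show ?thesis by blast
qed

text \<open>If \<open>X\<close> is multiplied by \<open>A - z\<close>, then \<open>e\<^sup>t\<^sup>A X\<close> solves the scalar equation \<open>y' = z y + g\<close>, which is
  integrated with the factor \<open>e\<^sup>z\<^sup>(\<^sup>t\<^sup>-\<^sup>s\<^sup>)\<close>.\<close>

lemma matexp_shift_bound:
  fixes A X :: "complex ^ 'N::finite ^ 'N"
  assumes z: "Re z \<le> M" "0 \<le> M" and t: "t \<in> {0..T}"
    and G: "\<And>s. s \<in> {0..T} \<Longrightarrow> norm (matexp (s *\<^sub>R A) ** ((A - mat z) ** X)) \<le> G"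
  shows "norm (matexp (t *\<^sub>R A) ** X) \<le> exp (M * T) * (norm X + T * G)"
proof -
  define w where "w s = exp (z * (of_real t - of_real s)) *\<^sub>C (matexp (s *\<^sub>R A) ** X)" for s
  define w' where "w' s = exp (z * (of_real t - of_real s)) *\<^sub>C (matexp (s *\<^sub>R A) ** ((A - mat z) ** X))" for s
  have e: "norm (exp (z * (complex_of_real t - complex_of_real s))) \<le> exp (M * T)" if "s \<in> {0..t}" for s
  proof -
    have "Re z * (t - s) \<le> M * (t - s)" using that z by (intro mult_right_mono) auto
    also have "\<dots> \<le> M * T" using that t z by (intro mult_left_mono) auto
    finally show ?thesis by (simp add: norm_exp_eq_Re)
  qed
  have "(w has_vector_derivative w' s) (at s within {0..t})" for s
  proof -
    have "((\<lambda>u. exp (z * (of_real t - u))) has_field_derivative - z * exp (z * (of_real t - of_real s))) (at (complex_of_real s))"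
      by (auto intro!: derivative_eq_intros)
    then have d1: "((\<lambda>s. exp (z * (of_real t - of_real s))) has_vector_derivative - z * exp (z * (of_real t - of_real s))) (at s within {0..t})"
      by (rule has_vector_derivative_real_field)
    have d2: "((\<lambda>s. matexp (s *\<^sub>R A) ** X) has_vector_derivative A ** matexp (s *\<^sub>R A) ** X) (at s within {0..t})"
      by (rule bounded_linear.has_vector_derivative[OF mm_bounded_linear_left
          has_vector_derivative_at_within[OF matexp_has_vector_derivative]])
    have "(w has_vector_derivative (exp (z * (of_real t - of_real s)) *\<^sub>C (A ** matexp (s *\<^sub>R A) ** X) +
        (- z * exp (z * (of_real t - of_real s))) *\<^sub>C (matexp (s *\<^sub>R A) ** X))) (at s within {0..t})"
      unfolding w_def by (rule bounded_bilinear.has_vector_derivative[OF bounded_bilinear_scaleC d1 d2])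
    moreover have "exp (z * (of_real t - of_real s)) *\<^sub>C (A ** matexp (s *\<^sub>R A) ** X) +
        (- z * exp (z * (of_real t - of_real s))) *\<^sub>C (matexp (s *\<^sub>R A) ** X) = w' s"
      by (simp add: w'_def mm_diff_left mm_diff_right mat_mult scaleC_matrix_mult matexp_commute matrix_mul_assoc
          bounded_bilinear.diff_right[OF bounded_bilinear_scaleC] bounded_bilinear.minus_left[OF bounded_bilinear_scaleC]
          scaleC_scaleC mult.commute)
    ultimately show ?thesis by simp
  qed
  moreover have "norm (w' s) \<le> exp (M * T) * G" if "s \<in> {0..t}" for s
  proof -
    have s: "s \<in> {0..T}" using that t by auto
    show ?thesis
      unfolding w'_def norm_scaleC by (intro mult_mono e that G s) auto
  qed
  ultimately have "norm (w t - w 0) \<le> exp (M * T) * G * \<bar>t - 0\<bar>"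
    using t by (intro vector_differentiable_bound[where S = "{0..t}" and g' = w']) auto
  also have "\<dots> \<le> exp (M * T) * G * T"
    using t order_trans[OF norm_ge_zero G[of 0]] by (intro mult_left_mono mult_nonneg_nonneg) auto
  finally have "norm (w t - w 0) \<le> exp (M * T) * (T * G)" by (simp add: mult_ac)
  moreover have "norm (w 0) \<le> exp (M * T) * norm X"
    using e[of 0] t unfolding w_def norm_scaleC matexp_zero by (simp add: mult_right_mono)
  moreover have "w t = matexp (t *\<^sub>R A) ** X" by (simp add: w_def scaleC_one)
  ultimately show ?thesis
    using norm_triangle_ineq[of "w t - w 0" "w 0"] by (simp add: distrib_left)
qed

text \<open>Factors with an invertible \<open>A - r\<close> can be cancelled from the annihilating product. Each of the others costs one
  application of the previous estimate and with it one power of \<open>norm A\<close>.\<close>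

lemma matexp_bound:
  "\<exists>\<kappa>\<ge>0. \<forall>(A :: complex ^ 'N::finite ^ 'N) M T t. (\<forall>z. det (mat z - A) = 0 \<longrightarrow> Re z \<le> M) \<longrightarrow> 0 \<le> M \<longrightarrow> t \<in> {0..T} \<longrightarrow>
     norm (matexp (t *\<^sub>R A)) \<le> (exp (M * T) * (1 + T * \<kappa> * norm A)) ^ DIM(complex ^ 'N ^ 'N) * norm (mat 1 :: complex ^ 'N ^ 'N)"
proof -
  obtain K where K: "K \<ge> 0" "\<And>(x :: complex ^ 'N ^ 'N) (y :: complex ^ 'N ^ 'N). norm (x ** y) \<le> norm x * norm y * K"
    using bounded_bilinear.nonneg_bounded[OF bounded_bilinear_matrix_mult] by blast
  obtain L where L: "L \<ge> 0" "\<And>(A :: complex ^ 'N ^ 'N) z. det (mat z - A) = 0 \<Longrightarrow> cmod z \<le> L * norm A"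
    using eigenvalue_norm_le by blast
  \<comment> \<open>\<open>\<kappa> * norm A\<close> bounds multiplication by \<open>A - r\<close> for every eigenvalue \<open>r\<close>\<close>
  define \<kappa> where "\<kappa> = (1 + L * norm (mat 1 :: complex ^ 'N ^ 'N)) * K"
  have \<kappa>: "\<kappa> \<ge> 0" unfolding \<kappa>_def using K L by simp
  have "norm (matexp (t *\<^sub>R A)) \<le> (exp (M * T) * (1 + T * \<kappa> * norm A)) ^ DIM(complex ^ 'N ^ 'N) * norm (mat 1 :: complex ^ 'N ^ 'N)"
    if spec: "\<And>z. det (mat z - A) = 0 \<Longrightarrow> Re z \<le> M" and M: "0 \<le> M" and t: "t \<in> {0..T}"
    for A :: "complex ^ 'N ^ 'N" and M T t
  proof -
    define \<beta> where "\<beta> = exp (M * T) * (1 + T * \<kappa> * norm A)"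
    have T: "T \<ge> 0" using t by auto
    have \<beta>1: "1 \<le> \<beta>"
    proof -
      have "1 * 1 \<le> \<beta>"
        unfolding \<beta>_def using T M \<kappa> by (intro mult_mono) auto
      then show ?thesis by simp
    qed
    have step: "norm ((A - mat z) ** X) \<le> \<kappa> * norm A * norm X" if "det (mat z - A) = 0" for z and X :: "complex ^ 'N ^ 'N"
    proof -
      have "norm (mat z :: complex ^ 'N ^ 'N) \<le> L * norm A * norm (mat 1 :: complex ^ 'N ^ 'N)"
        unfolding mat_eq_scaleC[of z] norm_scaleC by (intro mult_right_mono L that) auto
      then have "norm (A - mat z) \<le> norm A + L * norm A * norm (mat 1 :: complex ^ 'N ^ 'N)"
        using norm_triangle_ineq4[of A "mat z"] by simp
      then have "norm (A - mat z) * norm X * K \<le> (norm A + L * norm A * norm (mat 1 :: complex ^ 'N ^ 'N)) * norm X * K"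
        using K by (intro mult_right_mono) auto
      with K(2)[of "A - mat z" X] show ?thesis by (simp add: \<kappa>_def algebra_simps)
    qed
    have main: "norm (matexp (s *\<^sub>R A) ** X) \<le> \<beta> ^ length rs * norm X"
      if "shifted_prod A rs X = 0" "s \<in> {0..T}" for rs s and X :: "complex ^ 'N ^ 'N"
      using that
    proof (induction rs arbitrary: X s)
      case Nil
      then show ?case by (simp add: mm_zero_right)
    next
      case (Cons r rs)
      show ?case
      proof (cases "det (mat r - A) = 0")
        case True
        have 0: "shifted_prod A rs ((A - mat r) ** X) = 0"
          using Cons.prems by (simp add: shifted_prod_commute)
        define G where "G = \<beta> ^ length rs * (\<kappa> * norm A * norm X)"
        have "norm (matexp (s *\<^sub>R A) ** X) \<le> exp (M * T) * (norm X + T * G)"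
        proof (rule matexp_shift_bound[OF spec[OF True] M Cons.prems(2)])
          fix s' assume "s' \<in> {0..T}"
          then have "norm (matexp (s' *\<^sub>R A) ** ((A - mat r) ** X)) \<le> \<beta> ^ length rs * norm ((A - mat r) ** X)"
            by (rule Cons.IH[OF 0])
          also have "\<dots> \<le> G"
            unfolding G_def using \<beta>1 by (intro mult_left_mono step True) auto
          finally show "norm (matexp (s' *\<^sub>R A) ** ((A - mat r) ** X)) \<le> G" .
        qed
        also have "\<dots> \<le> exp (M * T) * (\<beta> ^ length rs * norm X + T * G)"
          using mult_right_mono[OF one_le_power[OF \<beta>1, of "length rs"], of "norm X"] by simp
        also have "\<dots> = \<beta> ^ length (r # rs) * norm X"
          by (simp add: G_def \<beta>_def algebra_simps)
        finally show ?thesis .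
      next
        case False
        then have "invertible (mat r - A)" by (simp add: invertible_det_nz)
        then obtain B where B: "B ** (mat r - A) = mat 1" by (auto simp: invertible_left_inverse)
        have "(mat r - A) ** shifted_prod A rs X = 0"
          using Cons.prems(1) by (simp add: mm_diff_left)
        then have "B ** ((mat r - A) ** shifted_prod A rs X) = 0" by (simp add: mm_zero_right)
        then have "shifted_prod A rs X = 0" by (simp add: matrix_mul_assoc B)
        then have "norm (matexp (s *\<^sub>R A) ** X) \<le> \<beta> ^ length rs * norm X"
          using Cons.IH Cons.prems(2) by blast
        also have "\<dots> \<le> \<beta> ^ length (r # rs) * norm X"
          using \<beta>1 by (intro mult_right_mono power_increasing) auto
        finally show ?thesis .
      qed
    qed
    obtain rs where rs: "length rs \<le> DIM(complex ^ 'N ^ 'N)" "shifted_prod A rs (mat 1) = 0"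
      using annihilating_product by blast
    have "norm (matexp (t *\<^sub>R A)) \<le> \<beta> ^ length rs * norm (mat 1 :: complex ^ 'N ^ 'N)"
      using main[OF rs(2) t] by simp
    also have "\<dots> \<le> \<beta> ^ DIM(complex ^ 'N ^ 'N) * norm (mat 1 :: complex ^ 'N ^ 'N)"
      using \<beta>1 rs(1) by (intro mult_right_mono power_increasing) auto
    finally show ?thesis by (simp add: \<beta>_def)
  qed
  with \<kappa> show ?thesis by blast
qed

section \<open>Growth of the derivatives of the exponential symbol\<close>

lemma symexp_polynomial_bound:
  fixes a :: "real ^ 'n::finite \<Rightarrow> complex ^ 'N::finite ^ 'N"
  assumes a: "growth_bound 0 C m a" and q: "quasi_hyperbolic a"
  shows "\<exists>D k. \<forall>t\<in>{0..T}. \<forall>\<xi>. norm (symexp a t \<xi>) \<le> D * jbracket \<xi> ^ k"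
proof -
  let ?d = "DIM(complex ^ 'N ^ 'N)" and ?I = "norm (mat 1 :: complex ^ 'N ^ 'N)"
  obtain M where M: "\<And>\<xi> z. Re z > M \<Longrightarrow> det (mat z - a \<xi>) \<noteq> 0"
    using q unfolding quasi_hyperbolic_def by blast
  obtain \<kappa> where \<kappa>: "\<kappa> \<ge> 0" "\<And>(A :: complex ^ 'N::finite ^ 'N) M T t. (\<forall>z. det (mat z - A) = 0 \<longrightarrow> Re z \<le> M) \<Longrightarrow> 0 \<le> M \<Longrightarrow> t \<in> {0..T} \<Longrightarrow>
     norm (matexp (t *\<^sub>R A)) \<le> (exp (M * T) * (1 + T * \<kappa> * norm A)) ^ ?d * ?I"
    using matexp_bound by metis
  \<comment> \<open>a larger half plane is harmless, and \<open>exp (?M * t)\<close> now increases with \<open>t\<close>\<close>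
  let ?M = "max M 0"
  have spec: "\<forall>z. det (mat z - a \<xi>) = 0 \<longrightarrow> Re z \<le> ?M" for \<xi>
    using M[of _ \<xi>] by (metis le_max_iff_disj not_less)
  have C: "C \<ge> 0" by (rule growth_bound_nonneg[OF a])
  have "norm (symexp a t \<xi>) \<le> ((exp (?M * T) * (1 + T * \<kappa> * C)) ^ ?d * ?I) * jbracket \<xi> ^ (m * ?d)"
    if t: "t \<in> {0..T}" for t \<xi>
  proof -
    have T: "0 \<le> T" using t by auto
    have aC: "norm (a \<xi>) \<le> C * jbracket \<xi> ^ m" using growth_boundD[OF a, of "[]" \<xi>] by simp
    have "norm (symexp a t \<xi>) \<le> (exp (?M * T) * (1 + T * \<kappa> * norm (a \<xi>))) ^ ?d * ?I"
      unfolding symexp_def by (rule \<kappa>(2)[OF spec _ t]) simp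
    also have "\<dots> \<le> (exp (?M * T) * ((1 + T * \<kappa> * C) * jbracket \<xi> ^ m)) ^ ?d * ?I"
    proof (intro mult_right_mono power_mono mult_left_mono)
      have "1 + T * \<kappa> * norm (a \<xi>) \<le> jbracket \<xi> ^ m + T * \<kappa> * (C * jbracket \<xi> ^ m)"
        using T \<kappa>(1) by (intro add_mono jbracket_power_ge_1 mult_left_mono aC) auto
      then show "1 + T * \<kappa> * norm (a \<xi>) \<le> (1 + T * \<kappa> * C) * jbracket \<xi> ^ m" by (simp add: algebra_simps)
    qed (use T \<kappa>(1) in auto)
    also have "\<dots> = ((exp (?M * T) * (1 + T * \<kappa> * C)) ^ ?d * ?I) * jbracket \<xi> ^ (m * ?d)"
      by (simp add: power_mult_distrib power_mult mult_ac)
    finally show ?thesis .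
  qed
  then show ?thesis by blast
qed

text \<open>A derivative \<open>X\<close> of the exponential satisfies \<open>X' = a X + R\<close>, where \<open>R\<close> collects the Leibniz terms with
  derivatives of lower order, so Duhamel's formula bounds it by the estimates already known.\<close>

lemma bounded_growth_symexp:
  fixes a :: "real ^ 'n::finite \<Rightarrow> complex ^ 'N::finite ^ 'N"
  assumes a: "\<And>L. \<exists>C m. growth_bound L C m a" and q: "quasi_hyperbolic a"
  shows "bounded_growth (symexp a) {0..T}"
  unfolding bounded_growth_def
proof
  fix L
  have sa: "smooth a" using a unfolding growth_bound_def by blast
  obtain K where K: "K \<ge> 0" "\<And>(x :: complex ^ 'N ^ 'N) (y :: complex ^ 'N ^ 'N). norm (x ** y) \<le> norm x * norm y * K"
    using bounded_bilinear.nonneg_bounded[OF bounded_bilinear_matrix_mult] by blast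
  obtain D k where D: "\<And>t \<xi>. t \<in> {0..T} \<Longrightarrow> norm (symexp a t \<xi>) \<le> D * jbracket \<xi> ^ k"
    using symexp_polynomial_bound[OF _ q] a by metis
  show "\<exists>C m. \<forall>t\<in>{0..T}. growth_bound L C m (symexp a t)"
  proof (induction L)
    case 0
    show ?case
      using D by (intro exI[of _ D] exI[of _ k]) (auto simp: growth_bound_def smooth_symexp[OF sa])
  next
    case (Suc L)
    then obtain C m where C: "\<And>t. t \<in> {0..T} \<Longrightarrow> growth_bound L C m (symexp a t)" by blast
    obtain Ca ma where Ca: "growth_bound (Suc L) Ca ma a" using a by blast
    define Q where "Q = 2 ^ Suc L * (Ca * \<bar>C\<bar> * K)"
    define H where "H = T * (\<bar>D\<bar> * Q * K)"
    have Q: "Q \<ge> 0" unfolding Q_def using growth_bound_nonneg[OF Ca] K by auto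
    have new: "norm (iter_partial is (symexp a t) \<xi>) \<le> H * jbracket \<xi> ^ (k + (ma + m))"
      if l: "length is = Suc L" and t: "t \<in> {0..T}" for "is" :: "'n list" and t \<xi>
    proof -
      define X where "X s = iter_partial is (symexp a s) \<xi>" for s
      define R where "R s = (\<Sum>(u, v)\<leftarrow>tl (splits is). iter_partial u a \<xi> ** iter_partial v (symexp a s) \<xi>)" for s
      have X': "(X has_vector_derivative a \<xi> ** X s + R s) (at s)" for s
      proof -
        have "iter_partial is (\<lambda>\<xi>. a \<xi> ** symexp a s \<xi>) \<xi> =
            (\<Sum>(u, v)\<leftarrow>splits is. iter_partial u a \<xi> ** iter_partial v (symexp a s) \<xi>)"
          by (simp add: iter_partial_bilinear[OF bounded_bilinear_matrix_mult sa smooth_symexp[OF sa]])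
        also have "\<dots> = a \<xi> ** X s + R s"
          by (subst splits_Cons_tl) (simp add: X_def R_def)
        finally show ?thesis
          using symexp_has_vector_derivative[OF sa, of "is" \<xi> s] by (simp add: X_def[abs_def])
      qed
      have R: "norm (R s) \<le> Q * jbracket \<xi> ^ (ma + m)" if s: "s \<in> {0..T}" for s
      proof -
        have "norm (case p of (u, v) \<Rightarrow> iter_partial u a \<xi> ** iter_partial v (symexp a s) \<xi>) \<le> Ca * \<bar>C\<bar> * K * jbracket \<xi> ^ (ma + m)"
          if p: "p \<in> set (tl (splits is))" for p
        proof -
          obtain u v where uv: "p = (u, v)" by (cases p)
          have v: "length v \<le> L" using tl_splits_less p l unfolding uv by fastforce
          have "(u, v) \<in> set (splits is)" using p unfolding uv by (subst splits_Cons_tl) simp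
          then have u: "length u \<le> Suc L" using splits_lengths l by fastforce
          have "norm (iter_partial v (symexp a s) \<xi>) \<le> C * jbracket \<xi> ^ m"
            by (rule growth_boundD[OF C[OF s] v])
          also have "\<dots> \<le> \<bar>C\<bar> * jbracket \<xi> ^ m"
            by (intro mult_right_mono) (auto simp: jbracket_ge_0)
          finally have "norm (iter_partial u a \<xi>) * norm (iter_partial v (symexp a s) \<xi>) * K \<le>
              (Ca * jbracket \<xi> ^ ma) * (\<bar>C\<bar> * jbracket \<xi> ^ m) * K"
            using K(1) growth_bound_nonneg[OF Ca]
            by (intro mult_right_mono mult_mono growth_boundD[OF Ca u]) (auto simp: jbracket_ge_0)
          with K(2) have "norm (iter_partial u a \<xi> ** iter_partial v (symexp a s) \<xi>) \<le> (Ca * jbracket \<xi> ^ ma) * (\<bar>C\<bar> * jbracket \<xi> ^ m) * K"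
            by (rule order_trans)
          then show ?thesis by (simp add: uv power_add mult_ac)
        qed
        then have "norm (R s) \<le> real (length (tl (splits is))) * (Ca * \<bar>C\<bar> * K * jbracket \<xi> ^ (ma + m))"
          unfolding R_def by (rule norm_sum_list_le)
        also have "\<dots> \<le> 2 ^ Suc L * (Ca * \<bar>C\<bar> * K * jbracket \<xi> ^ (ma + m))"
          using l K(1) growth_bound_nonneg[OF Ca] by (intro mult_right_mono) (auto simp: length_splits jbracket_ge_0)
        finally show ?thesis by (simp add: Q_def mult_ac)
      qed
      \<comment> \<open>Duhamel: the part \<open>a X\<close> of the equation cancels in the derivative of \<open>Z\<close>\<close>
      define Z where "Z s = matexp ((t - s) *\<^sub>R a \<xi>) ** X s" for s
      have Z': "(Z has_vector_derivative matexp ((t - s) *\<^sub>R a \<xi>) ** R s) (at s)" for s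
      proof -
        have "(Z has_vector_derivative (matexp ((t - s) *\<^sub>R a \<xi>) ** (a \<xi> ** X s + R s) +
            (- (a \<xi> ** matexp ((t - s) *\<^sub>R a \<xi>))) ** X s)) (at s)"
          unfolding Z_def by (rule bounded_bilinear.has_vector_derivative[OF bounded_bilinear_matrix_mult
            matexp_reverse_has_vector_derivative X'])
        moreover have "matexp ((t - s) *\<^sub>R a \<xi>) ** (a \<xi> ** X s) = (a \<xi> ** matexp ((t - s) *\<^sub>R a \<xi>)) ** X s"
          unfolding matexp_commute by (rule matrix_mul_assoc)
        ultimately show ?thesis
          by (simp add: matrix_add_ldistrib bounded_bilinear.minus_left[OF bounded_bilinear_matrix_mult])
      qed
      let ?B = "(\<bar>D\<bar> * jbracket \<xi> ^ k) * (Q * jbracket \<xi> ^ (ma + m)) * K"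
      have "norm (matexp ((t - s) *\<^sub>R a \<xi>) ** R s) \<le> ?B" if s: "s \<in> {0..t}" for s
      proof -
        have "norm (matexp ((t - s) *\<^sub>R a \<xi>)) \<le> D * jbracket \<xi> ^ k"
          using D[of "t - s" \<xi>] s t by (auto simp: symexp_def)
        also have "\<dots> \<le> \<bar>D\<bar> * jbracket \<xi> ^ k"
          by (intro mult_right_mono) (auto simp: jbracket_ge_0)
        finally have "norm (matexp ((t - s) *\<^sub>R a \<xi>)) * norm (R s) * K \<le> ?B"
          using K(1) s t by (intro mult_right_mono mult_mono R) (auto simp: jbracket_ge_0)
        with K(2) show ?thesis by (rule order_trans)
      qed
      then have "norm (Z t - Z 0) \<le> ?B * \<bar>t - 0\<bar>"
        using t by (intro vector_differentiable_bound[where S = "{0..t}" and g' = "\<lambda>s. matexp ((t - s) *\<^sub>R a \<xi>) ** R s"]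
            has_vector_derivative_at_within[OF Z']) auto
      also have "\<dots> \<le> ?B * T"
        using t K(1) Q by (intro mult_left_mono) (auto simp: jbracket_ge_0)
      finally have "norm (Z t - Z 0) \<le> H * jbracket \<xi> ^ (k + (ma + m))"
        by (simp add: H_def power_add mult_ac)
      moreover have "Z t = X t" unfolding Z_def using matexp_zero[of "a \<xi>"] by simp
      moreover have "Z 0 = 0"
      proof -
        have "symexp a 0 = (\<lambda>\<xi>. mat 1)" by (rule ext) (simp only: symexp_def matexp_zero)
        then have "X 0 = 0" using l by (auto simp: X_def iter_partial_const)
        then show ?thesis by (simp add: Z_def mm_zero_right)
      qed
      ultimately show ?thesis by (simp add: X_def)
    qed
    have "growth_bound (Suc L) (max C H) (k + (ma + m)) (symexp a t)" if t: "t \<in> {0..T}" for t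
      unfolding growth_bound_def
    proof (intro conjI allI impI)
      show "smooth (symexp a t)" by (rule smooth_symexp[OF sa])
      fix "is" :: "'n list" and \<xi> :: "real ^ 'n" assume "length is \<le> Suc L"
      then consider "length is \<le> L" | "length is = Suc L" by linarith
      then show "norm (iter_partial is (symexp a t) \<xi>) \<le> max C H * jbracket \<xi> ^ (k + (ma + m))"
      proof cases
        case 1
        then show ?thesis
          using growth_boundD[OF growth_bound_mono[OF C[OF t] order_refl max.cobounded1, of "k + (ma + m)" H]] by simp
      next
        case 2
        have "H * jbracket \<xi> ^ (k + (ma + m)) \<le> max C H * jbracket \<xi> ^ (k + (ma + m))"
          by (intro mult_right_mono) (auto simp: jbracket_ge_0)
        with new[OF 2 t, of \<xi>] show ?thesis by simp
      qed
    qed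
    then show ?case by blast
  qed
qed

section \<open>Differentiable families of multipliers\<close>

definition time_derivative ::
  "(real \<Rightarrow> real ^ 'n::finite \<Rightarrow> 'b::real_normed_vector) \<Rightarrow> (real \<Rightarrow> real ^ 'n \<Rightarrow> 'b) \<Rightarrow> bool" where
  "time_derivative b b' \<longleftrightarrow> (\<forall>t. smooth (b t)) \<and> (\<forall>t. smooth (b' t)) \<and>
     (\<forall>is x t. ((\<lambda>t. iter_partial is (b t) x) has_vector_derivative iter_partial is (b' t) x) (at t))"

lemma time_derivativeD:
  assumes "time_derivative b b'"
  shows "((\<lambda>t. iter_partial is (b t) x) has_vector_derivative iter_partial is (b' t) x) (at t within S)"
proof -
  have "((\<lambda>t. iter_partial is (b t) x) has_vector_derivative iter_partial is (b' t) x) (at t)"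
    using assms unfolding time_derivative_def by blast
  then show ?thesis by (rule has_vector_derivative_at_within)
qed

lemma has_vector_derivative_sum_list:
  assumes "\<And>p. p \<in> set ps \<Longrightarrow> (f p has_vector_derivative f' p) F"
  shows "((\<lambda>t. \<Sum>p\<leftarrow>ps. f p t) has_vector_derivative (\<Sum>p\<leftarrow>ps. f' p)) F"
  using assms by (induction ps) (auto intro: has_vector_derivative_add)

lemma time_derivative_mult_left:
  fixes a :: "real ^ 'n::finite \<Rightarrow> 'a::real_normed_vector"
  assumes B: "bounded_bilinear B" and a: "smooth a" and b: "time_derivative b b'"
  shows "time_derivative (\<lambda>t x. B (a x) (b t x)) (\<lambda>t x. B (a x) (b' t x))"
  unfolding time_derivative_def
proof (intro conjI allI)
  have sm: "smooth (b t)" "smooth (b' t)" for t using b by (auto simp: time_derivative_def)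
  show "smooth (\<lambda>x. B (a x) (b t x))" "smooth (\<lambda>x. B (a x) (b' t x))" for t
    by (intro smooth_bilinear[OF B a] sm)+
  fix "is" :: "'n list" and x t
  have "((\<lambda>t. B (iter_partial u a x) (iter_partial v (b t) x)) has_vector_derivative
      B (iter_partial u a x) (iter_partial v (b' t) x)) (at t)" for u v
    by (rule bounded_linear.has_vector_derivative[OF bounded_bilinear.bounded_linear_right[OF B] time_derivativeD[OF b]])
  then have "((\<lambda>t. \<Sum>p\<leftarrow>splits is. B (iter_partial (fst p) a x) (iter_partial (snd p) (b t) x)) has_vector_derivative
      (\<Sum>p\<leftarrow>splits is. B (iter_partial (fst p) a x) (iter_partial (snd p) (b' t) x))) (at t)"
    by (rule has_vector_derivative_sum_list)
  then show "((\<lambda>t. iter_partial is (\<lambda>x. B (a x) (b t x)) x) has_vector_derivative iter_partial is (\<lambda>x. B (a x) (b' t x)) x) (at t)"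
    unfolding iter_partial_bilinear[OF B a sm(1)] iter_partial_bilinear[OF B a sm(2)] case_prod_unfold .
qed

lemma time_derivative_symexp:
  fixes a :: "real ^ 'n::finite \<Rightarrow> complex ^ 'N::finite ^ 'N"
  assumes "smooth a"
  shows "time_derivative (symexp a) (\<lambda>t x. a x ** symexp a t x)"
  unfolding time_derivative_def
  using symexp_has_vector_derivative[OF assms] smooth_symexp[OF assms]
    smooth_bilinear[OF bounded_bilinear_matrix_mult assms smooth_symexp[OF assms]] by blast

text \<open>Lipschitz continuity in \<open>t\<close> and, below, a first order expansion with quadratic remainder, for all derivatives in \<open>x\<close> and with
  constants of polynomial growth.\<close>

definition Lipschitz_multipliers :: "(real \<Rightarrow> real ^ 'n::finite \<Rightarrow> 'b::real_normed_vector) \<Rightarrow> real \<Rightarrow> bool" where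
  "Lipschitz_multipliers b T \<longleftrightarrow>
     (\<forall>L. \<exists>C m. \<forall>s\<in>{0..T}. \<forall>t\<in>{0..T}. growth_bound L (C * \<bar>s - t\<bar>) m (\<lambda>x. b s x - b t x))"

definition Taylor_multipliers ::
  "(real \<Rightarrow> real ^ 'n::finite \<Rightarrow> 'b::real_normed_vector) \<Rightarrow> (real \<Rightarrow> real ^ 'n \<Rightarrow> 'b) \<Rightarrow> real \<Rightarrow> bool" where
  "Taylor_multipliers b b' T \<longleftrightarrow>
     (\<forall>L. \<exists>C m. \<forall>s\<in>{0..T}. \<forall>t\<in>{0..T}. growth_bound L (C * \<bar>s - t\<bar>\<^sup>2) m (\<lambda>x. b s x - b t x - (s - t) *\<^sub>R b' t x))"

lemma iter_partial_scaleR: "smooth f \<Longrightarrow> iter_partial is (\<lambda>x. r *\<^sub>R f x) = (\<lambda>x. r *\<^sub>R iter_partial is f x)"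
  by (rule iter_partial_bounded_linear[OF bounded_linear_scaleR_right])

lemma smooth_scaleR: "smooth f \<Longrightarrow> smooth (\<lambda>x. r *\<^sub>R f x)"
  by (rule smooth_bounded_linear[OF bounded_linear_scaleR_right])

lemma Lipschitz_multipliersI:
  fixes b :: "real \<Rightarrow> real ^ 'n::finite \<Rightarrow> 'b::real_normed_vector"
  assumes d: "time_derivative b b'" and g: "bounded_growth b' {0..T}"
  shows "Lipschitz_multipliers b T"
  unfolding Lipschitz_multipliers_def
proof
  fix L
  obtain C m where C: "\<And>t. t \<in> {0..T} \<Longrightarrow> growth_bound L C m (b' t)"
    using g unfolding bounded_growth_def by blast
  have sm: "smooth (b t)" for t using d by (simp add: time_derivative_def)
  have "growth_bound L (C * \<bar>s - t\<bar>) m (\<lambda>x. b s x - b t x)" if st: "s \<in> {0..T}" "t \<in> {0..T}" for s t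
    unfolding growth_bound_def
  proof (intro conjI allI impI)
    show "smooth (\<lambda>x. b s x - b t x)" by (rule smooth_diff[OF sm sm])
    fix "is" :: "'n list" and x :: "real ^ 'n" assume l: "length is \<le> L"
    have "norm (iter_partial is (b s) x - iter_partial is (b t) x) \<le> (C * jbracket x ^ m) * \<bar>s - t\<bar>"
    proof (rule vector_differentiable_bound[where S = "{0..T}" and g = "\<lambda>r. iter_partial is (b r) x"
          and g' = "\<lambda>r. iter_partial is (b' r) x"])
      show "((\<lambda>t. iter_partial is (b t) x) has_vector_derivative iter_partial is (b' r) x) (at r within {0..T})" for r
        by (rule time_derivativeD[OF d])
      show "norm (iter_partial is (b' r) x) \<le> C * jbracket x ^ m" if "r \<in> {0..T}" for r
        by (rule growth_boundD[OF C[OF that] l])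
    qed (use st in auto)
    then show "norm (iter_partial is (\<lambda>x. b s x - b t x) x) \<le> C * \<bar>s - t\<bar> * jbracket x ^ m"
      by (simp add: iter_partial_diff[OF sm sm] mult_ac)
  qed
  then show "\<exists>C m. \<forall>s\<in>{0..T}. \<forall>t\<in>{0..T}. growth_bound L (C * \<bar>s - t\<bar>) m (\<lambda>x. b s x - b t x)" by blast
qed

lemma Taylor_multipliersI:
  fixes b :: "real \<Rightarrow> real ^ 'n::finite \<Rightarrow> 'b::real_normed_vector"
  assumes d: "time_derivative b b'" and lip: "Lipschitz_multipliers b' T"
  shows "Taylor_multipliers b b' T"
  unfolding Taylor_multipliers_def
proof
  fix L
  obtain C m where C: "\<And>s t. s \<in> {0..T} \<Longrightarrow> t \<in> {0..T} \<Longrightarrow> growth_bound L (C * \<bar>s - t\<bar>) m (\<lambda>x. b' s x - b' t x)"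
    using lip unfolding Lipschitz_multipliers_def by blast
  have sm: "smooth (b t)" "smooth (b' t)" for t using d by (simp_all add: time_derivative_def)
  have "growth_bound L (\<bar>C\<bar> * \<bar>s - t\<bar>\<^sup>2) m (\<lambda>x. b s x - b t x - (s - t) *\<^sub>R b' t x)" if st: "s \<in> {0..T}" "t \<in> {0..T}" for s t
    unfolding growth_bound_def
  proof (intro conjI allI impI)
    show "smooth (\<lambda>x. b s x - b t x - (s - t) *\<^sub>R b' t x)"
      using smooth_diff[OF smooth_diff[OF sm(1)[of s] sm(1)[of t]] smooth_scaleR[OF sm(2)[of t], of "s - t"]] .
    fix "is" :: "'n list" and x :: "real ^ 'n" assume l: "length is \<le> L"
    let ?S = "{min s t..max s t}"
    define g where "g r = iter_partial is (b r) x - r *\<^sub>R iter_partial is (b' t) x" for r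
    have "norm (g s - g t) \<le> (\<bar>C\<bar> * \<bar>s - t\<bar> * jbracket x ^ m) * \<bar>s - t\<bar>"
    proof (rule vector_differentiable_bound[where S = ?S and g = g and x = s and y = t
          and g' = "\<lambda>r. iter_partial is (b' r) x - iter_partial is (b' t) x"])
      show "(g has_vector_derivative iter_partial is (b' r) x - iter_partial is (b' t) x) (at r within ?S)" for r
      proof -
        have "((\<lambda>t. iter_partial is (b t) x) has_vector_derivative iter_partial is (b' r) x) (at r within ?S)"
          by (rule time_derivativeD[OF d])
        moreover have "((\<lambda>r. r *\<^sub>R iter_partial is (b' t) x) has_vector_derivative iter_partial is (b' t) x) (at r within ?S)"
          by (auto intro!: derivative_eq_intros)
        ultimately show ?thesis unfolding g_def by (rule has_vector_derivative_diff)
      qed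
      show "norm (iter_partial is (b' r) x - iter_partial is (b' t) x) \<le> \<bar>C\<bar> * \<bar>s - t\<bar> * jbracket x ^ m" if r: "r \<in> ?S" for r
      proof -
        have "norm (iter_partial is (b' r) x - iter_partial is (b' t) x) \<le> C * \<bar>r - t\<bar> * jbracket x ^ m"
        proof -
          have "r \<in> {0..T}" using r st by (auto simp: min_def max_def split: if_splits)
          from growth_boundD[OF C[OF this st(2)] l, of x] show ?thesis
            by (simp add: iter_partial_diff[OF sm(2) sm(2)])
        qed
        also have "\<dots> \<le> \<bar>C\<bar> * \<bar>s - t\<bar> * jbracket x ^ m"
          using r by (intro mult_right_mono mult_mono) (auto simp: jbracket_ge_0 min_def max_def split: if_splits)
        finally show ?thesis .
      qed
    qed auto
    moreover have "g s - g t = iter_partial is (\<lambda>x. b s x - b t x - (s - t) *\<^sub>R b' t x) x"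
      unfolding iter_partial_diff[OF smooth_diff[OF sm(1) sm(1)] smooth_scaleR[OF sm(2)]]
        iter_partial_diff[OF sm(1) sm(1)] iter_partial_scaleR[OF sm(2)] g_def
      by (simp add: scaleR_diff_left)
    ultimately show "norm (iter_partial is (\<lambda>x. b s x - b t x - (s - t) *\<^sub>R b' t x) x) \<le> \<bar>C\<bar> * \<bar>s - t\<bar>\<^sup>2 * jbracket x ^ m"
      by (simp add: power2_eq_square mult_ac)
  qed
  then show "\<exists>C m. \<forall>s\<in>{0..T}. \<forall>t\<in>{0..T}. growth_bound L (C * \<bar>s - t\<bar>\<^sup>2) m (\<lambda>x. b s x - b t x - (s - t) *\<^sub>R b' t x)" by blast
qed

text \<open>These conditions make \<open>t \<mapsto> b t\<close> a \<open>C\<^sup>1\<close> curve of multiplication operators, on functions and, through the entries,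
  on distributions.\<close>

definition C1_multipliers ::
  "(real \<Rightarrow> real ^ 'n::finite \<Rightarrow> 'b::real_normed_vector) \<Rightarrow> (real \<Rightarrow> real ^ 'n \<Rightarrow> 'b) \<Rightarrow> bool" where
  "C1_multipliers b b' \<longleftrightarrow> (\<forall>T. bounded_growth b {0..T} \<and> bounded_growth b' {0..T} \<and>
     Lipschitz_multipliers b T \<and> Lipschitz_multipliers b' T \<and> Taylor_multipliers b b' T)"

lemma growth_bound_linear_ex:
  assumes B: "bounded_linear B"
  obtains K where "K \<ge> 0" "\<And>L C m f. growth_bound L C m f \<Longrightarrow> growth_bound L (C * K) m (\<lambda>x. B (f x))"
proof -
  obtain K where K: "K \<ge> 0" "\<And>x. norm (B x) \<le> norm x * K"
    using bounded_linear.nonneg_bounded[OF B] by blast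
  show ?thesis by (rule that[OF K(1) growth_bound_linear[OF B K(2) K(1)]])
qed

lemma C1_multipliers_linear:
  fixes b :: "real \<Rightarrow> real ^ 'n::finite \<Rightarrow> 'b::real_normed_vector" and B :: "'b \<Rightarrow> 'c::real_normed_vector"
  assumes B: "bounded_linear B" and b: "C1_multipliers b b'"
  shows "C1_multipliers (\<lambda>t x. B (b t x)) (\<lambda>t x. B (b' t x))"
proof -
  note lin = bounded_linear.linear[OF B]
  obtain K where K: "K \<ge> 0" "\<And>L C m (f :: real ^ 'n \<Rightarrow> 'b). growth_bound L C m f \<Longrightarrow> growth_bound L (C * K) m (\<lambda>x. B (f x))"
    using growth_bound_linear_ex[OF B] by blast
  have lip: "Lipschitz_multipliers (\<lambda>t x. B (c t x)) T" if c: "Lipschitz_multipliers c T" for c :: "real \<Rightarrow> real ^ 'n \<Rightarrow> 'b" and T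
    unfolding Lipschitz_multipliers_def
  proof
    fix L
    obtain C m where C: "\<And>s t. s \<in> {0..T} \<Longrightarrow> t \<in> {0..T} \<Longrightarrow> growth_bound L (C * \<bar>s - t\<bar>) m (\<lambda>x. c s x - c t x)"
      using c unfolding Lipschitz_multipliers_def by blast
    have "growth_bound L ((C * K) * \<bar>s - t\<bar>) m (\<lambda>x. B (c s x) - B (c t x))" if "s \<in> {0..T}" "t \<in> {0..T}" for s t
      using K(2)[OF C[OF that]] by (simp add: linear_diff[OF lin] mult_ac)
    then show "\<exists>C m. \<forall>s\<in>{0..T}. \<forall>t\<in>{0..T}. growth_bound L (C * \<bar>s - t\<bar>) m (\<lambda>x. B (c s x) - B (c t x))" by blast
  qed
  have tay: "Taylor_multipliers (\<lambda>t x. B (b t x)) (\<lambda>t x. B (b' t x)) T" for T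
    unfolding Taylor_multipliers_def
  proof
    fix L
    obtain C m where C: "\<And>s t. s \<in> {0..T} \<Longrightarrow> t \<in> {0..T} \<Longrightarrow> growth_bound L (C * \<bar>s - t\<bar>\<^sup>2) m (\<lambda>x. b s x - b t x - (s - t) *\<^sub>R b' t x)"
      using b unfolding C1_multipliers_def Taylor_multipliers_def by blast
    have "growth_bound L ((C * K) * \<bar>s - t\<bar>\<^sup>2) m (\<lambda>x. B (b s x) - B (b t x) - (s - t) *\<^sub>R B (b' t x))" if "s \<in> {0..T}" "t \<in> {0..T}" for s t
      using K(2)[OF C[OF that]] by (simp add: linear_diff[OF lin] linear_cmul[OF lin] mult_ac)
    then show "\<exists>C m. \<forall>s\<in>{0..T}. \<forall>t\<in>{0..T}. growth_bound L (C * \<bar>s - t\<bar>\<^sup>2) m (\<lambda>x. B (b s x) - B (b t x) - (s - t) *\<^sub>R B (b' t x))" by blast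
  qed
  show ?thesis
    using b lip tay bounded_growth_linear[OF B] unfolding C1_multipliers_def by blast
qed

text \<open>The first two derivatives of \<open>e\<^sup>t\<^sup>a\<close> in \<open>t\<close> are \<open>a e\<^sup>t\<^sup>a\<close> and \<open>a\<^sup>2 e\<^sup>t\<^sup>a\<close>, and the growth bounds for \<open>e\<^sup>t\<^sup>a\<close> extend to them.\<close>

lemma C1_multipliers_symexp:
  fixes a :: "real ^ 'n::finite \<Rightarrow> complex ^ 'N::finite ^ 'N"
  assumes a: "\<And>L. \<exists>C m. growth_bound L C m a" and q: "quasi_hyperbolic a"
  shows "C1_multipliers (symexp a) (\<lambda>t x. a x ** symexp a t x)"
  unfolding C1_multipliers_def
proof (intro allI)
  fix T
  let ?b' = "\<lambda>t x. a x ** symexp a t x" and ?b'' = "\<lambda>t x. a x ** (a x ** symexp a t x)"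
  have sa: "smooth a" using a unfolding growth_bound_def by blast
  have ga: "bounded_growth (\<lambda>_::real. a) {0..T}" using a unfolding bounded_growth_def by blast
  have g: "bounded_growth (symexp a) {0..T}" by (rule bounded_growth_symexp[OF a q])
  have g': "bounded_growth ?b' {0..T}" by (rule bounded_growth_bilinear[OF bounded_bilinear_matrix_mult ga g])
  have g'': "bounded_growth ?b'' {0..T}" by (rule bounded_growth_bilinear[OF bounded_bilinear_matrix_mult ga g'])
  have d: "time_derivative (symexp a) ?b'" by (rule time_derivative_symexp[OF sa])
  have d': "time_derivative ?b' ?b''" by (rule time_derivative_mult_left[OF bounded_bilinear_matrix_mult sa d])
  have l': "Lipschitz_multipliers ?b' T" by (rule Lipschitz_multipliersI[OF d' g''])
  show "bounded_growth (symexp a) {0..T} \<and> bounded_growth ?b' {0..T} \<and> Lipschitz_multipliers (symexp a) T \<and>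
      Lipschitz_multipliers ?b' T \<and> Taylor_multipliers (symexp a) ?b' T"
    using g g' l' Lipschitz_multipliersI[OF d g'] Taylor_multipliersI[OF d l'] by blast
qed

subsection \<open>Multiplication operators on the Schwartz space\<close>

text \<open>Membership in \<open>O_M\<close>, expressed with lists of directions.\<close>

definition slow_growth :: "(real ^ 'n::finite \<Rightarrow> 'b::real_normed_vector) \<Rightarrow> bool" where
  "slow_growth b \<longleftrightarrow> (\<forall>L. \<exists>C m. growth_bound L C m b)"

lemma slow_growth_bounded_growth: "bounded_growth b I \<Longrightarrow> t \<in> I \<Longrightarrow> slow_growth (b t)"
  unfolding slow_growth_def bounded_growth_def by blast

lemma slow_growth_linear: "bounded_linear B \<Longrightarrow> slow_growth b \<Longrightarrow> slow_growth (\<lambda>x. B (b x))"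
  using bounded_growth_linear[of B "\<lambda>_. b" UNIV] unfolding slow_growth_def bounded_growth_def by simp

lemma slow_growth_bilinear: "bounded_bilinear B \<Longrightarrow> slow_growth b \<Longrightarrow> slow_growth c \<Longrightarrow> slow_growth (\<lambda>x. B (b x) (c x))"
  using bounded_growth_bilinear[of B "\<lambda>_. b" UNIV "\<lambda>_. c"] unfolding slow_growth_def bounded_growth_def by simp

lemma slow_growth_const: "slow_growth (\<lambda>x. c)"
  unfolding slow_growth_def growth_bound_def
proof (intro allI exI conjI impI)
  show "norm (iter_partial is (\<lambda>x. c) x) \<le> norm c * jbracket x ^ 0" for "is" x
    by (simp add: iter_partial_const)
qed (rule smooth_const)

lemma C1_multipliers_slow_growth:
  assumes "C1_multipliers b b'" "t \<ge> 0"
  shows "slow_growth (b t)" "slow_growth (b' t)"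
  using assms slow_growth_bounded_growth[of b "{0..t}" t] slow_growth_bounded_growth[of b' "{0..t}" t]
  by (auto simp: C1_multipliers_def)

text \<open>This covers the action of matrices on vector-valued functions and that of their entries on test functions.\<close>

definition bmult :: "('a::real_normed_vector \<Rightarrow> 'b::real_normed_vector \<Rightarrow> 'c::real_normed_vector) \<Rightarrow>
    (real ^ 'n \<Rightarrow> 'a) \<Rightarrow> ('n::finite, 'b) schwartz \<Rightarrow> ('n, 'c) schwartz" where
  "bmult B b \<phi> = Abs_schwartz (\<lambda>x. B (b x) (Rep_schwartz \<phi> x))"

lemma mult_schwartz_bmult: "mult_schwartz = bmult (*v)"
  by (simp add: fun_eq_iff mult_schwartz_def bmult_def)

lemma mult_test_bmult: "mult_test = bmult (*)"
  by (simp add: fun_eq_iff mult_test_def bmult_def)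

lemma Rep_bmult:
  assumes B: "bounded_bilinear B" and b: "slow_growth b"
  shows "Rep_schwartz (bmult B b \<phi>) = (\<lambda>x. B (b x) (Rep_schwartz \<phi> x))"
proof -
  have "is_schwartz (\<lambda>x. B (b x) (Rep_schwartz \<phi> x))"
    by (rule is_schwartz_bilinear[OF B b[unfolded slow_growth_def, THEN spec] is_schwartz_Rep])
  then show ?thesis unfolding bmult_def by (intro Abs_schwartz_inverse CollectI)
qed

lemma snorm_bmult:
  fixes B :: "'a::real_normed_vector \<Rightarrow> 'b::real_normed_vector \<Rightarrow> 'c::real_normed_vector"
  assumes B: "bounded_bilinear B"
  obtains K where "K \<ge> 0" "\<And>L C m (b :: real ^ 'n::finite \<Rightarrow> 'a) (\<phi> :: ('n, 'b) schwartz) (g :: ('n, 'c) schwartz). growth_bound L C m b \<Longrightarrow> Rep_schwartz g = (\<lambda>x. B (b x) (Rep_schwartz \<phi> x)) \<Longrightarrow>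
    snorm L g \<le> 2 ^ L * (C * K) * snorm (L + m) \<phi>"
proof -
  obtain K where K: "K \<ge> 0" "\<And>x y. norm (B x y) \<le> norm x * norm y * K"
    using bounded_bilinear.nonneg_bounded[OF B] by blast
  show ?thesis
  proof (rule that[OF K(1)])
    fix L C m and b :: "real ^ 'n \<Rightarrow> 'a" and \<phi> :: "('n, 'b) schwartz" and g :: "('n, 'c) schwartz"
    assume "growth_bound L C m b" "Rep_schwartz g = (\<lambda>x. B (b x) (Rep_schwartz \<phi> x))"
    from snorm_bilinear_le[OF B K this] show "snorm L g \<le> 2 ^ L * (C * K) * snorm (L + m) \<phi>" .
  qed
qed

lemma bmult_add: "bounded_bilinear B \<Longrightarrow> slow_growth b \<Longrightarrow> bmult B b (\<phi> + \<psi>) = bmult B b \<phi> + bmult B b \<psi>"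
  by (rule Rep_schwartz_eqI) (simp add: Rep_bmult plus_schwartz.rep_eq bounded_bilinear.add_right)

lemma bmult_scaleR: "bounded_bilinear B \<Longrightarrow> slow_growth b \<Longrightarrow> bmult B b (r *\<^sub>R \<phi>) = r *\<^sub>R bmult B b \<phi>"
  by (rule Rep_schwartz_eqI) (simp add: Rep_bmult scaleR_schwartz.rep_eq bounded_bilinear.scaleR_right)

lemma linear_bmult: "bounded_bilinear B \<Longrightarrow> slow_growth b \<Longrightarrow> linear (bmult B b)"
  by (intro linearI bmult_add bmult_scaleR)

lemma snorm_bmult_family:
  fixes B :: "'a::real_normed_vector \<Rightarrow> 'b::real_normed_vector \<Rightarrow> 'c::real_normed_vector" and b :: "'i \<Rightarrow> real ^ 'n::finite \<Rightarrow> 'a"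
  assumes B: "bounded_bilinear B" and b: "bounded_growth b I"
  shows "\<exists>C\<ge>0. \<exists>k. \<forall>t\<in>I. \<forall>\<phi>. snorm L (bmult B (b t) \<phi>) \<le> C * snorm k \<phi>"
proof (cases "I = {}")
  case False
  obtain K where K: "K \<ge> 0" "\<And>L C m (b :: real ^ 'n \<Rightarrow> 'a) (\<phi> :: ('n, 'b) schwartz) (g :: ('n, 'c) schwartz). growth_bound L C m b \<Longrightarrow> Rep_schwartz g = (\<lambda>x. B (b x) (Rep_schwartz \<phi> x)) \<Longrightarrow>
    snorm L g \<le> 2 ^ L * (C * K) * snorm (L + m) \<phi>" using snorm_bmult[OF B] by blast
  obtain C m where C: "\<And>t. t \<in> I \<Longrightarrow> growth_bound L C m (b t)" using b unfolding bounded_growth_def by blast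
  have "C \<ge> 0" using False C growth_bound_nonneg by blast
  moreover have "snorm L (bmult B (b t) \<phi>) \<le> 2 ^ L * (C * K) * snorm (L + m) \<phi>" if "t \<in> I" for t \<phi>
    by (rule K(2)[OF C[OF that]]) (rule Rep_bmult[OF B slow_growth_bounded_growth[OF b that]])
  ultimately show ?thesis using K(1) by (intro exI[of _ "2 ^ L * (C * K)"]) auto
qed (auto intro: exI[of _ 0])

lemma continuous_on_bmult:
  assumes B: "bounded_bilinear B" and b: "slow_growth b"
  shows "continuous_on UNIV (bmult B b)"
proof (rule continuous_on_schwartz_op)
  show "bmult B b (f - g) = bmult B b f - bmult B b g" for f g
    by (rule linear_diff[OF linear_bmult[OF assms]])
  have "bounded_growth (\<lambda>_::unit. b) UNIV" using b unfolding slow_growth_def bounded_growth_def by blast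
  from snorm_bmult_family[OF B this]
  show "\<exists>k C. \<forall>f. snorm m (bmult B b f) \<le> C * snorm k f" for m by blast
qed

lemma vn_bounded_bmult_family:
  assumes B: "bounded_bilinear B" and b: "bounded_growth b I" and V: "vn_bounded V"
  shows "vn_bounded (\<Union>t\<in>I. bmult B (b t) ` V)"
  unfolding vn_bounded_schwartz_iff
proof
  fix L
  obtain C k where C: "C \<ge> 0" "\<And>t \<phi>. t \<in> I \<Longrightarrow> snorm L (bmult B (b t) \<phi>) \<le> C * snorm k \<phi>"
    using snorm_bmult_family[OF B b] by metis
  obtain A where A: "\<And>\<phi>. \<phi> \<in> V \<Longrightarrow> snorm k \<phi> \<le> A" using V unfolding vn_bounded_schwartz_iff by blast
  have "snorm L (bmult B (b t) \<phi>) \<le> C * A" if "t \<in> I" "\<phi> \<in> V" for t \<phi>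
    using C(2)[OF that(1), of \<phi>] mult_left_mono[OF A[OF that(2)] C(1)] by linarith
  then show "\<exists>A. \<forall>f\<in>\<Union>t\<in>I. bmult B (b t) ` V. snorm L f \<le> A" by blast
qed

lemma snorm_bmult_Lipschitz:
  fixes B :: "'a::real_normed_vector \<Rightarrow> 'b::real_normed_vector \<Rightarrow> 'c::real_normed_vector" and b :: "real \<Rightarrow> real ^ 'n::finite \<Rightarrow> 'a"
  assumes B: "bounded_bilinear B" and b: "Lipschitz_multipliers b T" "bounded_growth b {0..T}"
  shows "\<exists>C k. C \<ge> 0 \<and> (\<forall>s\<in>{0..T}. \<forall>t\<in>{0..T}. \<forall>\<phi>. snorm L (bmult B (b s) \<phi> - bmult B (b t) \<phi>) \<le> C * \<bar>s - t\<bar> * snorm k \<phi>)"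
proof -
  obtain K where K: "K \<ge> 0" "\<And>L C m (b :: real ^ 'n \<Rightarrow> 'a) (\<phi> :: ('n, 'b) schwartz) (g :: ('n, 'c) schwartz). growth_bound L C m b \<Longrightarrow> Rep_schwartz g = (\<lambda>x. B (b x) (Rep_schwartz \<phi> x)) \<Longrightarrow>
    snorm L g \<le> 2 ^ L * (C * K) * snorm (L + m) \<phi>" using snorm_bmult[OF B] by blast
  obtain C m where C: "\<And>s t. s \<in> {0..T} \<Longrightarrow> t \<in> {0..T} \<Longrightarrow> growth_bound L (C * \<bar>s - t\<bar>) m (\<lambda>x. b s x - b t x)"
    using b(1) unfolding Lipschitz_multipliers_def by blast
  have "snorm L (bmult B (b s) \<phi> - bmult B (b t) \<phi>) \<le> (2 ^ L * (\<bar>C\<bar> * K)) * \<bar>s - t\<bar> * snorm (L + m) \<phi>"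
    if st: "s \<in> {0..T}" "t \<in> {0..T}" for s t \<phi>
  proof -
    have "snorm L (bmult B (b s) \<phi> - bmult B (b t) \<phi>) \<le> 2 ^ L * ((C * \<bar>s - t\<bar>) * K) * snorm (L + m) \<phi>"
    proof (rule K(2)[OF C[OF st]], rule ext)
      show "Rep_schwartz (bmult B (b s) \<phi> - bmult B (b t) \<phi>) x = B (b s x - b t x) (Rep_schwartz \<phi> x)" for x
        by (simp add: Rep_schwartz_diff Rep_bmult[OF B slow_growth_bounded_growth[OF b(2) st(1)]]
            Rep_bmult[OF B slow_growth_bounded_growth[OF b(2) st(2)]] bounded_bilinear.diff_left[OF B])
    qed
    also have "\<dots> \<le> 2 ^ L * ((\<bar>C\<bar> * \<bar>s - t\<bar>) * K) * snorm (L + m) \<phi>"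
      using K(1) by (intro mult_right_mono mult_left_mono snorm_nonneg) auto
    finally show ?thesis by (simp add: mult_ac)
  qed
  moreover have "2 ^ L * (\<bar>C\<bar> * K) \<ge> 0" using K(1) by simp
  ultimately show ?thesis by blast
qed

lemma snorm_bmult_Taylor:
  fixes B :: "'a::real_normed_vector \<Rightarrow> 'b::real_normed_vector \<Rightarrow> 'c::real_normed_vector" and b :: "real \<Rightarrow> real ^ 'n::finite \<Rightarrow> 'a"
  assumes B: "bounded_bilinear B" and b: "Taylor_multipliers b b' T" "bounded_growth b {0..T}" "bounded_growth b' {0..T}"
  shows "\<exists>C k. C \<ge> 0 \<and> (\<forall>s\<in>{0..T}. \<forall>t\<in>{0..T}. s \<noteq> t \<longrightarrow> (\<forall>\<phi>.
    snorm L ((bmult B (b s) \<phi> - bmult B (b t) \<phi>) /\<^sub>R (s - t) - bmult B (b' t) \<phi>) \<le> C * \<bar>s - t\<bar> * snorm k \<phi>))"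
proof -
  obtain K where K: "K \<ge> 0" "\<And>L C m (b :: real ^ 'n \<Rightarrow> 'a) (\<phi> :: ('n, 'b) schwartz) (g :: ('n, 'c) schwartz). growth_bound L C m b \<Longrightarrow> Rep_schwartz g = (\<lambda>x. B (b x) (Rep_schwartz \<phi> x)) \<Longrightarrow>
    snorm L g \<le> 2 ^ L * (C * K) * snorm (L + m) \<phi>" using snorm_bmult[OF B] by blast
  obtain C m where C: "\<And>s t. s \<in> {0..T} \<Longrightarrow> t \<in> {0..T} \<Longrightarrow> growth_bound L (C * \<bar>s - t\<bar>\<^sup>2) m (\<lambda>x. b s x - b t x - (s - t) *\<^sub>R b' t x)"
    using b(1) unfolding Taylor_multipliers_def by blast
  have "snorm L ((bmult B (b s) \<phi> - bmult B (b t) \<phi>) /\<^sub>R (s - t) - bmult B (b' t) \<phi>) \<le> (2 ^ L * (\<bar>C\<bar> * K)) * \<bar>s - t\<bar> * snorm (L + m) \<phi>"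
    if st: "s \<in> {0..T}" "t \<in> {0..T}" "s \<noteq> t" for s t \<phi>
  proof -
    let ?g = "bmult B (b s) \<phi> - bmult B (b t) \<phi> - (s - t) *\<^sub>R bmult B (b' t) \<phi>"
    have "snorm L ?g \<le> 2 ^ L * ((C * \<bar>s - t\<bar>\<^sup>2) * K) * snorm (L + m) \<phi>"
    proof (rule K(2)[OF C[OF st(1,2)]], rule ext)
      show "Rep_schwartz ?g x = B (b s x - b t x - (s - t) *\<^sub>R b' t x) (Rep_schwartz \<phi> x)" for x
        by (simp add: Rep_schwartz_diff scaleR_schwartz.rep_eq Rep_bmult[OF B slow_growth_bounded_growth[OF b(2) st(1)]]
            Rep_bmult[OF B slow_growth_bounded_growth[OF b(2) st(2)]]
            Rep_bmult[OF B slow_growth_bounded_growth[OF b(3) st(2)]] bounded_bilinear.diff_left[OF B] bounded_bilinear.scaleR_left[OF B])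
    qed
    also have "\<dots> \<le> 2 ^ L * ((\<bar>C\<bar> * \<bar>s - t\<bar>\<^sup>2) * K) * snorm (L + m) \<phi>"
      using K(1) by (intro mult_right_mono mult_left_mono snorm_nonneg) auto
    finally have g: "snorm L ?g \<le> \<bar>s - t\<bar> * ((2 ^ L * (\<bar>C\<bar> * K)) * \<bar>s - t\<bar> * snorm (L + m) \<phi>)"
      by (simp add: power2_eq_square mult_ac)
    have "(bmult B (b s) \<phi> - bmult B (b t) \<phi>) /\<^sub>R (s - t) - bmult B (b' t) \<phi> = inverse (s - t) *\<^sub>R ?g"
      using st(3) by (simp add: scaleR_diff_right)
    then have "snorm L ((bmult B (b s) \<phi> - bmult B (b t) \<phi>) /\<^sub>R (s - t) - bmult B (b' t) \<phi>) = inverse \<bar>s - t\<bar> * snorm L ?g"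
      by (simp only: snorm_scaleR abs_inverse)
    also have "\<dots> \<le> inverse \<bar>s - t\<bar> * (\<bar>s - t\<bar> * ((2 ^ L * (\<bar>C\<bar> * K)) * \<bar>s - t\<bar> * snorm (L + m) \<phi>))"
      by (intro mult_left_mono g) simp
    also have "\<dots> = (2 ^ L * (\<bar>C\<bar> * K)) * \<bar>s - t\<bar> * snorm (L + m) \<phi>"
      using st(3) by (simp add: mult.assoc[symmetric])
    finally show ?thesis .
  qed
  moreover have "2 ^ L * (\<bar>C\<bar> * K) \<ge> 0" using K(1) by simp
  ultimately show ?thesis by blast
qed

lemma eventually_within_nonneg:
  "\<forall>\<^sub>F s in at t within {0..}. s \<in> {0..\<bar>t\<bar> + 1} \<and> s \<noteq> t" for t :: real
  unfolding eventually_at by (intro exI[of _ 1]) (auto simp: dist_real_def)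

lemma tendsto_abs_diff: "((\<lambda>s. C * \<bar>s - t\<bar> * A) \<longlongrightarrow> 0) (at t within S)" for t :: real
  by (auto intro!: tendsto_eq_intros)

lemma has_tvs_derivative_bmult:
  assumes B: "bounded_bilinear B" and b: "C1_multipliers b b'" and t: "t \<ge> 0"
  shows "has_tvs_derivative (\<lambda>t. bmult B (b t) \<phi>) (bmult B (b' t) \<phi>) t {0..}"
  unfolding has_tvs_derivative_def
proof (rule tendsto_schwartzI)
  fix m
  obtain C k where C: "\<And>s r \<phi>. s \<in> {0..\<bar>t\<bar> + 1} \<Longrightarrow> r \<in> {0..\<bar>t\<bar> + 1} \<Longrightarrow> s \<noteq> r \<Longrightarrow>
      snorm m ((bmult B (b s) \<phi> - bmult B (b r) \<phi>) /\<^sub>R (s - r) - bmult B (b' r) \<phi>) \<le> C * \<bar>s - r\<bar> * snorm k \<phi>"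
    using snorm_bmult_Taylor[OF B, of b b' "\<bar>t\<bar> + 1" m] b unfolding C1_multipliers_def by metis
  have "\<forall>\<^sub>F s in at t within {0..}. snorm m ((bmult B (b s) \<phi> - bmult B (b t) \<phi>) /\<^sub>R (s - t) - bmult B (b' t) \<phi>) \<le> C * \<bar>s - t\<bar> * snorm k \<phi>"
    using eventually_within_nonneg by eventually_elim (use C t in auto)
  then show "\<exists>g. (\<forall>\<^sub>F s in at t within {0..}. snorm m ((bmult B (b s) \<phi> - bmult B (b t) \<phi>) /\<^sub>R (s - t) - bmult B (b' t) \<phi>) \<le> g s) \<and>
      (g \<longlongrightarrow> 0) (at t within {0..})"
    by (intro exI[of _ "\<lambda>s. C * \<bar>s - t\<bar> * snorm k \<phi>"] conjI tendsto_abs_diff)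
qed

lemma continuous_on_bmult_family:
  assumes B: "bounded_bilinear B" and b: "\<And>T. Lipschitz_multipliers b T" "\<And>T. bounded_growth b {0..T}"
  shows "continuous_on {0..} (\<lambda>t. bmult B (b t) \<phi>)"
  unfolding continuous_on_def
proof (intro ballI tendsto_schwartzI)
  fix t :: real and m assume t: "t \<in> {0..}"
  obtain C k where C: "\<And>s r \<phi>. s \<in> {0..\<bar>t\<bar> + 1} \<Longrightarrow> r \<in> {0..\<bar>t\<bar> + 1} \<Longrightarrow>
      snorm m (bmult B (b s) \<phi> - bmult B (b r) \<phi>) \<le> C * \<bar>s - r\<bar> * snorm k \<phi>"
    using snorm_bmult_Lipschitz[OF B b(1) b(2), of "\<bar>t\<bar> + 1" m] by metis
  have "\<forall>\<^sub>F s in at t within {0..}. snorm m (bmult B (b s) \<phi> - bmult B (b t) \<phi>) \<le> C * \<bar>s - t\<bar> * snorm k \<phi>"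
    using eventually_within_nonneg by eventually_elim (use C t in auto)
  then show "\<exists>g. (\<forall>\<^sub>F s in at t within {0..}. snorm m (bmult B (b s) \<phi> - bmult B (b t) \<phi>) \<le> g s) \<and>
      (g \<longlongrightarrow> 0) (at t within {0..})"
    by (intro exI[of _ "\<lambda>s. C * \<bar>s - t\<bar> * snorm k \<phi>"] conjI tendsto_abs_diff)
qed

section \<open>The Cauchy problem for multiplication operators\<close>

lemma has_vector_derivative_quotientI:
  fixes f :: "real \<Rightarrow> 'a::real_normed_vector"
  assumes "((\<lambda>r. (f r - f s) /\<^sub>R (r - s)) \<longlongrightarrow> l) (at s within S)"
  shows "(f has_vector_derivative l) (at s within S)"
proof -
  have "((\<lambda>r. norm ((f r - f s) /\<^sub>R (r - s) - l)) \<longlongrightarrow> 0) (at s within S)"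
    using tendsto_norm_zero[OF LIM_zero[OF assms]] .
  moreover have "\<forall>\<^sub>F r in at s within S. norm ((f r - f s) /\<^sub>R (r - s) - l) = norm (f r - f s - (r - s) *\<^sub>R l) / norm (r - s)"
    unfolding eventually_at_filter
  proof (intro always_eventually allI impI)
    fix r assume "r \<noteq> s"
    then have "(f r - f s) /\<^sub>R (r - s) - l = (f r - f s - (r - s) *\<^sub>R l) /\<^sub>R (r - s)"
      by (simp add: scaleR_diff_right)
    then show "norm ((f r - f s) /\<^sub>R (r - s) - l) = norm (f r - f s - (r - s) *\<^sub>R l) / norm (r - s)"
      by (simp add: divide_inverse mult.commute)
  qed
  ultimately have "((\<lambda>r. norm (f r - f s - (r - s) *\<^sub>R l) / norm (r - s)) \<longlongrightarrow> 0) (at s within S)"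
    by (rule Lim_transform_eventually)
  then show ?thesis
    unfolding has_vector_derivative_def has_derivative_iff_norm
    by (auto intro: bounded_linear_scaleR_left)
qed

lemma has_tvs_derivative_mono: "has_tvs_derivative u d t S \<Longrightarrow> S' \<subseteq> S \<Longrightarrow> has_tvs_derivative u d t S'"
  unfolding has_tvs_derivative_def by (rule tendsto_within_subset)

text \<open>The equation holds for positive times only, so the exceptional point \<open>0\<close> has to be admitted here.\<close>

lemma constant_of_zero_derivative:
  fixes Z :: "real \<Rightarrow> 'a::banach"
  assumes d: "\<And>s. s \<in> {0..t} \<Longrightarrow> (Z has_vector_derivative Z' s) (at s within {0..t})"
    and z: "\<And>s. 0 < s \<Longrightarrow> s \<le> t \<Longrightarrow> Z' s = 0" and t: "0 \<le> t"
  shows "Z t = Z 0"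
proof (rule has_derivative_zero_unique_strong_interval[where k = "{0}" and a = 0 and b = t])
  show "continuous_on {0..t} Z"
    using d by (intro continuous_on_vector_derivative) auto
  show "(Z has_derivative (\<lambda>h. 0)) (at s within {0..t})" if "s \<in> {0..t} - {0}" for s
    using d[of s] z[of s] that by (auto simp: has_vector_derivative_def)
qed (use t in auto)

subsection \<open>Schwartz functions\<close>

lemma tendsto_schwartz_eval:
  assumes "(f \<longlongrightarrow> l) F"
  shows "((\<lambda>r. Rep_schwartz (f r) x) \<longlongrightarrow> Rep_schwartz l x) F"
proof -
  have t: "((\<lambda>r. snorm 0 (f r - l)) \<longlongrightarrow> 0) F"
    using assms by (simp add: tendsto_schwartz_iff)
  have le: "norm (Rep_schwartz (f r) x - Rep_schwartz l x) \<le> snorm 0 (f r - l)" for r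
    using norm_le_snorm[of "[]" "f r - l" x] by (simp add: Rep_schwartz_diff)
  have "\<forall>\<^sub>F r in F. norm (Rep_schwartz (f r) x - Rep_schwartz l x) \<le> snorm 0 (f r - l)"
    by (intro always_eventually allI le)
  from Lim_null_comparison[OF this t] show ?thesis by (rule LIM_zero_cancel)
qed

lemma mult_schwartz_comp:
  fixes a b :: "real ^ 'n::finite \<Rightarrow> complex ^ 'N::finite ^ 'N"
  assumes "slow_growth a" "slow_growth b"
  shows "mult_schwartz a (mult_schwartz b \<phi>) = mult_schwartz (\<lambda>x. a x ** b x) \<phi>"
  unfolding mult_schwartz_bmult
  by (rule Rep_schwartz_eqI)
    (simp add: Rep_bmult[OF bounded_bilinear_matrix_vector_mult] assms
      slow_growth_bilinear[OF bounded_bilinear_matrix_mult] matrix_vector_mul_assoc)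

lemma mult_schwartz_one: "mult_schwartz (\<lambda>x. mat 1) \<phi> = \<phi>"
  unfolding mult_schwartz_bmult
  by (rule Rep_schwartz_eqI) (simp add: Rep_bmult[OF bounded_bilinear_matrix_vector_mult slow_growth_const])

lemma clinear_mult_schwartz:
  fixes b :: "real ^ 'n::finite \<Rightarrow> complex ^ 'N::finite ^ 'N"
  assumes "slow_growth b"
  shows "clinear (mult_schwartz b)"
  unfolding clinear_iff mult_schwartz_bmult
proof (intro conjI allI)
  show "bmult (*v) b (c *\<^sub>C \<phi>) = c *\<^sub>C bmult (*v) b \<phi>" for c \<phi>
    by (rule Rep_schwartz_eqI)
      (simp add: Rep_bmult[OF bounded_bilinear_matrix_vector_mult assms] scaleC_schwartz.rep_eq
        vec_eq_iff matrix_vector_mult_def scaleC_vec_def scaleC_complex_def sum_distrib_left mult_ac)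
qed (rule bmult_add[OF bounded_bilinear_matrix_vector_mult assms])

text \<open>The hypotheses on the symbol enter only through this package of properties of its exponential.\<close>

locale exponential_multipliers =
  fixes a :: "real ^ 'n::finite \<Rightarrow> complex ^ 'N::finite ^ 'N" and E :: "real \<Rightarrow> real ^ 'n \<Rightarrow> complex ^ 'N ^ 'N"
  assumes a: "slow_growth a"
    and E: "C1_multipliers E (\<lambda>t x. a x ** E t x)"
    and E_zero: "E 0 = (\<lambda>x. mat 1)"
    and E_add: "E (s + t) x = E s x ** E t x"
    and E_commute: "a x ** E t x = E t x ** a x"
    and E_deriv: "((\<lambda>t. E t x) has_vector_derivative a x ** E t x) (at t)"
begin

lemma slow_E: "t \<ge> 0 \<Longrightarrow> slow_growth (E t)" and slow_aE: "t \<ge> 0 \<Longrightarrow> slow_growth (\<lambda>x. a x ** E t x)"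
  using C1_multipliers_slow_growth[OF E] by auto

lemma schwartz_solution: "cauchy_solution (mult_schwartz a) \<phi> (\<lambda>t. mult_schwartz (E t) \<phi>)"
  unfolding cauchy_solution_def
proof (intro conjI exI[of _ "\<lambda>t. mult_schwartz (\<lambda>x. a x ** E t x) \<phi>"] allI impI)
  show "has_tvs_derivative (\<lambda>t. mult_schwartz (E t) \<phi>) (mult_schwartz (\<lambda>x. a x ** E t x) \<phi>) t {0..}" if "0 \<le> t" for t
    unfolding mult_schwartz_bmult by (rule has_tvs_derivative_bmult[OF bounded_bilinear_matrix_vector_mult E that])
  show "continuous_on {0..} (\<lambda>t. mult_schwartz (\<lambda>x. a x ** E t x) \<phi>)"
    unfolding mult_schwartz_bmult
    using E by (intro continuous_on_bmult_family[OF bounded_bilinear_matrix_vector_mult]) (auto simp: C1_multipliers_def)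
  show "mult_schwartz (\<lambda>x. a x ** E t x) \<phi> - mult_schwartz a (mult_schwartz (E t) \<phi>) = 0" if "0 < t" for t
    using that by (simp add: mult_schwartz_comp a slow_E)
  show "mult_schwartz (E 0) \<phi> = \<phi>" by (simp add: E_zero mult_schwartz_one)
qed

lemma E_reverse_deriv: "((\<lambda>s. E (t - s) x) has_vector_derivative - (a x ** E (t - s) x)) (at s within S)"
proof -
  have "((\<lambda>s. t - s) has_vector_derivative - 1) (at s)"
    by (auto intro!: derivative_eq_intros)
  from vector_diff_chain_at[OF this E_deriv] show ?thesis
    by (simp add: o_def has_vector_derivative_at_within)
qed

text \<open>Evaluation at a point is continuous on the Schwartz space, so a solution satisfies a linear system of
  ordinary differential equations at each point.\<close>

lemma schwartz_unique:
  assumes v: "cauchy_solution (mult_schwartz a) \<phi> v" and t: "t \<ge> 0"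
  shows "v t = mult_schwartz (E t) \<phi>"
proof (rule Rep_schwartz_eqI)
  fix x
  obtain v' where v': "\<And>t. t \<ge> 0 \<Longrightarrow> has_tvs_derivative v (v' t) t {0..}" "\<And>t. t > 0 \<Longrightarrow> v' t = mult_schwartz a (v t)"
    and v0: "v 0 = \<phi>" using v unfolding cauchy_solution_def by auto
  \<comment> \<open>evaluation at \<open>x\<close> turns the equation into a linear system, solved by variation of constants\<close>
  define y where "y s = Rep_schwartz (v s) x" for s
  have y: "(y has_vector_derivative Rep_schwartz (v' s) x) (at s within {0..t})" if s: "s \<in> {0..t}" for s
  proof (rule has_vector_derivative_quotientI)
    have "has_tvs_derivative v (v' s) s {0..t}"
      using s by (intro has_tvs_derivative_mono[OF v'(1)]) auto
    from tendsto_schwartz_eval[OF this[unfolded has_tvs_derivative_def], of x]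
    show "((\<lambda>r. (y r - y s) /\<^sub>R (r - s)) \<longlongrightarrow> Rep_schwartz (v' s) x) (at s within {0..t})"
      by (simp add: y_def Rep_schwartz_diff scaleR_schwartz.rep_eq)
  qed
  define Z where "Z s = E (t - s) x *v y s" for s
  define Z' where "Z' s = E (t - s) x *v Rep_schwartz (v' s) x + (- (a x ** E (t - s) x)) *v y s" for s
  have "Z t = Z 0"
  proof (rule constant_of_zero_derivative[where Z = Z and Z' = Z', OF _ _ t])
    show "(Z has_vector_derivative Z' s) (at s within {0..t})" if "s \<in> {0..t}" for s
      unfolding Z_def[abs_def] Z'_def
      by (rule bounded_bilinear.has_vector_derivative[OF bounded_bilinear_matrix_vector_mult E_reverse_deriv y[OF that]])
    show "Z' s = 0" if "0 < s" "s \<le> t" for s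
    proof -
      have "Rep_schwartz (v' s) x = a x *v y s"
        unfolding v'(2)[OF that(1)] mult_schwartz_bmult Rep_bmult[OF bounded_bilinear_matrix_vector_mult a] y_def ..
      then show ?thesis
        by (simp add: Z'_def matrix_vector_mul_assoc E_commute bounded_bilinear.minus_left[OF bounded_bilinear_matrix_vector_mult])
    qed
  qed
  then have "y t = E t x *v y 0" by (simp add: Z_def E_zero)
  then show "Rep_schwartz (v t) x = Rep_schwartz (mult_schwartz (E t) \<phi>) x"
    unfolding mult_schwartz_bmult Rep_bmult[OF bounded_bilinear_matrix_vector_mult slow_E[OF t]] by (simp add: y_def v0)
qed

lemma schwartz_semigroup: "loc_unif_bounded_semigroup (\<lambda>t. mult_schwartz (E t))"
  unfolding loc_unif_bounded_semigroup_def
proof (intro conjI allI impI)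
  show "clinear (mult_schwartz (E t))" "continuous_on UNIV (mult_schwartz (E t))" if "0 \<le> t" for t
    using clinear_mult_schwartz[OF slow_E[OF that]]
      continuous_on_bmult[OF bounded_bilinear_matrix_vector_mult slow_E[OF that]] by (simp_all add: mult_schwartz_bmult)
  show "mult_schwartz (E 0) = id" by (simp add: fun_eq_iff E_zero mult_schwartz_one)
  show "mult_schwartz (E (t + s)) = mult_schwartz (E t) \<circ> mult_schwartz (E s)" if "0 \<le> t" "0 \<le> s" for t s
  proof -
    have add: "E (t + s) = (\<lambda>x. E t x ** E s x)" by (rule ext) (rule E_add)
    show ?thesis
      unfolding add using that by (simp add: fun_eq_iff mult_schwartz_comp slow_E)
  qed
  show "bounded_operators ((\<lambda>t. mult_schwartz (E t)) ` {0..T})" for T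
    unfolding bounded_operators_def mult_schwartz_bmult
    using vn_bounded_bmult_family[OF bounded_bilinear_matrix_vector_mult, of E "{0..T}"] E
    by (auto simp: C1_multipliers_def)
qed

end

subsection \<open>Tempered distributions\<close>

definition entry :: "'j \<Rightarrow> 'k \<Rightarrow> ('x \<Rightarrow> 'a ^ 'k ^ 'j) \<Rightarrow> 'x \<Rightarrow> 'a" where
  "entry j k b x = b x $ j $ k"

lemma bounded_linear_entry: "bounded_linear (\<lambda>M :: 'a::real_normed_vector ^ 'k::finite ^ 'j::finite. M $ j $ k)"
  by (rule bounded_linear_compose[OF bounded_linear_vec_nth bounded_linear_vec_nth])

lemma slow_growth_entry: "slow_growth b \<Longrightarrow> slow_growth (entry j k b)"
  for b :: "real ^ 'n::finite \<Rightarrow> complex ^ 'N::finite ^ 'N"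
  unfolding entry_def by (rule slow_growth_linear[OF bounded_linear_entry])

lemma bounded_growth_entry: "bounded_growth b I \<Longrightarrow> bounded_growth (\<lambda>t. entry j k (b t)) I"
  for b :: "'i \<Rightarrow> real ^ 'n::finite \<Rightarrow> complex ^ 'N::finite ^ 'N"
  unfolding entry_def by (rule bounded_growth_linear[OF bounded_linear_entry])

lemma C1_multipliers_entry: "C1_multipliers b b' \<Longrightarrow> C1_multipliers (\<lambda>t. entry j k (b t)) (\<lambda>t. entry j k (b' t))"
  for b :: "real \<Rightarrow> real ^ 'n::finite \<Rightarrow> complex ^ 'N::finite ^ 'N"
  unfolding entry_def by (rule C1_multipliers_linear[OF bounded_linear_entry])

lemma Rep_mult_test: "slow_growth b \<Longrightarrow> Rep_schwartz (mult_test b \<phi>) = (\<lambda>x. b x * Rep_schwartz \<phi> x)"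
  unfolding mult_test_bmult by (rule Rep_bmult[OF bounded_bilinear_mult])

lemma mult_test_add: "slow_growth b \<Longrightarrow> mult_test b (\<phi> + \<psi>) = mult_test b \<phi> + mult_test b \<psi>"
  unfolding mult_test_bmult by (rule bmult_add[OF bounded_bilinear_mult])

lemma mult_test_scaleC: "slow_growth b \<Longrightarrow> mult_test b (c *\<^sub>C \<phi>) = c *\<^sub>C mult_test b \<phi>"
  by (rule Rep_schwartz_eqI) (simp add: Rep_mult_test scaleC_schwartz.rep_eq scaleC_complex_def)

lemma Rep_mult_tempered:
  fixes b :: "real ^ 'n::finite \<Rightarrow> complex ^ 'N::finite ^ 'N"
  assumes b: "slow_growth b"
  shows "Rep_tempered (mult_tempered b u) \<phi> = (\<chi> j. \<Sum>k\<in>UNIV. Rep_tempered u (mult_test (entry j k b) \<phi>) $ k)"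
proof -
  let ?f = "\<lambda>\<phi>. \<chi> j. \<Sum>k\<in>UNIV. Rep_tempered u (mult_test (entry j k b) \<phi>) $ k"
  have "clinear ?f"
    by (simp add: clinear_iff vec_eq_iff mult_test_add mult_test_scaleC slow_growth_entry b Rep_tempered_add
        Rep_tempered_scaleC scaleC_vec_def scaleC_complex_def sum.distrib sum_distrib_left)
  moreover have "continuous_on UNIV ?f"
  proof (intro continuous_on_vec_lambda continuous_on_sum continuous_on_component)
    fix j k
    have "continuous_on UNIV (mult_test (entry j k b))"
      unfolding mult_test_bmult by (rule continuous_on_bmult[OF bounded_bilinear_mult slow_growth_entry[OF b]])
    then show "continuous_on UNIV (\<lambda>\<phi>. Rep_tempered u (mult_test (entry j k b) \<phi>))"
      by (rule continuous_on_compose2[OF continuous_on_Rep_tempered]) simp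
  qed
  ultimately have "Rep_tempered (Abs_tempered ?f) = ?f"
    by (intro Abs_tempered_inverse) simp
  then show ?thesis
    by (simp add: mult_tempered_def entry_def[abs_def])
qed

lemma norm_vec_le_sum: "norm (x :: 'a::real_normed_vector ^ 'n::finite) \<le> (\<Sum>j\<in>UNIV. norm (x $ j))"
  unfolding norm_vec_def by (rule L2_set_le_sum) simp

lemma norm_matrix_action_le:
  fixes f :: "'N::finite \<Rightarrow> 'N \<Rightarrow> complex ^ 'N"
  shows "norm (\<chi> j. \<Sum>k\<in>UNIV. f j k $ k) \<le> (\<Sum>j\<in>UNIV. \<Sum>k\<in>UNIV. norm (f j k))"
proof -
  have "norm (\<chi> j. \<Sum>k\<in>UNIV. f j k $ k) \<le> (\<Sum>j\<in>UNIV. norm (\<Sum>k\<in>UNIV. f j k $ k))"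
    using norm_vec_le_sum[of "\<chi> j. \<Sum>k\<in>UNIV. f j k $ k"] by simp
  also have "\<dots> \<le> (\<Sum>j\<in>UNIV. \<Sum>k\<in>UNIV. norm (f j k))"
    by (intro sum_mono sum_norm_le Finite_Cartesian_Product.norm_nth_le)
  finally show ?thesis .
qed

lemma Rep_tempered_eqI: "(\<And>\<phi>. Rep_tempered u \<phi> = Rep_tempered v \<phi>) \<Longrightarrow> u = v"
  by (metis Rep_tempered_inject ext)

lemma clinear_mult_tempered:
  fixes b :: "real ^ 'n::finite \<Rightarrow> complex ^ 'N::finite ^ 'N"
  assumes "slow_growth b"
  shows "clinear (mult_tempered b)"
  unfolding clinear_iff
  by (auto intro!: Rep_tempered_eqI simp: Rep_mult_tempered[OF assms] plus_tempered.rep_eq scaleC_tempered.rep_eq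
      vec_eq_iff scaleC_vec_def scaleC_complex_def sum.distrib sum_distrib_left)

lemma Rep_schwartz_sum: "Rep_schwartz (\<Sum>i\<in>A. f i) x = (\<Sum>i\<in>A. Rep_schwartz (f i) x)"
  by (induction A rule: infinite_finite_induct) (simp_all add: plus_schwartz.rep_eq zero_schwartz.rep_eq)

text \<open>The entries of the two matrices act on the test function one after the other, and their sum over the middle index is an
  entry of the product.\<close>

lemma mult_tempered_comp:
  fixes b c :: "real ^ 'n::finite \<Rightarrow> complex ^ 'N::finite ^ 'N"
  assumes b: "slow_growth b" and c: "slow_growth c"
  shows "mult_tempered b (mult_tempered c u) = mult_tempered (\<lambda>x. b x ** c x) u"
proof (rule Rep_tempered_eqI)
  fix \<phi>
  have bc: "slow_growth (\<lambda>x. b x ** c x)" by (rule slow_growth_bilinear[OF bounded_bilinear_matrix_mult b c])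
  have e: "slow_growth (entry j k b)" "slow_growth (entry j k c)" "slow_growth (entry j k (\<lambda>x. b x ** c x))" for j k
    using b c bc by (simp_all add: slow_growth_entry)
  have "mult_test (entry j l (\<lambda>x. b x ** c x)) \<phi> = (\<Sum>k\<in>UNIV. mult_test (entry k l c) (mult_test (entry j k b) \<phi>))" for j l
    by (rule Rep_schwartz_eqI)
      (simp only: Rep_mult_test[OF e(1)] Rep_mult_test[OF e(2)] Rep_mult_test[OF e(3)] Rep_schwartz_sum,
       simp add: entry_def matrix_matrix_mult_def sum_distrib_left sum_distrib_right mult_ac)
  then have "(\<Sum>l\<in>UNIV. Rep_tempered u (mult_test (entry j l (\<lambda>x. b x ** c x)) \<phi>) $ l) =
      (\<Sum>l\<in>UNIV. \<Sum>k\<in>UNIV. Rep_tempered u (mult_test (entry k l c) (mult_test (entry j k b) \<phi>)) $ l)" for j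
    by (simp add: linear_sum[OF linear_Rep_tempered])
  moreover have "(\<Sum>l\<in>UNIV. \<Sum>k\<in>UNIV. Rep_tempered u (mult_test (entry k l c) (mult_test (entry j k b) \<phi>)) $ l) = (\<Sum>k\<in>UNIV. \<Sum>l\<in>UNIV. Rep_tempered u (mult_test (entry k l c) (mult_test (entry j k b) \<phi>)) $ l)" for j
    by (rule sum.swap)
  ultimately show "Rep_tempered (mult_tempered b (mult_tempered c u)) \<phi> = Rep_tempered (mult_tempered (\<lambda>x. b x ** c x) u) \<phi>"
    by (simp add: Rep_mult_tempered[OF b] Rep_mult_tempered[OF c] Rep_mult_tempered[OF bc])
qed

lemma mult_tempered_one:
  fixes u :: "('n::finite, 'N::finite) tempered"
  shows "mult_tempered (\<lambda>x. mat 1) u = u"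
proof (rule Rep_tempered_eqI)
  fix \<phi> :: "('n, complex) schwartz"
  have one: "mult_test (entry j k (\<lambda>x. mat 1)) \<phi> = (if j = k then \<phi> else 0)" for j k :: 'N
    by (rule Rep_schwartz_eqI)
      (simp only: Rep_mult_test[OF slow_growth_entry[OF slow_growth_const]],
       simp add: entry_def mat_def zero_schwartz.rep_eq)
  have "Rep_tempered u (mult_test (entry j k (\<lambda>x. mat 1)) \<phi>) $ k = (if j = k then Rep_tempered u \<phi> $ k else 0)" for j k :: 'N
    unfolding one by (simp add: linear_0[OF linear_Rep_tempered])
  then show "Rep_tempered (mult_tempered (\<lambda>x. mat 1) u) \<phi> = Rep_tempered u \<phi>"
    by (simp add: Rep_mult_tempered slow_growth_const vec_eq_iff)
qed

lemma vn_bounded_subset: "vn_bounded B \<Longrightarrow> A \<subseteq> B \<Longrightarrow> vn_bounded A"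
  unfolding vn_bounded_def by (meson order_trans)

lemma vn_bounded_UN: "finite I \<Longrightarrow> (\<And>i. i \<in> I \<Longrightarrow> vn_bounded (B i)) \<Longrightarrow> vn_bounded (\<Union>i\<in>I. B i)"
  by (induction I rule: finite_induct) (auto intro: vn_bounded_empty vn_bounded_Un)

text \<open>The finitely many entries of all members of the family map \<open>B\<close> into one bounded set of test functions.\<close>

lemma dual_controlled_mult_tempered:
  fixes b :: "'i \<Rightarrow> real ^ 'n::finite \<Rightarrow> complex ^ 'N::finite ^ 'N"
  assumes b: "bounded_growth b I"
  shows "dual_controlled ((\<lambda>t. mult_tempered (b t)) ` I)"
  unfolding dual_controlled_def
proof (intro allI impI)
  fix B :: "('n, complex) schwartz set" assume B: "vn_bounded B"
  define B' where "B' = (\<Union>p\<in>(UNIV :: ('N \<times> 'N) set). \<Union>t\<in>I. mult_test (entry (fst p) (snd p) (b t)) ` B)"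
  have "vn_bounded B'"
    unfolding B'_def mult_test_bmult
    by (intro vn_bounded_UN vn_bounded_bmult_family[OF bounded_bilinear_mult bounded_growth_entry[OF b] B]) simp
  moreover have "norm (Rep_tempered (mult_tempered (b t) u) \<phi>) \<le> (real CARD('N) * real CARD('N)) * A"
    if t: "t \<in> I" and A: "\<forall>\<psi>\<in>B'. norm (Rep_tempered u \<psi>) \<le> A" and \<phi>: "\<phi> \<in> B" for t u A \<phi>
  proof -
    have "norm (Rep_tempered (mult_tempered (b t) u) \<phi>) \<le>
        (\<Sum>j\<in>(UNIV :: 'N set). \<Sum>k\<in>(UNIV :: 'N set). norm (Rep_tempered u (mult_test (entry j k (b t)) \<phi>)))"
      unfolding Rep_mult_tempered[OF slow_growth_bounded_growth[OF b t]] by (rule norm_matrix_action_le)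
    also have "\<dots> \<le> (\<Sum>j\<in>(UNIV :: 'N set). \<Sum>k\<in>(UNIV :: 'N set). A)"
    proof (intro sum_mono)
      fix j k :: 'N
      have "mult_test (entry j k (b t)) \<phi> \<in> B'" unfolding B'_def using t \<phi> by force
      then show "norm (Rep_tempered u (mult_test (entry j k (b t)) \<phi>)) \<le> A" using A by blast
    qed
    finally show ?thesis by simp
  qed
  ultimately show "\<exists>B' C. vn_bounded B' \<and> (\<forall>T\<in>(\<lambda>t. mult_tempered (b t)) ` I. \<forall>u A. A \<ge> 0 \<longrightarrow>
     (\<forall>\<psi>\<in>B'. norm (Rep_tempered u \<psi>) \<le> A) \<longrightarrow> (\<forall>\<phi>\<in>B. norm (Rep_tempered (T u) \<phi>) \<le> C * A))"
    by (intro exI[of _ B'] exI[of _ "real CARD('N) * real CARD('N)"]) blast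
qed

text \<open>Each entry of the matrix contributes one seminorm estimate, and on a bounded set of test functions these finitely many seminorms
  are bounded.\<close>

lemma tendsto_tempered_of_entries:
  fixes w :: "real \<Rightarrow> ('n::finite, 'N::finite) tempered" and u :: "('n, 'N) tempered"
    and \<chi>' :: "real \<Rightarrow> 'N \<Rightarrow> 'N \<Rightarrow> ('n, complex) schwartz \<Rightarrow> ('n, complex) schwartz"
  assumes w: "\<forall>\<^sub>F s in at t within {0..}. \<forall>\<phi>. Rep_tempered (w s - l) \<phi> = (\<chi> j. \<Sum>k\<in>UNIV. Rep_tempered u (\<chi>' s j k \<phi>) $ k)"
    and le: "\<And>m j k. \<exists>C q. C \<ge> 0 \<and> (\<forall>\<^sub>F s in at t within {0..}. \<forall>\<phi>. snorm m (\<chi>' s j k \<phi>) \<le> C * \<bar>s - t\<bar> * snorm q \<phi>)"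
  shows "(w \<longlongrightarrow> l) (at t within {0..})"
proof (rule tendsto_temperedI)
  fix B :: "('n, complex) schwartz set" assume B: "vn_bounded B"
  obtain C0 m where C0: "C0 \<ge> 0" "\<And>\<psi>. norm (Rep_tempered u \<psi>) \<le> C0 * snorm m \<psi>"
    using tempered_bound by blast
  define P where "P j k C q \<longleftrightarrow> C \<ge> 0 \<and> (\<forall>\<^sub>F s in at t within {0..}. \<forall>\<phi>. snorm m (\<chi>' s j k \<phi>) \<le> C * \<bar>s - t\<bar> * snorm q \<phi>)"
    for j k C q
  have "\<exists>C q. P j k C q" for j k
    unfolding P_def by (rule le)
  then obtain C q where "\<And>j k. P j k (C j k) (q j k)" by metis
  then have C: "\<And>j k. C j k \<ge> 0" "\<And>j k. \<forall>\<^sub>F s in at t within {0..}. \<forall>\<phi>. snorm m (\<chi>' s j k \<phi>) \<le> C j k * \<bar>s - t\<bar> * snorm (q j k) \<phi>"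
    unfolding P_def by blast+
  have "\<forall>k. \<exists>A. \<forall>\<phi>\<in>B. snorm k \<phi> \<le> A" using B by (simp add: vn_bounded_schwartz_iff)
  then obtain A where A: "\<And>k \<phi>. \<phi> \<in> B \<Longrightarrow> snorm k \<phi> \<le> A k" by metis
  define D where "D = (\<Sum>j\<in>UNIV. \<Sum>k\<in>UNIV. C0 * (C j k * A (q j k)))"
  have "\<forall>\<^sub>F s in at t within {0..}. \<forall>j\<in>UNIV. \<forall>k\<in>UNIV. \<forall>\<phi>. snorm m (\<chi>' s j k \<phi>) \<le> C j k * \<bar>s - t\<bar> * snorm (q j k) \<phi>"
    by (intro eventually_ball_finite ballI C(2)) auto
  with w have "\<forall>\<^sub>F s in at t within {0..}. \<forall>\<phi>\<in>B. norm (Rep_tempered (w s - l) \<phi>) \<le> D * \<bar>s - t\<bar> * 1"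
  proof eventually_elim
    case (elim s)
    show ?case
    proof
      fix \<phi> assume \<phi>: "\<phi> \<in> B"
      have "norm (Rep_tempered (w s - l) \<phi>) \<le> (\<Sum>j\<in>UNIV. \<Sum>k\<in>UNIV. norm (Rep_tempered u (\<chi>' s j k \<phi>)))"
        unfolding elim(1)[rule_format] by (rule norm_matrix_action_le)
      also have "\<dots> \<le> (\<Sum>j\<in>UNIV. \<Sum>k\<in>UNIV. C0 * (C j k * A (q j k)) * \<bar>s - t\<bar>)"
      proof (intro sum_mono)
        fix j k
        have "norm (Rep_tempered u (\<chi>' s j k \<phi>)) \<le> C0 * snorm m (\<chi>' s j k \<phi>)" by (rule C0(2))
        also have "\<dots> \<le> C0 * (C j k * \<bar>s - t\<bar> * snorm (q j k) \<phi>)"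
          using elim(2) by (intro mult_left_mono C0(1)) auto
        also have "\<dots> \<le> C0 * (C j k * \<bar>s - t\<bar> * A (q j k))"
          using C(1)[of j k] by (intro mult_left_mono C0(1) A \<phi>) auto
        finally show "norm (Rep_tempered u (\<chi>' s j k \<phi>)) \<le> C0 * (C j k * A (q j k)) * \<bar>s - t\<bar>"
          by (simp add: mult_ac)
      qed
      also have "\<dots> = D * \<bar>s - t\<bar> * 1" by (simp add: D_def sum_distrib_right)
      finally show "norm (Rep_tempered (w s - l) \<phi>) \<le> D * \<bar>s - t\<bar> * 1" .
    qed
  qed
  then show "\<exists>g. (\<forall>\<^sub>F s in at t within {0..}. \<forall>\<phi>\<in>B. norm (Rep_tempered (w s - l) \<phi>) \<le> g s) \<and> (g \<longlongrightarrow> (0::real)) (at t within {0..})"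
    by (intro exI[of _ "\<lambda>s. D * \<bar>s - t\<bar> * 1"] conjI tendsto_abs_diff)
qed

lemma has_tvs_derivative_mult_tempered:
  fixes b :: "real \<Rightarrow> real ^ 'n::finite \<Rightarrow> complex ^ 'N::finite ^ 'N"
  assumes b: "C1_multipliers b b'" and t: "t \<ge> 0"
  shows "has_tvs_derivative (\<lambda>t. mult_tempered (b t) u) (mult_tempered (b' t) u) t {0..}"
  unfolding has_tvs_derivative_def
proof (rule tendsto_tempered_of_entries)
  let ?\<chi> = "\<lambda>s j k \<phi>. (mult_test (entry j k (b s)) \<phi> - mult_test (entry j k (b t)) \<phi>) /\<^sub>R (s - t) - mult_test (entry j k (b' t)) \<phi>"
  note sl = C1_multipliers_slow_growth[OF b]
  show "\<forall>\<^sub>F s in at t within {0..}. \<forall>\<phi>. Rep_tempered ((mult_tempered (b s) u - mult_tempered (b t) u) /\<^sub>R (s - t) - mult_tempered (b' t) u) \<phi> =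
      (\<chi> j. \<Sum>k\<in>UNIV. Rep_tempered u (?\<chi> s j k \<phi>) $ k)"
    using eventually_within_nonneg
  proof eventually_elim
    case (elim s)
    then have s: "s \<ge> 0" by simp
    show ?case
      by (simp add: tempered_diff tempered_scaleR Rep_mult_tempered sl s t vec_eq_iff Rep_tempered_diff Rep_tempered_scaleR
          sum_subtractf scaleR_sum_right[symmetric])
  qed
  fix m and j k :: 'N
  obtain C q where C: "C \<ge> 0" "\<And>s r \<phi>. s \<in> {0..\<bar>t\<bar> + 1} \<Longrightarrow> r \<in> {0..\<bar>t\<bar> + 1} \<Longrightarrow> s \<noteq> r \<Longrightarrow>
      snorm m ((mult_test (entry j k (b s)) \<phi> - mult_test (entry j k (b r)) \<phi>) /\<^sub>R (s - r) - mult_test (entry j k (b' r)) \<phi>) \<le> C * \<bar>s - r\<bar> * snorm q \<phi>"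
    using snorm_bmult_Taylor[OF bounded_bilinear_mult, of "\<lambda>t. entry j k (b t)" "\<lambda>t. entry j k (b' t)" "\<bar>t\<bar> + 1" m]
      C1_multipliers_entry[OF b, of j k] unfolding C1_multipliers_def mult_test_bmult by metis
  have "\<forall>\<^sub>F s in at t within {0..}. \<forall>\<phi>. snorm m (?\<chi> s j k \<phi>) \<le> C * \<bar>s - t\<bar> * snorm q \<phi>"
    using eventually_within_nonneg by eventually_elim (use C t in auto)
  with C(1) show "\<exists>C q. C \<ge> 0 \<and> (\<forall>\<^sub>F s in at t within {0..}. \<forall>\<phi>. snorm m (?\<chi> s j k \<phi>) \<le> C * \<bar>s - t\<bar> * snorm q \<phi>)"
    by blast
qed

lemma continuous_on_mult_tempered_family:
  fixes b :: "real \<Rightarrow> real ^ 'n::finite \<Rightarrow> complex ^ 'N::finite ^ 'N"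
  assumes b: "C1_multipliers b b'"
  shows "continuous_on {0..} (\<lambda>t. mult_tempered (b' t) u)"
  unfolding continuous_on_def
proof (intro ballI)
  fix t :: real assume "t \<in> {0..}"
  then have t: "t \<ge> 0" by simp
  note sl = C1_multipliers_slow_growth[OF b]
  let ?\<chi> = "\<lambda>s j k \<phi>. mult_test (entry j k (b' s)) \<phi> - mult_test (entry j k (b' t)) \<phi>"
  show "((\<lambda>t. mult_tempered (b' t) u) \<longlongrightarrow> mult_tempered (b' t) u) (at t within {0..})"
  proof (rule tendsto_tempered_of_entries)
    show "\<forall>\<^sub>F s in at t within {0..}. \<forall>\<phi>. Rep_tempered (mult_tempered (b' s) u - mult_tempered (b' t) u) \<phi> =
        (\<chi> j. \<Sum>k\<in>UNIV. Rep_tempered u (?\<chi> s j k \<phi>) $ k)"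
      using eventually_within_nonneg
    proof eventually_elim
      case (elim s)
      then have s: "s \<ge> 0" by simp
      show ?case
        by (simp add: tempered_diff Rep_mult_tempered sl s t vec_eq_iff Rep_tempered_diff sum_subtractf)
    qed
    fix m and j k :: 'N
    obtain C q where C: "C \<ge> 0" "\<And>s r \<phi>. s \<in> {0..\<bar>t\<bar> + 1} \<Longrightarrow> r \<in> {0..\<bar>t\<bar> + 1} \<Longrightarrow>
        snorm m (mult_test (entry j k (b' s)) \<phi> - mult_test (entry j k (b' r)) \<phi>) \<le> C * \<bar>s - r\<bar> * snorm q \<phi>"
      using snorm_bmult_Lipschitz[OF bounded_bilinear_mult, of "\<lambda>t. entry j k (b' t)" "\<bar>t\<bar> + 1" m]
        C1_multipliers_entry[OF b, of j k] unfolding C1_multipliers_def mult_test_bmult by metis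
    have "\<forall>\<^sub>F s in at t within {0..}. \<forall>\<phi>. snorm m (?\<chi> s j k \<phi>) \<le> C * \<bar>s - t\<bar> * snorm q \<phi>"
      using eventually_within_nonneg by eventually_elim (use C t in auto)
    with C(1) show "\<exists>C q. C \<ge> 0 \<and> (\<forall>\<^sub>F s in at t within {0..}. \<forall>\<phi>. snorm m (?\<chi> s j k \<phi>) \<le> C * \<bar>s - t\<bar> * snorm q \<phi>)"
      by blast
  qed
qed

text \<open>The product rule for the pairing: the difference quotients of \<open>v\<close> converge uniformly on the bounded set of
  values of \<open>\<psi>\<close>.\<close>

lemma has_vector_derivative_pairing:
  assumes v: "has_tvs_derivative v d s S" and \<psi>: "has_tvs_derivative \<psi> e s S" and B: "vn_bounded (\<psi> ` S)"
  shows "((\<lambda>r. Rep_tempered (v r) (\<psi> r)) has_vector_derivative (Rep_tempered d (\<psi> s) + Rep_tempered (v s) e)) (at s within S)"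
proof (rule has_vector_derivative_quotientI)
  let ?F = "at s within S"
  let ?q = "\<lambda>r. (v r - v s) /\<^sub>R (r - s)" and ?p = "\<lambda>r. (\<psi> r - \<psi> s) /\<^sub>R (r - s)"
  have inS: "\<forall>\<^sub>F r in ?F. r \<in> S \<and> r \<noteq> s"
    by (simp add: eventually_at_filter)
  have functional: "((\<lambda>r. Rep_tempered w (?p r)) \<longlongrightarrow> Rep_tempered w e) ?F" for w
    using continuous_on_tendsto_compose[OF continuous_on_Rep_tempered \<psi>[unfolded has_tvs_derivative_def], of w] by simp
  have "((\<lambda>r. (r - s) *\<^sub>R Rep_tempered d (?p r)) \<longlongrightarrow> (s - s) *\<^sub>R Rep_tempered d e) ?F"
    by (intro tendsto_intros functional)
  then have "((\<lambda>r. (r - s) *\<^sub>R Rep_tempered d (?p r) + Rep_tempered d (\<psi> s)) \<longlongrightarrow> 0 + Rep_tempered d (\<psi> s)) ?F"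
    by (intro tendsto_intros) simp
  moreover have "\<forall>\<^sub>F r in ?F. (r - s) *\<^sub>R Rep_tempered d (?p r) + Rep_tempered d (\<psi> s) = Rep_tempered d (\<psi> r)"
    using inS by eventually_elim (simp add: Rep_tempered_scaleR Rep_tempered_diff)
  ultimately have lim2: "((\<lambda>r. Rep_tempered d (\<psi> r)) \<longlongrightarrow> Rep_tempered d (\<psi> s)) ?F"
    by (simp add: Lim_transform_eventually)
  have lim1: "((\<lambda>r. Rep_tempered (?q r - d) (\<psi> r)) \<longlongrightarrow> 0) ?F"
    unfolding tendsto_iff
  proof (intro allI impI)
    fix \<epsilon> :: real assume "\<epsilon> > 0"
    from tendsto_temperedD[OF v[unfolded has_tvs_derivative_def] B this] inS
    show "\<forall>\<^sub>F r in ?F. dist (Rep_tempered (?q r - d) (\<psi> r)) 0 < \<epsilon>"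
      by eventually_elim auto
  qed
  have "((\<lambda>r. Rep_tempered (?q r - d) (\<psi> r) + Rep_tempered d (\<psi> r) + Rep_tempered (v s) (?p r)) \<longlongrightarrow>
      0 + Rep_tempered d (\<psi> s) + Rep_tempered (v s) e) ?F"
    by (intro tendsto_add lim1 lim2 functional)
  moreover have "Rep_tempered (?q r - d) (\<psi> r) + Rep_tempered d (\<psi> r) + Rep_tempered (v s) (?p r) =
      (Rep_tempered (v r) (\<psi> r) - Rep_tempered (v s) (\<psi> s)) /\<^sub>R (r - s)" for r
    by (simp add: tempered_diff tempered_scaleR Rep_tempered_scaleR Rep_tempered_diff scaleR_diff_right)
  ultimately show "((\<lambda>r. (Rep_tempered (v r) (\<psi> r) - Rep_tempered (v s) (\<psi> s)) /\<^sub>R (r - s)) \<longlongrightarrow>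
      Rep_tempered d (\<psi> s) + Rep_tempered (v s) e) ?F"
    by simp
qed

lemma has_tvs_derivative_reverse:
  fixes u :: "real \<Rightarrow> ('n::finite, 'b::real_normed_vector) schwartz"
  assumes u: "has_tvs_derivative u d (t - s) {0..}" and s: "s \<in> {0..t}"
  shows "has_tvs_derivative (\<lambda>s. u (t - s)) (- d) s {0..t}"
proof -
  have "filterlim (\<lambda>r. t - r) (at (t - s) within {0..}) (at s within {0..t})"
    unfolding filterlim_at eventually_at_filter by (auto intro!: tendsto_intros)
  from filterlim_compose[OF u[unfolded has_tvs_derivative_def] this]
  have l: "((\<lambda>r. (u (t - r) - u (t - s)) /\<^sub>R (t - r - (t - s))) \<longlongrightarrow> d) (at s within {0..t})" .
  have "(u (t - r) - u (t - s)) /\<^sub>R (r - s) - - d = - ((u (t - r) - u (t - s)) /\<^sub>R (t - r - (t - s)) - d)" for r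
  proof -
    have "inverse (t - r - (t - s)) = - inverse (r - s)"
      unfolding inverse_minus_eq[symmetric] by (rule arg_cong[where f = inverse]) simp
    then show ?thesis by simp
  qed
  then have "snorm m ((u (t - r) - u (t - s)) /\<^sub>R (r - s) - - d) = snorm m ((u (t - r) - u (t - s)) /\<^sub>R (t - r - (t - s)) - d)" for r m
    by (simp only: snorm_minus)
  with l show ?thesis
    unfolding has_tvs_derivative_def tendsto_schwartz_iff by simp
qed

context exponential_multipliers
begin

lemma tempered_solution:
  fixes u :: "('n, 'N) tempered"
  shows "cauchy_solution (mult_tempered a) u (\<lambda>t. mult_tempered (E t) u)"
  unfolding cauchy_solution_def
proof (intro conjI exI[of _ "\<lambda>t. mult_tempered (\<lambda>x. a x ** E t x) u"] allI impI)
  show "has_tvs_derivative (\<lambda>t. mult_tempered (E t) u) (mult_tempered (\<lambda>x. a x ** E t x) u) t {0..}" if "0 \<le> t" for t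
    by (rule has_tvs_derivative_mult_tempered[OF E that])
  show "continuous_on {0..} (\<lambda>t. mult_tempered (\<lambda>x. a x ** E t x) u)"
    by (rule continuous_on_mult_tempered_family[OF E])
  show "mult_tempered (\<lambda>x. a x ** E t x) u - mult_tempered a (mult_tempered (E t) u) = 0" if "0 < t" for t
    using that by (simp add: mult_tempered_comp a slow_E)
  show "mult_tempered (E 0) u = u" by (simp add: E_zero mult_tempered_one)
qed

text \<open>For a solution \<open>v\<close> the curve \<open>s \<mapsto> T(t - s) v(s)\<close> joins \<open>T(t) u\<close> to \<open>v(t)\<close> and has derivative zero. It is differentiated
  entry by entry after pairing it with a test function.\<close>

lemma tempered_unique:
  fixes u :: "('n, 'N) tempered"
  assumes v: "cauchy_solution (mult_tempered a) u v" and t: "t \<ge> 0"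
  shows "v t = mult_tempered (E t) u"
proof (rule Rep_tempered_eqI)
  fix \<phi>
  obtain v' where v': "\<And>t. t \<ge> 0 \<Longrightarrow> has_tvs_derivative v (v' t) t {0..}" "\<And>t. t > 0 \<Longrightarrow> v' t = mult_tempered a (v t)"
    and v0: "v 0 = u" using v unfolding cauchy_solution_def by auto
  define \<psi> where "\<psi> j k s = mult_test (entry j k (E (t - s))) \<phi>" for j k s
  define \<psi>' where "\<psi>' j k s = - mult_test (entry j k (\<lambda>x. a x ** E (t - s) x)) \<phi>" for j k s
  have d\<psi>: "has_tvs_derivative (\<psi> j k) (\<psi>' j k s) s {0..t}" if s: "s \<in> {0..t}" for j k s
    unfolding \<psi>_def[abs_def] \<psi>'_def mult_test_bmult
    using s by (intro has_tvs_derivative_reverse has_tvs_derivative_bmult[OF bounded_bilinear_mult C1_multipliers_entry[OF E]]) auto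
  have B\<psi>: "vn_bounded (\<psi> j k ` {0..t})" for j k
  proof (rule vn_bounded_subset)
    have "bounded_growth E {0..t}" using E by (simp add: C1_multipliers_def)
    then show "vn_bounded (\<Union>r\<in>{0..t}. mult_test (entry j k (E r)) ` {\<phi>})"
      unfolding mult_test_bmult
      by (intro vn_bounded_bmult_family[OF bounded_bilinear_mult] bounded_growth_entry)
        (auto simp: vn_bounded_schwartz_iff)
    show "\<psi> j k ` {0..t} \<subseteq> (\<Union>r\<in>{0..t}. mult_test (entry j k (E r)) ` {\<phi>})"
      by (auto simp: \<psi>_def intro!: bexI[of _ "t - _"])
  qed
  have "Rep_tempered (v t) \<phi> $ j = Rep_tempered (mult_tempered (E t) u) \<phi> $ j" for j
  proof -
    define Z where "Z s = (\<Sum>k\<in>UNIV. Rep_tempered (v s) (\<psi> j k s) $ k)" for s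
    define Z' where "Z' s = (\<Sum>k\<in>UNIV. (Rep_tempered (v' s) (\<psi> j k s) + Rep_tempered (v s) (\<psi>' j k s)) $ k)" for s
    have Z: "Z s = Rep_tempered (mult_tempered (E (t - s)) (v s)) \<phi> $ j" if "s \<le> t" for s
      using that by (simp add: Z_def \<psi>_def Rep_mult_tempered slow_E)
    have "Z t = Z 0"
    proof (rule constant_of_zero_derivative[where Z = Z and Z' = Z', OF _ _ t])
      show "(Z has_vector_derivative Z' s) (at s within {0..t})" if s: "s \<in> {0..t}" for s
      proof -
        have "has_tvs_derivative v (v' s) s {0..t}"
          using s by (intro has_tvs_derivative_mono[OF v'(1)]) auto
        from has_vector_derivative_pairing[OF this d\<psi>[OF s] B\<psi>]
        have "((\<lambda>r. Rep_tempered (v r) (\<psi> j k r) $ k) has_vector_derivative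
            (Rep_tempered (v' s) (\<psi> j k s) + Rep_tempered (v s) (\<psi>' j k s)) $ k) (at s within {0..t})" for k
          by (rule bounded_linear.has_vector_derivative[OF bounded_linear_vec_nth])
        then show ?thesis
          unfolding Z_def[abs_def] Z'_def by (rule has_vector_derivative_sum)
      qed
      show "Z' s = 0" if s: "0 < s" "s \<le> t" for s
      proof -
        have ts: "t - s \<ge> 0" using s by simp
        have com: "(\<lambda>x. E (t - s) x ** a x) = (\<lambda>x. a x ** E (t - s) x)" by (simp add: E_commute)
        have "Z' s = Rep_tempered (mult_tempered (E (t - s)) (v' s)) \<phi> $ j - Rep_tempered (mult_tempered (\<lambda>x. a x ** E (t - s) x) (v s)) \<phi> $ j"
          by (simp add: Z'_def \<psi>_def \<psi>'_def Rep_mult_tempered slow_E[OF ts] slow_aE[OF ts]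
              linear_neg[OF linear_Rep_tempered] sum_subtractf)
        also have "mult_tempered (E (t - s)) (v' s) = mult_tempered (\<lambda>x. a x ** E (t - s) x) (v s)"
          unfolding v'(2)[OF s(1)] mult_tempered_comp[OF slow_E[OF ts] a] com ..
        finally show ?thesis by simp
      qed
    qed
    then show ?thesis using t by (simp add: Z E_zero mult_tempered_one v0)
  qed
  then show "Rep_tempered (v t) \<phi> = Rep_tempered (mult_tempered (E t) u) \<phi>" by (simp add: vec_eq_iff)
qed

lemma tempered_semigroup:
  "loc_unif_bounded_semigroup (\<lambda>t. mult_tempered (E t) :: ('n, 'N) tempered \<Rightarrow> ('n, 'N) tempered)"
  unfolding loc_unif_bounded_semigroup_def
proof (intro conjI allI impI)
  have bg: "bounded_growth E {0..T}" for T using E by (simp add: C1_multipliers_def)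
  show lin: "clinear (mult_tempered (E t))" if "0 \<le> t" for t
    by (rule clinear_mult_tempered[OF slow_E[OF that]])
  show "continuous_on UNIV (mult_tempered (E t))" if "0 \<le> t" for t
  proof (rule dual_controlled_continuous[OF _ clinear_imp_linear[OF lin[OF that]]])
    have "bounded_growth E {t}" using bg[of t] by (rule bounded_growth_subset) (use that in auto)
    from dual_controlled_mult_tempered[OF this] show "dual_controlled {mult_tempered (E t)}" by simp
  qed
  show "mult_tempered (E 0) = id" by (simp add: fun_eq_iff E_zero mult_tempered_one)
  show "mult_tempered (E (t + s)) = mult_tempered (E t) \<circ> mult_tempered (E s)" if "0 \<le> t" "0 \<le> s" for t s
  proof -
    have add: "E (t + s) = (\<lambda>x. E t x ** E s x)" by (rule ext) (rule E_add)
    show ?thesis unfolding add using that by (simp add: fun_eq_iff mult_tempered_comp slow_E)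
  qed
  show "bounded_operators ((\<lambda>t. mult_tempered (E t)) ` {0..T})" for T
    by (rule dual_controlled_bounded[OF dual_controlled_mult_tempered[OF bg]])
qed

end

section \<open>Transport along the Fourier transform\<close>

text \<open>Continuous linear maps commute with difference quotients and with their limits.\<close>

lemma cauchy_solution_intertwine:
  fixes K :: "'a::{real_vector, topological_space} \<Rightarrow> 'b::{real_vector, topological_space}"
  assumes lin: "linear K" and cont: "continuous_on UNIV K" and KA: "\<And>y. K (A y) = A' (K y)"
    and u: "cauchy_solution A x u"
  shows "cauchy_solution A' (K x) (\<lambda>t. K (u t))"
proof -
  obtain u' where u': "\<And>t. t \<ge> 0 \<Longrightarrow> has_tvs_derivative u (u' t) t {0..}" "continuous_on {0..} u'"
    "\<And>t. t > 0 \<Longrightarrow> u' t = A (u t)" "u 0 = x"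
    using u unfolding cauchy_solution_def by auto
  show ?thesis
    unfolding cauchy_solution_def
  proof (intro conjI exI[of _ "\<lambda>t. K (u' t)"] allI impI)
    show "has_tvs_derivative (\<lambda>t. K (u t)) (K (u' t)) t {0..}" if "0 \<le> t" for t
      using continuous_on_tendsto_compose[OF cont u'(1)[OF that, unfolded has_tvs_derivative_def]]
      by (simp add: has_tvs_derivative_def linear_diff[OF lin] linear_cmul[OF lin])
    show "continuous_on {0..} (\<lambda>t. K (u' t))"
      by (rule continuous_on_compose2[OF cont u'(2)]) simp
    show "K (u' t) - A' (K (u t)) = 0" if "0 < t" for t by (simp add: u'(3)[OF that] KA)
    show "K (u 0) = K x" by (simp add: u'(4))
  qed
qed

lemma clinear_compose: "clinear f \<Longrightarrow> clinear g \<Longrightarrow> clinear (\<lambda>x. f (g x))"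
  by (simp add: clinear_iff)

text \<open>A map of order four has its third power as inverse, so linearity and continuity of the inverse come with those of the map.\<close>

locale conjugation =
  fixes J :: "'a::{complex_vector, topological_space} \<Rightarrow> 'a"
  assumes J_clinear: "clinear J" and J_continuous: "continuous_on UNIV J"
    and J_four: "J (J (J (J x))) = x"
begin

definition J' :: "'a \<Rightarrow> 'a" where "J' x = J (J (J x))"

lemma J'_J [simp]: "J' (J x) = x" and J_J' [simp]: "J (J' x) = x"
  by (simp_all add: J'_def J_four)

lemma inv_J: "inv J = J'"
  by (rule inv_equality) simp_all

lemma J'_clinear: "clinear J'"
  unfolding J'_def[abs_def] by (rule clinear_compose[OF J_clinear clinear_compose[OF J_clinear J_clinear]])

lemma J'_continuous: "continuous_on UNIV J'"
proof -
  have "continuous_on UNIV (\<lambda>x. J (J x))"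
    by (rule continuous_on_compose2[OF J_continuous J_continuous]) simp
  then have "continuous_on UNIV (\<lambda>x. J (J (J x)))"
    by (rule continuous_on_compose2[OF J_continuous]) simp
  then show ?thesis by (simp add: J'_def[abs_def])
qed

lemma solution_conj:
  "cauchy_solution A (J x) w \<Longrightarrow> cauchy_solution (\<lambda>x. J' (A (J x))) x (\<lambda>t. J' (w t))"
  using cauchy_solution_intertwine[OF clinear_imp_linear[OF J'_clinear] J'_continuous, of A "\<lambda>x. J' (A (J x))" "J x" w]
  by simp

lemma solution_conj_back:
  "cauchy_solution (\<lambda>x. J' (A (J x))) x v \<Longrightarrow> cauchy_solution A (J x) (\<lambda>t. J (v t))"
  using cauchy_solution_intertwine[OF clinear_imp_linear[OF J_clinear] J_continuous, of "\<lambda>x. J' (A (J x))" A x v]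
  by simp

lemma unique_solution_conj:
  assumes sol: "\<And>x. cauchy_solution A x (\<lambda>t. T t x)"
    and uniq: "\<And>x v t. cauchy_solution A x v \<Longrightarrow> t \<ge> 0 \<Longrightarrow> v t = T t x"
  shows "\<exists>u. cauchy_solution (\<lambda>x. J' (A (J x))) x u \<and>
    (\<forall>v. cauchy_solution (\<lambda>x. J' (A (J x))) x v \<longrightarrow> (\<forall>t\<ge>0. v t = u t)) \<and>
    (\<forall>t\<ge>0. u t = J' (T t (J x)))"
proof (intro exI[of _ "\<lambda>t. J' (T t (J x))"] conjI allI impI)
  show "cauchy_solution (\<lambda>x. J' (A (J x))) x (\<lambda>t. J' (T t (J x)))"
    by (rule solution_conj[OF sol])
  fix v t assume "cauchy_solution (\<lambda>x. J' (A (J x))) x v" "0 \<le> (t::real)"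
  then have "J (v t) = T t (J x)" using uniq[OF solution_conj_back] by blast
  then show "v t = J' (T t (J x))" by (metis J'_J)
qed simp

lemma semigroup_conj:
  assumes T: "loc_unif_bounded_semigroup T"
  shows "loc_unif_bounded_semigroup (\<lambda>t x. J' (T t (J x)))"
  unfolding loc_unif_bounded_semigroup_def
proof (intro conjI allI impI)
  note T' = T[unfolded loc_unif_bounded_semigroup_def]
  show "clinear (\<lambda>x. J' (T t (J x)))" if "0 \<le> t" for t
  proof -
    have "clinear (T t)" using T' that by blast
    then have "clinear (\<lambda>x. T t (J x))" by (rule clinear_compose[OF _ J_clinear])
    then show ?thesis by (rule clinear_compose[OF J'_clinear])
  qed
  show "continuous_on UNIV (\<lambda>x. J' (T t (J x)))" if "0 \<le> t" for t
  proof -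
    have "continuous_on UNIV (T t)" using T' that by blast
    then have "continuous_on UNIV (\<lambda>x. T t (J x))"
      by (rule continuous_on_compose2[OF _ J_continuous]) simp
    then show ?thesis by (rule continuous_on_compose2[OF J'_continuous]) simp
  qed
  show "(\<lambda>x. J' (T 0 (J x))) = id" using T' by (simp add: fun_eq_iff)
  show "(\<lambda>x. J' (T (t + s) (J x))) = (\<lambda>x. J' (T t (J x))) \<circ> (\<lambda>x. J' (T s (J x)))" if "0 \<le> t" "0 \<le> s" for t s
  proof -
    have "T (t + s) = T t \<circ> T s" using T' that by blast
    then show ?thesis by (simp add: fun_eq_iff)
  qed
  show "bounded_operators ((\<lambda>t x. J' (T t (J x))) ` {0..T0})" if "0 < T0" for T0
    unfolding bounded_operators_def
  proof (intro allI impI)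
    fix B :: "'a set" assume "vn_bounded B"
    then have "vn_bounded (J ` B)"
      by (rule vn_bounded_image[OF linear_cmul[OF clinear_imp_linear[OF J_clinear]] J_continuous])
    then have "vn_bounded (\<Union>S\<in>T ` {0..T0}. S ` (J ` B))"
      using T' that unfolding bounded_operators_def by blast
    then have "vn_bounded (J' ` (\<Union>S\<in>T ` {0..T0}. S ` (J ` B)))"
      by (rule vn_bounded_image[OF linear_cmul[OF clinear_imp_linear[OF J'_clinear]] J'_continuous])
    also have "J' ` (\<Union>S\<in>T ` {0..T0}. S ` (J ` B)) = (\<Union>S\<in>(\<lambda>t x. J' (T t (J x))) ` {0..T0}. S ` B)"
      by (simp add: image_UN image_image)
    finally show "vn_bounded (\<Union>S\<in>(\<lambda>t x. J' (T t (J x))) ` {0..T0}. S ` B)" .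
  qed
qed

end

lemma Rep_fourier_tempered: "Rep_tempered (fourier_tempered u) \<phi> = Rep_tempered u (fourier \<phi>)"
proof -
  let ?f = "\<lambda>\<phi>. Rep_tempered u (fourier \<phi>)"
  have "clinear ?f" by (rule clinear_compose[OF Rep_tempered_clinear clinear_fourier])
  moreover have "continuous_on UNIV ?f"
    by (rule continuous_on_compose2[OF continuous_on_Rep_tempered continuous_on_fourier]) simp
  ultimately have "Rep_tempered (Abs_tempered ?f) = ?f" by (intro Abs_tempered_inverse) simp
  then show ?thesis by (simp add: fourier_tempered_def)
qed

lemma clinear_fourier_tempered: "clinear fourier_tempered"
  by (auto simp: clinear_iff Rep_fourier_tempered plus_tempered.rep_eq scaleC_tempered.rep_eq intro!: Rep_tempered_eqI)

lemma dual_controlled_fourier_tempered: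
  "dual_controlled {fourier_tempered :: ('n::finite, 'N::finite) tempered \<Rightarrow> _}"
  unfolding dual_controlled_def
proof (intro allI impI)
  fix B :: "('n, complex) schwartz set" assume "vn_bounded B"
  then have "vn_bounded (fourier ` B)"
    by (rule vn_bounded_image[OF linear_cmul[OF clinear_imp_linear[OF clinear_fourier]] continuous_on_fourier])
  then show "\<exists>B' C. vn_bounded B' \<and> (\<forall>T\<in>{fourier_tempered :: ('n, 'N) tempered \<Rightarrow> _}. \<forall>u A. A \<ge> 0 \<longrightarrow>
     (\<forall>\<psi>\<in>B'. norm (Rep_tempered u \<psi>) \<le> A) \<longrightarrow> (\<forall>\<phi>\<in>B. norm (Rep_tempered (T u) \<phi>) \<le> C * A))"
    by (intro exI[of _ "fourier ` B"] exI[of _ 1]) (auto simp: Rep_fourier_tempered)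
qed

interpretation fourier_schwartz: conjugation
  "fourier :: ('n::finite, 'b::{complex_normed_vector, banach, second_countable_topology}) schwartz \<Rightarrow> ('n, 'b) schwartz"
  by (rule conjugation.intro) (rule clinear_fourier continuous_on_fourier fourier_four_times)+

interpretation fourier_dual: conjugation
  "fourier_tempered :: ('n::finite, 'N::finite) tempered \<Rightarrow> ('n, 'N) tempered"
proof (rule conjugation.intro)
  show "clinear (fourier_tempered :: ('n, 'N) tempered \<Rightarrow> _)" by (rule clinear_fourier_tempered)
  then show "continuous_on UNIV (fourier_tempered :: ('n, 'N) tempered \<Rightarrow> _)"
    by (intro dual_controlled_continuous dual_controlled_fourier_tempered clinear_imp_linear)
  show "fourier_tempered (fourier_tempered (fourier_tempered (fourier_tempered u))) = u" for u :: "('n, 'N) tempered"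
    by (rule Rep_tempered_eqI) (simp add: Rep_fourier_tempered fourier_four_times)
qed

lemma op_schwartz_eq: "op_schwartz a = (\<lambda>\<phi>. fourier_schwartz.J' (mult_schwartz a (fourier \<phi>)))"
  unfolding op_schwartz_def[abs_def] fourier_schwartz.inv_J ..

lemma op_tempered_eq: "op_tempered a = (\<lambda>u. fourier_dual.J' (mult_tempered a (fourier_tempered u)))"
  unfolding op_tempered_def[abs_def] fourier_dual.inv_J ..

section \<open>The well-posedness theorem\<close>

lemma symbol_class_slow_growth:
  fixes a :: "real ^ 'n::finite \<Rightarrow> complex ^ 'N::finite ^ 'N"
  assumes "a \<in> symbol_class \<mu>"
  shows "slow_growth a"
  unfolding slow_growth_def
proof
  fix L
  have sm: "smooth a" using assms by (simp add: symbol_class_def)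
  \<comment> \<open>one exponent serves all orders, as differentiation only lowers the order of a symbol\<close>
  define m where "m = nat \<lceil>\<bar>\<mu>\<bar>\<rceil>"
  have m: "\<mu> - real k \<le> real m" for k unfolding m_def by linarith
  have "\<exists>C>0. \<forall>\<xi>. norm (mpartial (index_of is) a \<xi>) \<le> C * jbracket \<xi> powr (\<mu> - real (mi_order (index_of is :: nat ^ 'n)))" for "is"
    using assms by (simp add: symbol_class_def)
  then obtain C where C: "\<And>is. C is > 0"
    "\<And>is \<xi>. norm (iter_partial is a \<xi>) \<le> C is * jbracket \<xi> powr (\<mu> - real (length is))"
    unfolding mpartial_index_of[OF sm] mi_order_index_of by metis
  define D where "D = (\<Sum>is | length is \<le> L. C is)"
  have "norm (iter_partial is a \<xi>) \<le> D * jbracket \<xi> ^ m" if l: "length is \<le> L" for "is" \<xi>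
  proof -
    have "jbracket \<xi> powr (\<mu> - real (length is)) \<le> jbracket \<xi> powr real m"
      by (intro powr_mono m jbracket_ge_1)
    also have "\<dots> = jbracket \<xi> ^ m" by (simp add: powr_realpow jbracket_pos)
    finally have "C is * jbracket \<xi> powr (\<mu> - real (length is)) \<le> C is * jbracket \<xi> ^ m"
      using C(1) by (intro mult_left_mono) (auto intro: less_imp_le)
    also have "\<dots> \<le> D * jbracket \<xi> ^ m"
      unfolding D_def using l C(1) by (intro mult_right_mono member_le_sum) (auto simp: finite_lists_le jbracket_ge_0 intro: less_imp_le)
    finally show ?thesis using C(2)[of "is" \<xi>] by simp
  qed
  with sm show "\<exists>C m. growth_bound L C m a" unfolding growth_bound_def by blast
qed

text \<open>The definition of \<open>O_M\<close> asks for positive constants, hence the summands \<open>1\<close> in \<open>C + 1\<close> and \<open>m + 1\<close>.\<close>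

lemma slow_growth_O_M:
  fixes b :: "real ^ 'n::finite \<Rightarrow> complex ^ 'N::finite ^ 'N"
  assumes b: "slow_growth b"
  shows "b \<in> O_M"
  unfolding O_M_def
proof (intro CollectI conjI allI)
  show sm: "smooth b" using b unfolding slow_growth_def growth_bound_def by blast
  fix \<alpha> :: "nat ^ 'n"
  obtain "is" where "is": "\<alpha> = index_of is" using ex_list_index_of by metis
  obtain C m where C: "growth_bound (length is) C m b" using b unfolding slow_growth_def by blast
  have "norm (mpartial \<alpha> b \<xi>) \<le> (C + 1) * jbracket \<xi> powr (real m + 1)" for \<xi>
  proof -
    have "norm (mpartial \<alpha> b \<xi>) \<le> C * jbracket \<xi> ^ m"
      unfolding "is" mpartial_index_of[OF sm] by (rule growth_boundD[OF C order_refl])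
    also have "\<dots> \<le> (C + 1) * jbracket \<xi> ^ (m + 1)"
      using growth_bound_nonneg[OF C] by (intro mult_mono jbracket_power_mono) (auto simp: jbracket_ge_0)
    also have "jbracket \<xi> ^ (m + 1) = jbracket \<xi> powr (real m + 1)"
      using powr_realpow[OF jbracket_pos, of \<xi> "m + 1"] by (simp add: add.commute)
    finally show ?thesis .
  qed
  moreover have "C + 1 > 0" using growth_bound_nonneg[OF C] by simp
  moreover have "real m + 1 > 0" by simp
  ultimately show "\<exists>C>0. \<exists>m>0. \<forall>\<xi>. norm (mpartial \<alpha> b \<xi>) \<le> C * jbracket \<xi> powr m" by blast
qed

lemma exponential_multipliers_symexp:
  fixes a :: "real ^ 'n::finite \<Rightarrow> complex ^ 'N::finite ^ 'N"
  assumes a: "a \<in> symbol_class \<mu>" and q: "quasi_hyperbolic a"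
  shows "exponential_multipliers a (symexp a)"
proof
  show sl: "slow_growth a" by (rule symbol_class_slow_growth[OF a])
  show "C1_multipliers (symexp a) (\<lambda>t x. a x ** symexp a t x)"
    using sl unfolding slow_growth_def by (intro C1_multipliers_symexp q) blast
  show "symexp a 0 = (\<lambda>x. mat 1)" by (rule ext) (simp only: symexp_def matexp_zero)
  show "symexp a (s + t) x = symexp a s x ** symexp a t x" for s t x
    unfolding symexp_def by (rule matexp_add)
  show "a x ** symexp a t x = symexp a t x ** a x" for t x
    unfolding symexp_def by (rule matexp_commute)
  show "((\<lambda>t. symexp a t x) has_vector_derivative a x ** symexp a t x) (at t)" for t x
    unfolding symexp_def by (rule matexp_has_vector_derivative)
qed

theorem theorem2p2:
  fixes a :: "real ^ 'n::finite \<Rightarrow> complex ^ 'N::finite ^ 'N" and \<mu> :: real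
  assumes "a \<in> symbol_class \<mu>"
    and "quasi_hyperbolic a"
  shows "(\<forall>t\<ge>0. (\<lambda>\<xi>. matexp (t *\<^sub>R a \<xi>)) \<in> O_M) \<and>
    (\<forall>u0 :: ('n, 'N) tempered.
       \<exists>u. cauchy_solution (op_tempered a) u0 u \<and>
         (\<forall>v. cauchy_solution (op_tempered a) u0 v \<longrightarrow> (\<forall>t\<ge>0. v t = u t)) \<and>
         (\<forall>t\<ge>0. u t = op_tempered (\<lambda>\<xi>. matexp (t *\<^sub>R a \<xi>)) u0)) \<and>
    loc_unif_bounded_semigroup
      (\<lambda>t. op_tempered (\<lambda>\<xi>. matexp (t *\<^sub>R a \<xi>)) :: ('n, 'N) tempered \<Rightarrow> ('n, 'N) tempered) \<and>
    (\<forall>u0 :: ('n, complex ^ 'N) schwartz.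
       \<exists>u. cauchy_solution (op_schwartz a) u0 u \<and>
         (\<forall>v. cauchy_solution (op_schwartz a) u0 v \<longrightarrow> (\<forall>t\<ge>0. v t = u t)) \<and>
         (\<forall>t\<ge>0. u t = op_schwartz (\<lambda>\<xi>. matexp (t *\<^sub>R a \<xi>)) u0)) \<and>
    loc_unif_bounded_semigroup
      (\<lambda>t. op_schwartz (\<lambda>\<xi>. matexp (t *\<^sub>R a \<xi>)) ::
         ('n, complex ^ 'N) schwartz \<Rightarrow> ('n, complex ^ 'N) schwartz)"
proof -
  interpret exponential_multipliers a "symexp a"
    by (rule exponential_multipliers_symexp[OF assms])
  have E: "(\<lambda>\<xi>. matexp (t *\<^sub>R a \<xi>)) = symexp a t" for t
    by (rule ext) (simp only: symexp_def)
  show ?thesis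
    unfolding E
  proof (intro conjI allI impI)
    show "symexp a t \<in> O_M" if "0 \<le> t" for t
      by (rule slow_growth_O_M[OF slow_E[OF that]])
    show "\<exists>u. cauchy_solution (op_tempered a) u0 u \<and>
         (\<forall>v. cauchy_solution (op_tempered a) u0 v \<longrightarrow> (\<forall>t\<ge>0. v t = u t)) \<and>
         (\<forall>t\<ge>0. u t = op_tempered (symexp a t) u0)" for u0 :: "('n, 'N) tempered"
      unfolding op_tempered_eq by (rule fourier_dual.unique_solution_conj[where T = "\<lambda>t. mult_tempered (symexp a t)",
          OF tempered_solution]) (rule tempered_unique)
    show "loc_unif_bounded_semigroup (\<lambda>t. op_tempered (symexp a t) :: ('n, 'N) tempered \<Rightarrow> ('n, 'N) tempered)"
      unfolding op_tempered_eq by (rule fourier_dual.semigroup_conj[OF tempered_semigroup])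
    show "\<exists>u. cauchy_solution (op_schwartz a) u0 u \<and>
         (\<forall>v. cauchy_solution (op_schwartz a) u0 v \<longrightarrow> (\<forall>t\<ge>0. v t = u t)) \<and>
         (\<forall>t\<ge>0. u t = op_schwartz (symexp a t) u0)" for u0 :: "('n, complex ^ 'N) schwartz"
      unfolding op_schwartz_eq by (rule fourier_schwartz.unique_solution_conj[where T = "\<lambda>t. mult_schwartz (symexp a t)",
          OF schwartz_solution]) (rule schwartz_unique)
    show "loc_unif_bounded_semigroup (\<lambda>t. op_schwartz (symexp a t) :: ('n, complex ^ 'N) schwartz \<Rightarrow> ('n, complex ^ 'N) schwartz)"
      unfolding op_schwartz_eq by (rule fourier_schwartz.semigroup_conj[OF schwartz_semigroup])
  qed
qed

end
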